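(* (1) Let $\alpha\neq 0$ and $\beta$ be real numbers. The mapping $S^{\alpha,\beta}:A_\infty\to A_\infty$ is a linear operator admitting the simple representation $$S^{\alpha,\beta}f(t)=\left(\frac{1+\alpha\beta t}{\alpha}\right) f\left(\frac{\alpha^2 t}{1+\alpha\beta t}\right).$$ Furthermore, if $f\in A(a,b)$, then $S^{\alpha,\beta}f\in A(a_{\alpha,\beta},\, b^{f}_{\alpha,\beta})$, where $$a_{\alpha,\beta}=\begin{cases}\dfrac{a}{\alpha(\alpha-\beta a)} & \text{if }\alpha(\alpha-\beta a)>0,\\ +\infty&\text{otherwise,}\end{cases}\qquad b^{f}_{\alpha,\beta}=\begin{cases} b & \text{if }\alpha(\alpha-\beta b)>0,\\ \varrho\circ\tau f\left(\dfrac{\alpha}{\beta}\right)&\text{otherwise.}\end{cases}$$ (2) Let $\mu$ be a positive, not identically zero, Radon measure on $\mathbb{R}^+$. Then there exists a unique positive, increasing, concave and differentiable function $\mathfrak{f}$ with $\mathfrak{f}(0)=1$ which satisfies the nonlinear differential equation $$f^3 f''=-\mu(\tau f)$$ on $\mathbb{R}^+$, where $f''$ is the second derivative of $f$ considered in the sense of distributions. Furthermore, $\{S^{\alpha,\beta}\mathfrak{f}:\ \alpha>0,\ \beta\ge 0\}$ is the set of positive solutions of this equation.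
   Context: For a function $f$ whose reciprocal is square integrable on some (possibly infinite) interval of $\mathbb{R}^+$ with left endpoint $0$, $\tau f(t)=\int_0^t f^{-2}(s)\,ds$. For positive reals $a,b$, $A(a,b)$ is the set of continuous functions $f$ on $[0,a)$ such that $f$ or $-f$ is positive and $\tau f(a)=b$ (at the endpoint $\tau f(a)=\lim_{t\uparrow a}\tau f(t)$); the same notation is used when an index takes the value $+\infty$. $A_\infty=\bigcup_{a>0}\bigcup_{b>0}A(a,b)$ is the set of continuous functions of constant sign on some non-empty interval with left endpoint $0$. $\varrho g$ denotes the inverse function of a continuous monotone function $g$, i.e. $\varrho g\circ g(t)=t$; $\varrho\circ\tau f$ means $\varrho(\tau f)$. For $f\in A_\infty$: $$\Sigma f=\frac{1}{f(\varrho\circ\tau f)},\qquad \Pi^{\alpha,\beta}f=f\,(\alpha+\beta\,\tau f)\quad(\alpha\ne0,\ \beta\in\mathbb{R}),\qquad S^{\alpha,\beta}f=\Sigma\circ\Pi^{\alpha,-\beta}\circ\Sigma f .$$ Domains: if $f$ lives on $[0,a)$ with $\tau f(a)=b$, then $\Sigma f$ lives on $[0,b)$; $\Pi^{\alpha,\beta}f$ is considered on the maximal subinterval of $[0,a)$ starting at $0$ on which $\alpha+\beta\tau f$ does not vanish; the formula for $S^{\alpha,\beta}f(t)$ is for $t$ in the domain of $S^{\alpha,\beta}f$. Linearity of $S^{\alpha,\beta}$ is understood for linear combinations, of functions on a common interval $[0,a)$, that remain in $A_\infty$. In the differential equation, $\mu(\tau f)$ is the composition of $\mu$, viewed as a generalized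 function, with $\tau f$: if $\mu(dt)=h(t)dt$ it is the function $t\mapsto h(\tau f(t))$.
   Formalization: The index b^f is corrected to: b if α(α−βa)>0, otherwise τf(α/β). Uniqueness is among f with τf(+∞)=+∞, since S^{1,β}f with β>0 has all the other properties. Differentiability is claimed at 0 and wherever μ has no atom at τf(t), as f' jumps at atoms. *)

theory Defs
  imports "HOL-Analysis.Analysis"
begin

text \<open>
  The functions of the theory live on intervals \<open>[0,a)\<close> whose length \<open>a \<le> \<infinity>\<close> is part of
  the data and is changed by the operators. They are represented as partial maps, so that
  equality of maps is equality of functions together with their domains.
\<close>

type_synonym pfun = "real \<rightharpoonup> real"

abbreviation val :: "pfun \<Rightarrow> real \<Rightarrow> real" where
  "val f t \<equiv> the (f t)"

definition ival :: "ereal \<Rightarrow> real set" where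
  "ival a = {t. 0 \<le> t \<and> ereal t < a}"

definition tau :: "pfun \<Rightarrow> pfun" where
  "tau f = (\<lambda>t. if t \<in> dom f then Some (LBINT s:{0..t}. 1 / (val f s)\<^sup>2) else None)"

text \<open>Value of \<open>tau f\<close> at an extended real \<open>x > 0\<close>, by the left limit at the endpoint of the domain.\<close>

definition tau_at :: "pfun \<Rightarrow> ereal \<Rightarrow> ereal" where
  "tau_at f x =
     (if x \<in> ereal ` dom f then ereal (val (tau f) (real_of_ereal x))
      else Lim (at_left x) (\<lambda>y. ereal (val (tau f) (real_of_ereal y))))"

text \<open>Inverse of an injective partial map, with domain the range of the map.\<close>

definition rho :: "pfun \<Rightarrow> pfun" where
  "rho g = (\<lambda>u. if u \<in> ran g then Some (THE t. g t = Some u) else None)"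

text \<open>The class \<open>A(a,b)\<close>, for \<open>a\<close> and \<open>b\<close> in \<open>(0,\<infinity>]\<close>.\<close>

definition A_space :: "ereal \<Rightarrow> ereal \<Rightarrow> pfun set" where
  "A_space a b =
     {f. dom f = ival a \<and> continuous_on (ival a) (val f) \<and>
         ((\<forall>t\<in>ival a. val f t > 0) \<or> (\<forall>t\<in>ival a. - val f t > 0)) \<and>
         tau_at f a = b}"

definition A_inf :: "pfun set" where
  "A_inf = (\<Union>a\<in>{0<..}. \<Union>b\<in>{0<..}. A_space a b)"

definition Sigma_op :: "pfun \<Rightarrow> pfun" where
  "Sigma_op f = (\<lambda>t. map_option (\<lambda>y. 1 / y) ((f \<circ>\<^sub>m rho (tau f)) t))"

definition Pi_op :: "real \<Rightarrow> real \<Rightarrow> pfun \<Rightarrow> pfun" where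
  "Pi_op \<alpha> \<beta> f =
     (\<lambda>t. map_option (\<lambda>y. y * (\<alpha> + \<beta> * val (tau f) t)) (f t))
       |` {t. \<forall>s\<in>{0..t}. \<alpha> + \<beta> * val (tau f) s \<noteq> 0}"

definition S_op :: "real \<Rightarrow> real \<Rightarrow> pfun \<Rightarrow> pfun" where
  "S_op \<alpha> \<beta> = Sigma_op \<circ> Pi_op \<alpha> (- \<beta>) \<circ> Sigma_op"

definition lincomb :: "real \<Rightarrow> pfun \<Rightarrow> real \<Rightarrow> pfun \<Rightarrow> pfun" where
  "lincomb c f d g =
     (\<lambda>t. if t \<in> dom f \<inter> dom g then Some (c * val f t + d * val g t) else None)"

text \<open>
  The index \<open>a / (\<alpha> (\<alpha> - \<beta> a))\<close>. Extended real division would give \<open>\<infinity> / \<infinity> = 0\<close>, so the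
  case \<open>a = \<infinity>\<close> is given by its limit as \<open>a\<close> tends to \<open>\<infinity>\<close>.
\<close>

definition a_idx :: "real \<Rightarrow> real \<Rightarrow> ereal \<Rightarrow> ereal" where
  "a_idx \<alpha> \<beta> a =
     (if ereal \<alpha> * (ereal \<alpha> - ereal \<beta> * a) > 0 then
        (if a = \<infinity> then (if \<beta> = 0 then \<infinity> else ereal (- 1 / (\<alpha> * \<beta>)))
         else a / (ereal \<alpha> * (ereal \<alpha> - ereal \<beta> * a)))
      else \<infinity>)"

text \<open>
  The limit of the map \<open>tau (S_op \<alpha> \<beta> f)\<close> at the right endpoint, for \<open>f\<close> in \<open>A(a,b)\<close>. As
  \<open>tau (S_op \<alpha> \<beta> f) t = tau f (\<alpha>\<^sup>2 t / (1 + \<alpha> \<beta> t))\<close>, it is decided by the sign of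
  \<open>\<alpha> (\<alpha> - \<beta> a)\<close>. The variant with the sign of \<open>\<alpha> (\<alpha> - \<beta> b)\<close> and the value of \<open>rho (tau f)\<close> at
  \<open>\<alpha> / \<beta>\<close> is the rule for \<open>Pi_op \<alpha> (- \<beta>)\<close> and the length of its domain; with \<open>Sigma_op f\<close>,
  which lies in \<open>A(b,a)\<close> and has \<open>rho (tau (Sigma_op f)) = tau f\<close>, it becomes the one below. It
  fails for \<open>S_op 1 1 f\<close> and the constant function \<open>f = 1/2\<close> on \<open>[0,1/2)\<close>: there \<open>b = 2\<close>, the
  limit is \<open>2\<close>, and the variant gives \<open>1/4\<close>.
\<close>

definition b_idx :: "real \<Rightarrow> real \<Rightarrow> ereal \<Rightarrow> ereal \<Rightarrow> pfun \<Rightarrow> ereal" where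
  "b_idx \<alpha> \<beta> a b f =
     (if ereal \<alpha> * (ereal \<alpha> - ereal \<beta> * a) > 0 then b else tau_at f (ereal (\<alpha> / \<beta>)))"

text \<open>
  Regularity is automatic for Borel measures that are finite on the compact subsets of an
  interval.
\<close>

definition radon_on :: "real set \<Rightarrow> real measure \<Rightarrow> bool" where
  "radon_on X M \<longleftrightarrow> sets M = sets (restrict_space borel X) \<and>
     (\<forall>K. compact K \<and> K \<subseteq> X \<longrightarrow> emeasure M K < \<infinity>)"

text \<open>Smooth functions with compact support in \<open>(0,\<infinity>)\<close>.\<close>

definition test_fun :: "(real \<Rightarrow> real) \<Rightarrow> bool" where
  "test_fun \<psi> \<longleftrightarrow> (\<forall>n. (deriv ^^ n) \<psi> differentiable_on UNIV) \<and>
     (\<exists>c d. 0 < c \<and> c \<le> d \<and> (\<forall>x. x \<notin> {c..d} \<longrightarrow> \<psi> x = 0))"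

text \<open>
  The composition of a measure \<open>\<mu>\<close>, as a generalized function, with a diffeomorphism \<open>T\<close>, paired
  with a test function: for \<open>\<mu>(du) = h(u) du\<close> the substitution \<open>u = T t\<close> turns the integral
  into that of \<open>\<psi>(t) h(T t) dt\<close>. For \<open>T = tau f\<close> the range contains \<open>0 = T 0\<close>, where the
  derivative is irrelevant as test functions vanish at \<open>0\<close>.
\<close>

definition comp_pairing :: "real measure \<Rightarrow> pfun \<Rightarrow> (real \<Rightarrow> real) \<Rightarrow> real" where
  "comp_pairing \<mu> T \<psi> =
     (LINT u:ran T|\<mu>. \<psi> (val (rho T) u) * \<bar>deriv (val (rho T)) u\<bar>)"

text \<open>
  \<open>f\<^sup>3 f'' = - \<mu>(tau f)\<close> on \<open>[0,\<infinity>)\<close>, as generalized functions on \<open>(0,\<infinity>)\<close>. The product of the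
  continuous function \<open>f\<^sup>3\<close> with the distribution \<open>f''\<close> requires \<open>f''\<close> to be a measure, and the
  sign of the equation makes it \<open>- \<nu>\<close> with \<open>\<nu>\<close> positive where \<open>f\<close> is positive.
\<close>

definition solves_ode :: "real measure \<Rightarrow> pfun \<Rightarrow> bool" where
  "solves_ode \<mu> f \<longleftrightarrow> f \<in> A_inf \<and> dom f = {0..} \<and>
     (\<exists>\<nu>. radon_on {0<..} \<nu> \<and>
        (\<forall>\<psi>. test_fun \<psi> \<longrightarrow>
           (LBINT t:{0..}. val f t * (deriv ^^ 2) \<psi> t) = - (LINT t|\<nu>. \<psi> t)) \<and>
        (\<forall>\<psi>. test_fun \<psi> \<longrightarrow>
           - (LINT t|\<nu>. \<psi> t * (val f t) ^ 3) = - comp_pairing \<mu> (tau f) \<psi>))"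

definition pos_solution :: "real measure \<Rightarrow> pfun \<Rightarrow> bool" where
  "pos_solution \<mu> f \<longleftrightarrow> solves_ode \<mu> f \<and> (\<forall>t\<ge>0. val f t > 0)"

text \<open>
  The distinguished solution. Differentiability is required except at the points that
  \<open>tau f\<close> maps to atoms of \<open>\<mu>\<close>, where \<open>f'\<close> necessarily jumps; it is differentiability everywhere
  if \<open>\<mu>\<close> has no atoms. The solution is normalized by \<open>tau f (\<infinity>) = \<infinity>\<close>, that is, \<open>tau f\<close> maps
  \<open>[0,\<infinity>)\<close> onto the half-line carrying \<open>\<mu>\<close>: without this, \<open>S_op 1 \<beta> f\<close> for \<open>\<beta> > 0\<close> has all the
  other properties, too.
\<close>

definition distinguished_solution :: "real measure \<Rightarrow> pfun \<Rightarrow> bool" where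
  "distinguished_solution \<mu> f \<longleftrightarrow>
     pos_solution \<mu> f \<and> f \<in> A_space \<infinity> \<infinity> \<and> val f 0 = 1 \<and>
     mono_on {0..} (val f) \<and> concave_on {0..} (val f) \<and>
     (\<forall>t\<ge>0. t = 0 \<or> emeasure \<mu> {val (tau f) t} = 0 \<longrightarrow>
        val f differentiable (at t within {0..}))"

end

theory Submission
  imports Defs
begin

text \<open>
  The operator \<open>Sigma_op\<close> exchanges \<open>f\<close> on \<open>[0,a)\<close> with \<open>\<phi> = 1 / f \<circ> rho (tau f)\<close> on \<open>[0,b)\<close>, and
  \<open>tau\<close> with \<open>rho\<close>. The first part follows from \<open>tau (Pi_op \<alpha> (- \<beta>) g) = tau g / (\<alpha> (\<alpha> - \<beta> tau g))\<close>.

  Under the exchange, \<open>f\<^sup>3 f'' = - \<mu>(tau f)\<close> becomes \<open>\<phi>'' = \<phi> \<mu>\<close>. Integrated twice, this is a linear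
  Volterra equation, so a positive solution \<open>f\<close> exists for the initial data \<open>f(0) = 1\<close>, \<open>f'(0) = 0\<close>
  and is determined by its initial data in general. The operators \<open>S_op \<alpha> \<beta>\<close> preserve the twice
  integrated equation for \<open>f\<close>, by algebra alone, and carry given initial data to arbitrary ones. If the
  first solution lives on \<open>[0,L)\<close>, then \<open>S_op 1 (1 / L)\<close>, where \<open>1 / \<infinity> = 0\<close>, takes it to the distinguished one, from
  which \<open>S_op \<alpha> \<beta>\<close> with \<open>\<alpha> > 0\<close> and real \<open>\<beta>\<close> produces all others. For \<open>\<beta> < 0\<close> the function \<open>tau\<close>
  of the result tends to infinity in finite time, hence it is not a solution on \<open>[0,\<infinity>)\<close>.
\<close>

section \<open>Paths on half-open intervals\<close>

text \<open>The measure may have atoms, so \<open>f'\<close> may jump; this is why every argument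
  runs on equations integrated twice. Integrals against the measure extend over
  \<open>{0<..u}\<close>: open at 0, because test functions do not see an atom there, and closed at
  \<open>u\<close>, so that the slope is right continuous. Initial slope 0 is the starting point
  because the Volterra equation is then \<phi>(u) = 1 + integral of (u - s) \<phi>(s), with a
  nonnegative kernel. Hence \<phi> \<ge> 1 on the entire half-line, and the range of
  \<open>tau f\<close> is all of [0,\<infinity>). The price is that the length L of the domain, the
  integral of 1/\<phi>^2, may be finite. The index formulas show how \<open>S_op 1 \<beta>\<close>
  repairs this: \<beta> = 1/L is the one value for which the domain becomes infinite while the range
  of \<open>tau\<close> stays unbounded. A larger \<beta> makes the range of \<open>tau\<close>
  bounded, a smaller one makes the domain bounded. This trade-off also gives uniqueness under the
  normalization and the restriction to \<beta> \<ge> 0.\<close>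

lemma ival_PInf [simp]: "ival \<infinity> = {0..}"
  by (auto simp: ival_def)

lemma zero_mem_ival: "0 < a \<Longrightarrow> 0 \<in> ival a"
  by (auto simp: ival_def zero_ereal_def)

lemma ival_nonneg: "t \<in> ival a \<Longrightarrow> 0 \<le> t"
  by (auto simp: ival_def)

lemma ival_subset: "t \<in> ival a \<Longrightarrow> {0..t} \<subseteq> ival a"
  by (auto simp: ival_def intro: le_less_trans[rotated])

lemma ival_le: "t \<in> ival a \<Longrightarrow> 0 \<le> s \<Longrightarrow> s \<le> t \<Longrightarrow> s \<in> ival a"
  using ival_subset by fastforce

lemma ival_obtain_gt:
  assumes "t \<in> ival a"
  obtains t' where "t < t'" "t' \<in> ival a"
proof -
  have "ereal t < a" using assms by (auto simp: ival_def)
  then obtain y where y: "ereal t < y" "y < a" using dense by blast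
  then obtain r where "y = ereal r" by (cases y) auto
  with y assms that[of r] show thesis by (auto simp: ival_def)
qed

lemma ival_subset_ival: "ival a \<subseteq> ival b" if "a \<le> b"
  using that by (auto simp: ival_def)

lemma ival_inject:
  assumes "0 < a" "0 < b" "ival a = ival b" shows "a = b"
proof -
  have *: "x \<le> y" if "0 < x" "0 < y" "ival x = ival y" for x y :: ereal
  proof (rule ccontr)
    assume "\<not> x \<le> y"
    moreover have "y \<noteq> -\<infinity>" "y \<noteq> \<infinity>" using that \<open>\<not> x \<le> y\<close> by auto
    ultimately obtain r where "y = ereal r" by (cases y) auto
    then have "r \<in> ival x" "r \<notin> ival y"
      using \<open>\<not> x \<le> y\<close> \<open>0 < y\<close> by (auto simp: ival_def)
    then show False using that by simp
  qed
  show ?thesis by (rule antisym) (use * assms in auto)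
qed

lemma convex_ival: "convex (ival a)"
proof -
  have "is_interval (ival a)"
    unfolding is_interval_1 using ival_le ival_nonneg order_trans by blast
  then show ?thesis by (simp add: is_interval_convex_1)
qed

text \<open>Meant for the range of \<open>tau f\<close>: it has no maximum because
  \<open>tau f\<close> increases strictly and a half-open domain has no last point.\<close>

lemma eq_ival_Sup:
  assumes "0 \<in> I" "I \<subseteq> {0..}" "connected I" and nomax: "\<And>x. x \<in> I \<Longrightarrow> \<exists>y\<in>I. x < y"
  shows "I = ival (SUP x\<in>I. ereal x)"
proof
  show "I \<subseteq> ival (SUP x\<in>I. ereal x)"
  proof
    fix x assume "x \<in> I"
    then obtain y where "y \<in> I" "x < y" using nomax by blast
    then have "ereal x < (SUP x\<in>I. ereal x)" using less_SUP_iff ereal_less_eq by fastforce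
    then show "x \<in> ival (SUP x\<in>I. ereal x)" using assms(2) \<open>x \<in> I\<close> by (auto simp: ival_def)
  qed
  show "ival (SUP x\<in>I. ereal x) \<subseteq> I"
  proof
    fix x assume "x \<in> ival (SUP x\<in>I. ereal x)"
    then have "0 \<le> x" "ereal x < (SUP x\<in>I. ereal x)" by (auto simp: ival_def)
    then obtain y where "y \<in> I" "x < y" by (auto simp: less_SUP_iff)
    then show "x \<in> I" using assms(1,3) \<open>0 \<le> x\<close> connectedD_interval less_imp_le by metis
  qed
qed

lemma at_left_ereal_neq_bot:
  fixes a :: ereal
  assumes "0 < a" shows "at_left a \<noteq> bot"
proof
  assume "at_left a = bot"
  then have "eventually (\<lambda>_. False) (at_left a)" by simp
  then have "\<exists>b<a. \<forall>y>b. y < a \<longrightarrow> False"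
    by (rule eventually_at_left[OF assms, THEN iffD1])
  then obtain b where b: "b < a" "\<forall>y>b. y < a \<longrightarrow> False" by (elim exE conjE)
  obtain c where "b < c" "c < a" using dense[OF b(1)] by auto
  then show False using b(2) by simp
qed

lemma ival_interval: "s \<in> ival c \<Longrightarrow> t \<in> ival c \<Longrightarrow> {s..t} \<subseteq> ival c"
  using ival_subset[of t c] ival_nonneg[of s c] by auto

lemma at_within_ival: "t \<in> ival c \<Longrightarrow> 0 < t \<Longrightarrow> at t within ival c = at t"
proof -
  assume t: "t \<in> ival c" "0 < t"
  then obtain t' where t': "t < t'" "t' \<in> ival c" by (auto elim: ival_obtain_gt)
  have "at t within ival c = at t within UNIV"
    using t t' ival_subset[OF t'(2)] by (intro at_within_nhd[of _ "{0<..<t'}"]) auto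
  then show ?thesis by simp
qed

text \<open>The conditions of \<open>A_space\<close> without the one on \<open>tau_at\<close>. For
  the images of the operators that value is found only afterwards, from the range of
  \<open>tau\<close>.\<close>

locale path =
  fixes f :: pfun and a :: ereal
  assumes dom: "dom f = ival a" and a_pos: "0 < a"
    and cont: "continuous_on (ival a) (val f)"
    and sign: "(\<forall>t\<in>ival a. val f t > 0) \<or> (\<forall>t\<in>ival a. - val f t > 0)"
begin

abbreviation "\<tau> \<equiv> val (tau f)"
abbreviation "\<rho> \<equiv> val (rho (tau f))"

lemma f_eq_Some: "t \<in> ival a \<Longrightarrow> \<exists>y. f t = Some y"
  using dom by blast

lemma nonzero: "t \<in> ival a \<Longrightarrow> val f t \<noteq> 0"
  using sign by force

lemma dom_tau [simp]: "dom (tau f) = ival a"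
  unfolding tau_def dom_def using dom by auto

lemma tau_eq_Some: "t \<in> ival a \<Longrightarrow> \<exists>y. tau f t = Some y"
  using dom_tau by blast

lemma cont_inv_sq: "continuous_on (ival a) (\<lambda>s. 1 / (val f s)\<^sup>2)"
  using nonzero by (intro continuous_intros cont) auto

lemma tau_val: "t \<in> ival a \<Longrightarrow> \<tau> t = integral {0..t} (\<lambda>s. 1 / (val f s)\<^sup>2)"
  using dom continuous_on_subset[OF cont_inv_sq ival_subset]
  by (auto simp: tau_def intro!: set_borel_integral_eq_integral borel_integrable_atLeastAtMost')

lemma tau_0 [simp]: "\<tau> 0 = 0"
  using tau_val[OF zero_mem_ival[OF a_pos]] by simp

lemma tau_deriv:
  assumes t: "t \<in> ival a"
  shows "(\<tau> has_real_derivative 1 / (val f t)\<^sup>2) (at t within ival a)"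
proof -
  obtain t' where t': "t < t'" "t' \<in> ival a" using t by (rule ival_obtain_gt)
  have "((\<lambda>x. integral {0..x} (\<lambda>s. 1 / (val f s)\<^sup>2)) has_real_derivative 1 / (val f t)\<^sup>2)
      (at t within {0..t'})"
    using ival_subset[OF t'(2)] t t' ival_nonneg
    by (intro integral_has_real_derivative continuous_on_subset[OF cont_inv_sq]) auto
  moreover have "at t within {0..t'} = at t within ival a"
    using t t' ival_subset[OF t'(2)]
    by (intro at_within_nhd[of _ "{..<t'}"]) (auto dest: ival_nonneg)
  ultimately show ?thesis
    using has_field_derivative_transform_within[where g = \<tau> and S = "ival a" and d = 1] tau_val t
    by auto
qed

lemma tau_cont: "continuous_on (ival a) \<tau>"
  by (rule DERIV_continuous_on[OF tau_deriv])

lemma tau_DERIV: "t \<in> ival a \<Longrightarrow> 0 < t \<Longrightarrow> (\<tau> has_real_derivative 1 / (val f t)\<^sup>2) (at t)"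
  using tau_deriv[of t] by (simp add: at_within_ival)

lemma tau_less:
  assumes "s \<in> ival a" "t \<in> ival a" "s < t" shows "\<tau> s < \<tau> t"
proof (rule DERIV_pos_imp_increasing_open[where f = \<tau>, OF \<open>s < t\<close>])
  fix x assume "s < x" "x < t"
  then have "x \<in> ival a" "0 < x" using assms ival_le[OF assms(2), of x] ival_nonneg[of s a] by auto
  then show "\<exists>y. DERIV \<tau> x :> y \<and> 0 < y"
    using tau_DERIV[of x] nonzero[of x] by (intro exI[of _ "1 / (val f x)\<^sup>2"]) auto
next
  show "continuous_on {s..t} \<tau>"
    using assms by (intro continuous_on_subset[OF tau_cont] ival_interval)
qed

lemma tau_less_iff: "s \<in> ival a \<Longrightarrow> t \<in> ival a \<Longrightarrow> \<tau> s < \<tau> t \<longleftrightarrow> s < t"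
  using tau_less by (metis not_less_iff_gr_or_eq)

lemma tau_le_iff: "s \<in> ival a \<Longrightarrow> t \<in> ival a \<Longrightarrow> \<tau> s \<le> \<tau> t \<longleftrightarrow> s \<le> t"
  using tau_less_iff by (meson linorder_not_less)

lemma tau_eq_iff: "s \<in> ival a \<Longrightarrow> t \<in> ival a \<Longrightarrow> \<tau> s = \<tau> t \<longleftrightarrow> s = t"
  using tau_less by (metis not_less_iff_gr_or_eq)

lemma ran_tau_image: "ran (tau f) = \<tau> ` ival a"
proof -
  have "ran (tau f) = (\<lambda>t. the (tau f t)) ` dom (tau f)"
    by (force simp: ran_def dom_def image_iff)
  then show ?thesis by simp
qed

lemma ran_tau_ival: "ran (tau f) = ival (SUP x\<in>\<tau> ` ival a. ereal x)"
  unfolding ran_tau_image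
proof (rule eq_ival_Sup)
  show "0 \<in> \<tau> ` ival a" using tau_0 zero_mem_ival[OF a_pos] by (metis imageI)
  show "\<tau> ` ival a \<subseteq> {0..}"
    using tau_le_iff[OF zero_mem_ival[OF a_pos]] ival_nonneg by auto
  show "connected (\<tau> ` ival a)"
    by (intro connected_continuous_image tau_cont convex_connected convex_ival)
  show "\<exists>y\<in>\<tau> ` ival a. x < y" if x: "x \<in> \<tau> ` ival a" for x
  proof -
    obtain s where s: "s \<in> ival a" "x = \<tau> s" using x by blast
    obtain t where "s < t" "t \<in> ival a" using s(1) by (rule ival_obtain_gt)
    then show ?thesis using s tau_less by blast
  qed
qed

text \<open>The domain omits \<open>a\<close>, so \<open>tau_at\<close> takes its limit branch; by
  monotonicity the left limit is the supremum.\<close>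

lemma tau_at_endpoint: "tau_at f a = (SUP x\<in>\<tau> ` ival a. ereal x)" (is "_ = ?S")
proof -
  have "((\<lambda>y. ereal (\<tau> (real_of_ereal y))) \<longlongrightarrow> ?S) (at_left a)"
  proof (rule order_tendstoI)
    fix l assume "l < ?S"
    then obtain t where t: "t \<in> ival a" "l < ereal (\<tau> t)" by (auto simp: less_SUP_iff)
    have "eventually (\<lambda>y. ereal t < y \<and> y < a) (at_left a)"
      using t unfolding ival_def by (subst eventually_at_left[of "ereal t"]) auto
    then show "eventually (\<lambda>y. l < ereal (\<tau> (real_of_ereal y))) (at_left a)"
    proof eventually_elim
      case (elim y)
      then obtain r where r: "y = ereal r" by (cases y) auto
      have "0 \<le> t" using t ival_nonneg by auto
      then have "r \<in> ival a" using elim by (auto simp: r ival_def)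
      then have "\<tau> t < \<tau> r" using elim t by (auto simp: tau_less_iff r)
      then show ?case using t by (auto simp: r intro: less_trans)
    qed
  next
    fix u assume u: "?S < u"
    have "eventually (\<lambda>y. 0 < y \<and> y < a) (at_left a)"
      by (subst eventually_at_left[OF a_pos]) (use a_pos in blast)
    then show "eventually (\<lambda>y. ereal (\<tau> (real_of_ereal y)) < u) (at_left a)"
    proof eventually_elim
      case (elim y)
      then obtain r where r: "y = ereal r" by (cases y) auto
      then have "r \<in> ival a" using elim by (auto simp: r ival_def)
      then have "ereal (\<tau> r) \<le> ?S" by (auto intro: SUP_upper)
      then show ?case using u by (simp add: r)
    qed
  qed
  then have "Lim (at_left a) (\<lambda>y. ereal (\<tau> (real_of_ereal y))) = ?S"
    by (intro tendsto_Lim at_left_ereal_neq_bot a_pos)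
  moreover have "a \<notin> ereal ` dom f" by (auto simp: dom ival_def)
  ultimately show ?thesis by (simp add: tau_at_def)
qed

lemma ran_tau: "ran (tau f) = ival (tau_at f a)"
  by (simp add: ran_tau_ival tau_at_endpoint)

lemma tau_at_pos: "0 < tau_at f a"
proof -
  obtain t where "0 < t" "t \<in> ival a" using zero_mem_ival[OF a_pos] by (rule ival_obtain_gt)
  then have "\<tau> t \<in> ival (tau_at f a)" "0 < \<tau> t"
    using ran_tau_image ran_tau tau_less[OF zero_mem_ival[OF a_pos]] by auto
  then have "ereal 0 < ereal (\<tau> t)" "ereal (\<tau> t) < tau_at f a" by (auto simp: ival_def)
  then have "ereal 0 < tau_at f a" by (rule less_trans)
  then show ?thesis by (simp add: zero_ereal_def)
qed

text \<open>Endpoint values are read off from the range of \<open>tau f\<close>, because a nonempty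
  half-open interval determines its right end; no further limit has to be computed.\<close>

lemma tau_atI: "ran (tau f) = ival b \<Longrightarrow> 0 < b \<Longrightarrow> tau_at f a = b"
  using ran_tau tau_at_pos ival_inject by metis

lemma rho_eq_Some:
  assumes "t \<in> ival a" shows "rho (tau f) (\<tau> t) = Some t"
proof -
  have "(THE s. tau f s = Some (\<tau> t)) = t"
  proof (rule the_equality)
    fix s assume s: "tau f s = Some (\<tau> t)"
    then have "s \<in> ival a" using dom_tau by blast
    moreover have "\<tau> s = \<tau> t" using s by simp
    ultimately show "s = t" using assms by (simp add: tau_eq_iff)
  qed (use tau_eq_Some[OF assms] in auto)
  then show ?thesis using assms by (simp add: rho_def ran_tau_image)
qed

lemma rho_tau [simp]: "t \<in> ival a \<Longrightarrow> \<rho> (\<tau> t) = t"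
  by (simp add: rho_eq_Some)

lemma dom_rho: "dom (rho (tau f)) = ran (tau f)"
  by (auto simp: rho_def dom_def)

text \<open>The device by which closed formulas for \<open>tau\<close> of a transformed map are
  verified: differentiate the candidate and check its value at 0.\<close>

lemma tau_eqI:
  assumes G: "continuous_on (ival a) G" "G 0 = 0"
    and deriv: "\<And>t. t \<in> ival a \<Longrightarrow> 0 < t \<Longrightarrow> (G has_real_derivative 1 / (val f t)\<^sup>2) (at t)"
    and t: "t \<in> ival a"
  shows "\<tau> t = G t"
proof (cases "t = 0")
  case False
  then have "0 < t" using t ival_nonneg by force
  have "(\<tau> t - G t) = (\<tau> 0 - G 0)"
  proof (rule DERIV_isconst_end[where f = "\<lambda>t. \<tau> t - G t", OF \<open>0 < t\<close>])
    show "continuous_on {0..t} (\<lambda>t. \<tau> t - G t)"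
      by (intro continuous_intros continuous_on_subset[OF tau_cont] continuous_on_subset[OF G(1)]
          ival_subset t)
    show "((\<lambda>t. \<tau> t - G t) has_real_derivative 0) (at x)" if "0 < x" "x < t" for x
      using DERIV_diff[OF tau_DERIV deriv] that ival_le[OF t, of x] by force
  qed
  then show ?thesis using G by simp
qed (use G in simp)

end

locale A_path = path +
  fixes b :: ereal
  assumes tau_at_eq: "tau_at f a = b"
begin

lemma b_pos: "0 < b"
  using tau_at_pos tau_at_eq by simp

lemma tau_image: "\<tau> ` ival a = ival b"
  using ran_tau ran_tau_image tau_at_eq by simp

lemma ran_tau_eq: "ran (tau f) = ival b"
  using ran_tau tau_at_eq by simp

lemma tau_mem: "t \<in> ival a \<Longrightarrow> \<tau> t \<in> ival b"
  using tau_image by auto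

lemma tau_nonneg: "t \<in> ival a \<Longrightarrow> 0 \<le> \<tau> t"
  using tau_mem ival_nonneg by auto

lemma tau_obtain:
  assumes "u \<in> ival b" obtains t where "t \<in> ival a" "u = \<tau> t"
  using assms unfolding tau_image[symmetric] by blast

lemma rho_mem: "u \<in> ival b \<Longrightarrow> \<rho> u \<in> ival a"
  by (erule tau_obtain) simp

lemma tau_rho [simp]: "u \<in> ival b \<Longrightarrow> \<tau> (\<rho> u) = u"
  by (erule tau_obtain) simp

lemma rho_0 [simp]: "\<rho> 0 = 0"
  using rho_tau[OF zero_mem_ival[OF a_pos]] by simp

lemma rho_le_iff: "u \<in> ival b \<Longrightarrow> t \<in> ival a \<Longrightarrow> \<rho> u \<le> t \<longleftrightarrow> u \<le> \<tau> t"
  using tau_le_iff[OF rho_mem] by simp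

lemma rho_less_iff: "u \<in> ival b \<Longrightarrow> v \<in> ival b \<Longrightarrow> \<rho> u < \<rho> v \<longleftrightarrow> u < v"
  using tau_less_iff[OF rho_mem rho_mem] by simp

text \<open>A continuous injection has a continuous inverse on a compact domain; hence the passage
  to \<open>{0..t'}\<close> with \<open>t'\<close> beyond \<open>\<rho> u\<close>, whose image
  contains a relative neighbourhood of \<open>u\<close>.\<close>

lemma rho_cont: "continuous_on (ival b) \<rho>"
  unfolding continuous_on_eq_continuous_within
proof
  fix u assume u: "u \<in> ival b"
  obtain t' where t': "\<rho> u < t'" "t' \<in> ival a" using rho_mem[OF u] by (rule ival_obtain_gt)
  have less: "u < \<tau> t'" using t' tau_less[OF rho_mem[OF u]] u by auto
  have im: "\<tau> ` {0..t'} = {0..\<tau> t'}"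
  proof
    show "\<tau> ` {0..t'} \<subseteq> {0..\<tau> t'}"
      using tau_le_iff tau_nonneg t' ival_le[OF t'(2)] by auto
    show "{0..\<tau> t'} \<subseteq> \<tau> ` {0..t'}"
    proof
      fix v assume "v \<in> {0..\<tau> t'}"
      moreover from this have "v \<in> ival b" using ival_subset[OF tau_mem[OF t'(2)]] by auto
      ultimately have "\<rho> v \<in> {0..t'}" "\<tau> (\<rho> v) = v"
        using rho_le_iff[of v t'] t' ival_nonneg[OF rho_mem, of v] by auto
      then show "v \<in> \<tau> ` {0..t'}" by (metis imageI)
    qed
  qed
  have "continuous_on {0..\<tau> t'} \<rho>"
    unfolding im[symmetric] using ival_subset[OF t'(2)]
    by (intro continuous_on_inv continuous_on_subset[OF tau_cont]) auto
  then have "continuous (at u within {0..\<tau> t'}) \<rho>"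
    using less ival_nonneg[OF u] by (simp add: continuous_on_eq_continuous_within)
  moreover have "at u within {0..\<tau> t'} = at u within ival b"
    using less ival_subset[OF tau_mem[OF t'(2)]]
    by (intro at_within_nhd[of _ "{..<\<tau> t'}"]) (auto dest: ival_nonneg)
  ultimately show "continuous (at u within ival b) \<rho>" by simp
qed

lemma rho_DERIV:
  assumes u: "u \<in> ival b" "0 < u"
  shows "(\<rho> has_real_derivative (val f (\<rho> u))\<^sup>2) (at u)"
proof -
  obtain u' where u': "u < u'" "u' \<in> ival b" using u by (auto elim: ival_obtain_gt)
  have pos: "0 < \<rho> u" using rho_less_iff[OF zero_mem_ival[OF b_pos] u(1)] u by simp
  have "(\<rho> has_real_derivative inverse (1 / (val f (\<rho> u))\<^sup>2)) (at u)"
  proof (rule DERIV_inverse_function[of \<tau> _ _ _ 0 u'])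
    show "isCont \<rho> u" using rho_cont u at_within_ival[of u b]
      by (auto simp: continuous_on_eq_continuous_within)
    show "\<tau> (\<rho> y) = y" if "0 < y" "y < u'" for y
      using ival_le[OF u'(2), of y] that by simp
  qed (use u u' pos tau_DERIV[OF rho_mem[OF u(1)]] nonzero[OF rho_mem[OF u(1)]]
      ival_subset[OF u'(2)] in auto)
  then show ?thesis by (simp add: inverse_eq_divide)
qed

lemma f_rho_cont: "continuous_on (ival b) (\<lambda>u. val f (\<rho> u))"
  by (rule continuous_on_compose2[OF cont rho_cont]) (auto simp: rho_mem)

end

lemma A_space_iff: "f \<in> A_space a b \<longleftrightarrow> A_path f a b" if "0 < a"
  using that by (auto simp: A_space_def A_path_def path_def A_path_axioms_def)

lemma A_inf_iff: "f \<in> A_inf \<longleftrightarrow> (\<exists>a b. A_path f a b)"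
  using A_space_iff A_path.b_pos A_path.axioms(1) path.a_pos
  by (fastforce simp: A_inf_def)

section \<open>The operators\<close>

lemma pfun_eqI:
  fixes f g :: pfun
  assumes "dom f = dom g" "\<And>t. t \<in> dom f \<Longrightarrow> val f t = val g t"
  shows "f = g"
proof
  fix t show "f t = g t"
    using assms by (cases "t \<in> dom f") (force simp: dom_def set_eq_iff)+
qed

context A_path
begin

lemma rho_Some: "u \<in> ival b \<Longrightarrow> \<exists>t. rho (tau f) u = Some t"
  using dom_rho ran_tau_eq by blast

lemma dom_Sigma: "dom (Sigma_op f) = ival b"
proof -
  have "Sigma_op f u \<noteq> None \<longleftrightarrow> u \<in> ival b" for u
    using rho_Some[of u] rho_mem[of u] f_eq_Some[of "\<rho> u"] dom_rho ran_tau_eq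
    by (cases "u \<in> ival b") (auto simp: Sigma_op_def map_comp_def split: option.splits)
  then show ?thesis by (auto simp: dom_def)
qed

lemma val_Sigma: "u \<in> ival b \<Longrightarrow> val (Sigma_op f) u = 1 / val f (\<rho> u)"
  using rho_Some[of u] rho_mem[of u] f_eq_Some[of "\<rho> u"]
  by (auto simp: Sigma_op_def map_comp_def)

lemma path_Sigma: "path (Sigma_op f) b"
proof
  show "continuous_on (ival b) (val (Sigma_op f))"
    using nonzero rho_mem
    by (subst continuous_on_cong[OF refl val_Sigma]) (auto intro!: continuous_intros f_rho_cont)
  show "(\<forall>t\<in>ival b. 0 < val (Sigma_op f) t) \<or> (\<forall>t\<in>ival b. 0 < - val (Sigma_op f) t)"
    using sign rho_mem by (auto simp: val_Sigma)
qed (simp_all add: dom_Sigma b_pos)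

text \<open>By the inverse function rule the derivative of \<open>\<rho>\<close> is the square of
  \<open>val f (\<rho> u)\<close>, that is, the inverse square of the value of
  \<open>Sigma_op f\<close>.\<close>

lemma tau_Sigma: "u \<in> ival b \<Longrightarrow> val (tau (Sigma_op f)) u = \<rho> u"
  using rho_DERIV nonzero[OF rho_mem]
  by (intro path.tau_eqI[OF path_Sigma] rho_cont) (auto simp: val_Sigma power_divide)

lemma A_path_Sigma: "A_path (Sigma_op f) b a"
proof -
  interpret S: path "Sigma_op f" b by (rule path_Sigma)
  have "ran (tau (Sigma_op f)) = \<rho> ` ival b"
    unfolding S.ran_tau_image by (auto simp: tau_Sigma)
  also have "\<dots> = ival a"
  proof -
    have "t \<in> \<rho> ` ival b" if "t \<in> ival a" for t
      using that tau_mem by (intro image_eqI[of _ _ "\<tau> t"]) auto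
    then show ?thesis using rho_mem by auto
  qed
  finally show ?thesis
    by unfold_locales (rule S.tau_atI[OF _ a_pos])
qed

lemma rho_Sigma: "t \<in> ival a \<Longrightarrow> val (rho (tau (Sigma_op f))) t = \<tau> t"
proof -
  assume t: "t \<in> ival a"
  interpret S: A_path "Sigma_op f" b a by (rule A_path_Sigma)
  show ?thesis
    using S.rho_tau[OF tau_mem[OF t]] tau_Sigma[OF tau_mem[OF t]] t by simp
qed

end

section \<open>Fractional linear changes of variable on half-open intervals\<close>

lemma Moebius_inverse:
  fixes \<alpha> \<beta> v t :: real
  assumes \<alpha>: "\<alpha> \<noteq> 0" and v: "\<alpha> - \<beta> * v \<noteq> 0" and t: "t = v / (\<alpha> * (\<alpha> - \<beta> * v))"
  shows "1 + \<alpha> * \<beta> * t = \<alpha> / (\<alpha> - \<beta> * v)" "\<alpha>\<^sup>2 * t / (1 + \<alpha> * \<beta> * t) = v"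
proof -
  show *: "1 + \<alpha> * \<beta> * t = \<alpha> / (\<alpha> - \<beta> * v)"
    using \<alpha> v by (simp add: t divide_simps)
  show "\<alpha>\<^sup>2 * t / (1 + \<alpha> * \<beta> * t) = v"
    unfolding * using \<alpha> v by (simp add: t divide_simps power2_eq_square)
qed

text \<open>At \<open>v = 0\<close> the product is the square of \<alpha>, so its positivity
  describes the component of 0 in the set where \<open>\<alpha> - \<beta> * v\<close> does not
  vanish, for both signs of \<alpha> at once.\<close>

definition sign_set :: "real \<Rightarrow> real \<Rightarrow> ereal \<Rightarrow> real set" where
  "sign_set \<alpha> \<beta> a = {v \<in> ival a. 0 < \<alpha> * (\<alpha> - \<beta> * v)}"

lemma affine_nonvanishing:
  fixes \<alpha> \<beta> v :: real
  assumes "\<alpha> \<noteq> 0" "0 \<le> v"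
  shows "(\<forall>w\<in>{0..v}. \<alpha> - \<beta> * w \<noteq> 0) \<longleftrightarrow> 0 < \<alpha> * (\<alpha> - \<beta> * v)"
proof
  assume L: "\<forall>w\<in>{0..v}. \<alpha> - \<beta> * w \<noteq> 0"
  show "0 < \<alpha> * (\<alpha> - \<beta> * v)"
  proof (rule ccontr)
    assume "\<not> 0 < \<alpha> * (\<alpha> - \<beta> * v)"
    then have "\<exists>w\<ge>0. w \<le> v \<and> \<alpha> * (\<alpha> - \<beta> * w) = 0"
      using assms by (intro IVT2) (auto simp: power2_eq_square[symmetric] intro!: continuous_intros)
    then show False using L assms by auto
  qed
next
  assume R: "0 < \<alpha> * (\<alpha> - \<beta> * v)"
  show "\<forall>w\<in>{0..v}. \<alpha> - \<beta> * w \<noteq> 0"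
  proof (intro ballI notI)
    fix w assume w: "w \<in> {0..v}" "\<alpha> - \<beta> * w = 0"
    have "0 < w" using w assms by (cases "w = 0") auto
    \<comment> \<open>The factor \<open>w\<close> brings in \<open>\<beta> * w\<close>, which equals
      \<alpha> at a zero \<open>w\<close>; this avoids a case split on signs.\<close>
    have "\<alpha> * (\<alpha> - \<beta> * v) * w = \<alpha> * (\<alpha> * w - (\<beta> * w) * v)" by (simp add: algebra_simps)
    also have "\<dots> = \<alpha>\<^sup>2 * (w - v)" using w by (simp add: algebra_simps power2_eq_square)
    also have "\<dots> \<le> 0" using w by (simp add: mult_nonneg_nonpos)
    finally show False using mult_pos_pos[OF R \<open>0 < w\<close>] by linarith
  qed
qed

text \<open>Division by the square of \<alpha> turns the sign condition into
  \<open>\<beta> / \<alpha> * v < 1\<close>, which depends on the ratio only. If it fails at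
  \<open>a\<close>, the ratio is positive and its inverse is the zero at which the interval
  stops.\<close>

lemma sign_set_eq:
  assumes "\<alpha> \<noteq> 0" "0 < a"
  shows "ereal \<alpha> * (ereal \<alpha> - ereal \<beta> * a) > 0 \<Longrightarrow> sign_set \<alpha> \<beta> a = ival a"
    and "\<not> ereal \<alpha> * (ereal \<alpha> - ereal \<beta> * a) > 0 \<Longrightarrow>
      sign_set \<alpha> \<beta> a = ival (ereal (\<alpha> / \<beta>)) \<and> 0 < \<alpha> / \<beta> \<and> ereal (\<alpha> / \<beta>) \<le> a"
proof -
  have *: "0 < \<alpha> * (\<alpha> - \<beta> * v) \<longleftrightarrow> \<beta> / \<alpha> * v < 1" for v
  proof -
    have "\<alpha> * (\<alpha> - \<beta> * v) = \<alpha>\<^sup>2 * (1 - \<beta> / \<alpha> * v)"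
      using assms by (simp add: field_simps power2_eq_square)
    then show ?thesis using assms by (simp add: zero_less_mult_iff)
  qed
  have **: "ereal \<alpha> * (ereal \<alpha> - ereal \<beta> * a) > 0 \<longleftrightarrow>
    (if a = \<infinity> then \<beta> / \<alpha> \<le> 0 else \<beta> / \<alpha> * real_of_ereal a < 1)"
  proof (cases a)
    case PInf
    then show ?thesis using assms
      by (cases \<alpha> "0::real" rule: linorder_cases; cases \<beta> "0::real" rule: linorder_cases)
        (auto simp: zero_less_mult_iff field_simps)
  qed (use assms * in auto)
  show "sign_set \<alpha> \<beta> a = ival a" if "ereal \<alpha> * (ereal \<alpha> - ereal \<beta> * a) > 0"
  proof -
    have "\<beta> / \<alpha> * v < 1" if v: "v \<in> ival a" for v
    proof (cases "\<beta> / \<alpha> \<le> 0")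
      case True
      then show ?thesis using ival_nonneg[OF v] by (meson le_less_trans mult_nonpos_nonneg zero_less_one)
    next
      case False
      then have "a \<noteq> \<infinity>" "\<beta> / \<alpha> * real_of_ereal a < 1"
        using ** \<open>ereal \<alpha> * (ereal \<alpha> - ereal \<beta> * a) > 0\<close> by (auto split: if_splits)
      moreover have "v \<le> real_of_ereal a" using v \<open>a \<noteq> \<infinity>\<close> by (cases a) (auto simp: ival_def)
      ultimately show ?thesis using False mult_left_mono[of v "real_of_ereal a" "\<beta> / \<alpha>"] by linarith
    qed
    then show ?thesis by (auto simp: sign_set_def *)
  qed
  show "sign_set \<alpha> \<beta> a = ival (ereal (\<alpha> / \<beta>)) \<and> 0 < \<alpha> / \<beta> \<and> ereal (\<alpha> / \<beta>) \<le> a"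
    if n: "\<not> ereal \<alpha> * (ereal \<alpha> - ereal \<beta> * a) > 0"
  proof -
    have pos: "0 < \<beta> / \<alpha>"
    proof (rule ccontr)
      assume "\<not> 0 < \<beta> / \<alpha>"
      then have "\<beta> / \<alpha> * real_of_ereal a \<le> 0" using assms
        by (intro mult_nonpos_nonneg) (auto simp: real_of_ereal_pos)
      then show False using n ** \<open>\<not> 0 < \<beta> / \<alpha>\<close> by (auto split: if_splits)
    qed
    have le: "ereal (\<alpha> / \<beta>) \<le> a"
    proof (cases a)
      case (real r)
      then have "1 \<le> \<beta> / \<alpha> * r" using n ** by auto
      then show ?thesis using pos real by (auto simp: field_simps zero_less_divide_iff split: if_splits)
    qed (use assms in auto)
    have "\<beta> / \<alpha> * v < 1 \<longleftrightarrow> v < \<alpha> / \<beta>" for v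
      using pos by (auto simp: field_simps zero_less_divide_iff)
    then have "sign_set \<alpha> \<beta> a = ival (ereal (\<alpha> / \<beta>))"
      using ival_subset_ival[OF le] by (auto simp: sign_set_def * ival_def)
    then show ?thesis using pos le by (auto simp: zero_less_divide_iff)
  qed
qed

lemma a_idx_real:
  "0 < \<alpha> * (\<alpha> - \<beta> * r) \<Longrightarrow> a_idx \<alpha> \<beta> (ereal r) = ereal (r / (\<alpha> * (\<alpha> - \<beta> * r)))"
  by (cases "\<alpha> = 0 \<or> \<alpha> = \<beta> * r") (auto simp: a_idx_def)

text \<open>This map expresses \<open>tau\<close> of \<open>Pi_op \<alpha> (- \<beta>) f\<close>
  through \<open>tau f\<close>. Its derivative \<open>1 / (\<alpha> - \<beta> * v)^2\<close> is
  positive, so the image is again half-open and ends at the limit \<open>a_idx\<close>, which is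
  infinite when the denominator tends to 0.\<close>

lemma Moebius_image:
  assumes \<alpha>: "\<alpha> \<noteq> 0" and a: "0 < a"
  shows "(\<lambda>v. v / (\<alpha> * (\<alpha> - \<beta> * v))) ` sign_set \<alpha> \<beta> a = ival (a_idx \<alpha> \<beta> a)"
proof
  show "(\<lambda>v. v / (\<alpha> * (\<alpha> - \<beta> * v))) ` sign_set \<alpha> \<beta> a \<subseteq> ival (a_idx \<alpha> \<beta> a)"
  proof safe
    fix v assume "v \<in> sign_set \<alpha> \<beta> a"
    then have v: "v \<in> ival a" "0 < \<alpha> * (\<alpha> - \<beta> * v)" "0 \<le> v"
      by (auto simp: sign_set_def ival_nonneg)
    have "ereal (v / (\<alpha> * (\<alpha> - \<beta> * v))) < a_idx \<alpha> \<beta> a"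
    proof (cases a)
      case (real r)
      have "v / (\<alpha> * (\<alpha> - \<beta> * v)) < r / (\<alpha> * (\<alpha> - \<beta> * r))" if "0 < \<alpha> * (\<alpha> - \<beta> * r)"
      proof -
        have "\<alpha>\<^sup>2 * v < \<alpha>\<^sup>2 * r" using v real \<alpha> by (auto simp: ival_def)
        then have "v * (\<alpha> * (\<alpha> - \<beta> * r)) < r * (\<alpha> * (\<alpha> - \<beta> * v))"
          by (simp add: algebra_simps power2_eq_square)
        then show ?thesis
          by (simp only: pos_divide_less_eq[OF v(2)] times_divide_eq_left pos_less_divide_eq[OF that])
      qed
      then show ?thesis using real by (auto simp: a_idx_def)
    next
      case PInf
      have "v / (\<alpha> * (\<alpha> - \<beta> * v)) < - 1 / (\<alpha> * \<beta>)"
        if "\<beta> \<noteq> 0" "ereal \<alpha> * (ereal \<alpha> - ereal \<beta> * a) > 0"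
      proof -
        have K: "0 < - (\<alpha> * \<beta>)" using that \<alpha> PInf
          by (cases \<alpha> "0::real" rule: linorder_cases; cases \<beta> "0::real" rule: linorder_cases)
            (auto simp: mult_less_0_iff)
        have "v * - (\<alpha> * \<beta>) < \<alpha> * (\<alpha> - \<beta> * v)"
          using \<alpha> by (auto simp: algebra_simps zero_less_mult_iff linorder_neq_iff)
        then have "v / (\<alpha> * (\<alpha> - \<beta> * v)) < 1 / - (\<alpha> * \<beta>)"
          by (simp only: pos_divide_less_eq[OF v(2)] times_divide_eq_left pos_less_divide_eq[OF K] mult_1)
        then show ?thesis by simp
      qed
      then show ?thesis using PInf by (auto simp: a_idx_def)
    qed (use a in auto)
    then show "v / (\<alpha> * (\<alpha> - \<beta> * v)) \<in> ival (a_idx \<alpha> \<beta> a)"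
      using v by (simp add: ival_def)
  qed
next
  show "ival (a_idx \<alpha> \<beta> a) \<subseteq> (\<lambda>v. v / (\<alpha> * (\<alpha> - \<beta> * v))) ` sign_set \<alpha> \<beta> a"
  proof
    fix t assume "t \<in> ival (a_idx \<alpha> \<beta> a)"
    then have t: "0 \<le> t" "ereal t < a_idx \<alpha> \<beta> a" by (auto simp: ival_def)
    \<comment> \<open>The inverse map divides by this quantity. For
      \<open>\<alpha> * \<beta> < 0\<close> it is positive because \<open>a_idx\<close> is then
      finite and at most \<open>- 1 / (\<alpha> * \<beta>)\<close>.\<close>
    have pos: "0 < 1 + \<alpha> * \<beta> * t"
    proof (cases "0 \<le> \<alpha> * \<beta>")
      case False
      show ?thesis
      proof (cases a)
        case (real r)
        have "\<alpha> * \<beta> * r < 0" using False a real by (intro mult_neg_pos[of "\<alpha> * \<beta>"]) auto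
        moreover have "0 < \<alpha>\<^sup>2" using \<alpha> by simp
        ultimately have "0 < \<alpha>\<^sup>2 - \<alpha> * \<beta> * r" by linarith
        then have "0 < \<alpha> * (\<alpha> - \<beta> * r)" by (simp add: algebra_simps power2_eq_square)
        then have "t < r / (\<alpha> * (\<alpha> - \<beta> * r))" using t a_idx_real real by simp
        then have "t * (\<alpha> * (\<alpha> - \<beta> * r)) < r" using \<open>0 < \<alpha> * (\<alpha> - \<beta> * r)\<close>
          by (simp add: pos_less_divide_eq)
        then have "(1 + \<alpha> * \<beta> * t) * r > t * \<alpha>\<^sup>2" by (simp add: algebra_simps power2_eq_square)
        then have "(1 + \<alpha> * \<beta> * t) * r > 0" using t by (meson le_less_trans mult_nonneg_nonneg zero_le_power2)
        then show ?thesis using a real by (simp add: zero_less_mult_iff)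
      next
        case PInf
        have "ereal \<alpha> * (ereal \<alpha> - ereal \<beta> * a) > 0" "\<beta> \<noteq> 0" using False \<alpha> PInf
          by (cases \<alpha> "0::real" rule: linorder_cases; cases \<beta> "0::real" rule: linorder_cases;
              auto simp: zero_le_mult_iff)+
        then have "t < - 1 / (\<alpha> * \<beta>)" using t PInf by (simp add: a_idx_def)
        then show ?thesis using False by (simp add: divide_simps mult.commute split: if_splits)
      qed (use a in auto)
    qed (use t in \<open>simp add: add_pos_nonneg\<close>)
    define v where "v = \<alpha>\<^sup>2 * t / (1 + \<alpha> * \<beta> * t)"
    have v0: "0 \<le> v" using pos t by (simp add: v_def)
    have av: "\<alpha> - \<beta> * v = \<alpha> / (1 + \<alpha> * \<beta> * t)"
      using pos by (simp add: v_def divide_simps) (simp add: algebra_simps power2_eq_square)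
    have "v < r" if a_real: "a = ereal r" for r
    proof -
      have "t * (\<alpha> * (\<alpha> - \<beta> * r)) < r"
      proof (cases "0 < \<alpha> * (\<alpha> - \<beta> * r)")
        case True
        then have "t < r / (\<alpha> * (\<alpha> - \<beta> * r))" using t a_idx_real a_real by simp
        then show ?thesis using True by (simp add: pos_less_divide_eq)
      next
        case False
        then have "t * (\<alpha> * (\<alpha> - \<beta> * r)) \<le> 0" using t by (intro mult_nonneg_nonpos[where a = t]) (auto simp: not_less)
        also have "0 < r" using a a_real by simp
        finally show ?thesis .
      qed
      then have "\<alpha>\<^sup>2 * t < r * (1 + \<alpha> * \<beta> * t)" by (simp add: algebra_simps power2_eq_square)
      then show ?thesis using pos by (simp add: v_def pos_divide_less_eq)
    qed
    then have "v \<in> ival a" using v0 a by (cases a) (auto simp: ival_def)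
    moreover have "0 < \<alpha> * (\<alpha> - \<beta> * v)"
      unfolding av using pos \<alpha> by (auto simp: divide_simps zero_less_mult_iff)
    moreover have "t = v / (\<alpha> * (\<alpha> - \<beta> * v))"
      unfolding av using pos \<alpha> by (simp add: v_def power2_eq_square)
    ultimately show "t \<in> (\<lambda>v. v / (\<alpha> * (\<alpha> - \<beta> * v))) ` sign_set \<alpha> \<beta> a"
      by (auto simp: sign_set_def)
  qed
qed

context A_path
begin

text \<open>\<open>\<tau>\<close> maps \<open>{0..t}\<close> onto \<open>{0..\<tau> t}\<close>, so
  the condition on all earlier times becomes one on all smaller values.\<close>

lemma Pi_dom:
  assumes "\<alpha> \<noteq> 0"
  shows "dom (Pi_op \<alpha> (- \<beta>) f) = {t \<in> ival a. \<tau> t \<in> sign_set \<alpha> \<beta> b}"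
proof -
  have "(\<forall>s\<in>{0..t}. \<alpha> + - \<beta> * \<tau> s \<noteq> 0) \<longleftrightarrow> \<tau> t \<in> sign_set \<alpha> \<beta> b" if t: "t \<in> ival a" for t
  proof -
    have "{0..\<tau> t} = \<tau> ` {0..t}"
    proof
      show "{0..\<tau> t} \<subseteq> \<tau> ` {0..t}"
      proof
        fix v assume v: "v \<in> {0..\<tau> t}"
        then have "v \<in> ival b" using ival_subset[OF tau_mem[OF t]] by auto
        then have "\<rho> v \<in> {0..t}" "v = \<tau> (\<rho> v)"
          using rho_le_iff[of v t] v t rho_mem ival_nonneg by auto
        then show "v \<in> \<tau> ` {0..t}" by blast
      qed
      show "\<tau> ` {0..t} \<subseteq> {0..\<tau> t}"
        using tau_le_iff[of _ t] tau_nonneg ival_le[OF t] t by auto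
    qed
    then have "(\<forall>s\<in>{0..t}. \<alpha> + - \<beta> * \<tau> s \<noteq> 0) \<longleftrightarrow> (\<forall>w\<in>{0..\<tau> t}. \<alpha> - \<beta> * w \<noteq> 0)"
      by simp
    then show ?thesis
      using affine_nonvanishing[OF assms tau_nonneg[OF t]] tau_mem[OF t] by (simp add: sign_set_def)
  qed
  then show ?thesis using dom
    by (auto simp: Pi_op_def restrict_map_def dom_def)
qed

lemma val_Pi:
  assumes "t \<in> dom (Pi_op \<alpha> \<beta> f)"
  shows "val (Pi_op \<alpha> \<beta> f) t = val f t * (\<alpha> + \<beta> * \<tau> t)"
  using assms by (auto simp: Pi_op_def restrict_map_def dom_def split: if_splits)

text \<open>For \<open>c < b\<close> the bound is \<open>\<rho>\<close> at \<open>c\<close>, for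
  \<open>c = b\<close> it is the endpoint \<open>a\<close>; \<open>tau_at (Sigma_op f)\<close>
  covers both, since \<open>tau (Sigma_op f)\<close> is \<open>\<rho>\<close>.\<close>

lemma val_rho_image: "\<tau> t \<in> ival c \<longleftrightarrow> t \<in> ival (tau_at (Sigma_op f) c)"
  if hyp: "t \<in> ival a" "0 < c" "c \<le> b"
proof (cases "c = b")
  case True
  then show ?thesis using A_path.tau_at_eq[OF A_path_Sigma] hyp tau_mem by simp
next
  case False
  then obtain r where r: "c = ereal r" using hyp by (cases c; cases b) auto
  then have mem: "r \<in> ival b" using hyp False by (auto simp: ival_def zero_ereal_def)
  then have "tau_at (Sigma_op f) c = ereal (\<rho> r)"
    by (auto simp: tau_at_def dom_Sigma r tau_Sigma)
  moreover have "t < \<rho> r \<longleftrightarrow> \<tau> t < r" using rho_le_iff[OF mem hyp(1)] by linarith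
  ultimately show ?thesis using tau_nonneg[OF hyp(1)] ival_nonneg[OF hyp(1)] by (simp add: ival_def[of "ereal _"] r)
qed

text \<open>By the quotient rule \<open>\<tau> / (\<alpha> * (\<alpha> - \<beta> * \<tau>))\<close>
  has derivative \<open>\<tau>' / (\<alpha> - \<beta> * \<tau>)^2\<close>, the inverse square of the
  new map. The domain stops where \<open>\<tau>\<close> reaches \<open>\<alpha> / \<beta>\<close>,
  if it does; this length is \<open>b_idx\<close> with \<open>a\<close> and \<open>b\<close>
  exchanged and \<open>Sigma_op f\<close> for \<open>f\<close>, the form in which
  \<open>S_op\<close> consumes it.\<close>

lemma A_path_Pi:
  assumes "\<alpha> \<noteq> 0"
  shows "A_path (Pi_op \<alpha> (- \<beta>) f) (b_idx \<alpha> \<beta> b a (Sigma_op f)) (a_idx \<alpha> \<beta> b)"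
    and "\<And>t. t \<in> dom (Pi_op \<alpha> (- \<beta>) f) \<Longrightarrow>
      val (tau (Pi_op \<alpha> (- \<beta>) f)) t = \<tau> t / (\<alpha> * (\<alpha> - \<beta> * \<tau> t))"
proof -
  define h where "h = Pi_op \<alpha> (- \<beta>) f"
  define c where "c = b_idx \<alpha> \<beta> b a (Sigma_op f)"
  define b' where "b' = (if ereal \<alpha> * (ereal \<alpha> - ereal \<beta> * b) > 0 then b else ereal (\<alpha> / \<beta>))"
  have b': "sign_set \<alpha> \<beta> b = ival b'" "0 < b'" "b' \<le> b"
    using sign_set_eq[OF assms b_pos, of \<beta>] b_pos by (auto simp: b'_def)
  have c: "c = tau_at (Sigma_op f) b'"
    using A_path.tau_at_eq[OF A_path_Sigma] by (simp add: c_def b'_def b_idx_def)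
  have mem_iff: "\<tau> t \<in> ival b' \<longleftrightarrow> t \<in> ival c" if "t \<in> ival a" for t
    using val_rho_image[OF that b'(2,3)] by (simp add: c)
  have c_a: "ival c \<subseteq> ival a" "0 < c"
  proof -
    have "c = a \<or> (\<exists>u\<in>ival b. 0 < u \<and> c = ereal (\<rho> u))"
    proof (cases "b' = b")
      case True
      then show ?thesis using A_path.tau_at_eq[OF A_path_Sigma] by (simp add: c)
    next
      case False
      then obtain r where r: "b' = ereal r" using b' by (cases b') auto
      with b' False have "r \<in> ival b" "0 < r" by (auto simp: ival_def)
      then show ?thesis by (auto simp: c r tau_at_def dom_Sigma tau_Sigma intro!: bexI[of _ r])
    qed
    then have "c \<le> a \<and> 0 < c"
      using a_pos rho_mem rho_less_iff[OF zero_mem_ival[OF b_pos]] by (auto simp: ival_def less_imp_le)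
    then show "ival c \<subseteq> ival a" "0 < c" by (simp_all add: ival_subset_ival)
  qed
  have dom_h: "dom h = ival c"
    unfolding h_def Pi_dom[OF assms] b' using c_a mem_iff by auto
  have val_h: "val h t = val f t * (\<alpha> - \<beta> * \<tau> t)" if "t \<in> ival c" for t
    using val_Pi that dom_h by (simp add: h_def)
  have sgn: "0 < \<alpha> * (\<alpha> - \<beta> * \<tau> t)" if "t \<in> ival c" for t
    using mem_iff[of t] that c_a b'(1) by (auto simp: sign_set_def)
  have path_h: "path h c"
  proof
    show "continuous_on (ival c) (val h)"
      by (subst continuous_on_cong[OF refl val_h])
        (auto intro!: continuous_intros continuous_on_subset[OF cont] continuous_on_subset[OF tau_cont] c_a)
    have "(\<forall>t\<in>ival c. 0 < \<alpha> - \<beta> * \<tau> t) \<or> (\<forall>t\<in>ival c. \<alpha> - \<beta> * \<tau> t < 0)"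
      using sgn assms by (cases "0 < \<alpha>") (auto simp: zero_less_mult_iff)
    then show "(\<forall>t\<in>ival c. 0 < val h t) \<or> (\<forall>t\<in>ival c. 0 < - val h t)"
      using sign c_a by (auto simp: val_h mult_less_0_iff zero_less_mult_iff subset_iff)
  qed (use dom_h c_a in auto)
  interpret h: path h c by (rule path_h)
  have tau_h: "val (tau h) t = \<tau> t / (\<alpha> * (\<alpha> - \<beta> * \<tau> t))" if "t \<in> ival c" for t
    using that
  proof (intro h.tau_eqI)
    show "continuous_on (ival c) (\<lambda>t. \<tau> t / (\<alpha> * (\<alpha> - \<beta> * \<tau> t)))"
      using sgn by (intro continuous_intros continuous_on_subset[OF tau_cont] c_a) force
    show "((\<lambda>t. \<tau> t / (\<alpha> * (\<alpha> - \<beta> * \<tau> t))) has_real_derivative 1 / (val h t)\<^sup>2) (at t)"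
      if t: "t \<in> ival c" "0 < t" for t
    proof -
      have ne: "\<alpha> - \<beta> * \<tau> t \<noteq> 0" "val f t \<noteq> 0" using sgn[OF t(1)] nonzero c_a t by auto
      have "t \<in> ival a" using t c_a by auto
      show ?thesis
        by (rule DERIV_cong[OF DERIV_divide[OF tau_DERIV[OF \<open>t \<in> ival a\<close> t(2)]
              DERIV_cmult[OF DERIV_diff[OF DERIV_const DERIV_cmult[OF tau_DERIV[OF \<open>t \<in> ival a\<close> t(2)]]]]]])
          (use ne assms t in \<open>simp_all add: val_h divide_simps\<close>, simp add: algebra_simps power2_eq_square)
    qed
  qed simp
  have "ran (tau h) = (\<lambda>v. v / (\<alpha> * (\<alpha> - \<beta> * v))) ` (\<tau> ` ival c)"
    unfolding h.ran_tau_image by (auto simp: tau_h)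
  also have "\<tau> ` ival c = ival b'"
  proof
    show "\<tau> ` ival c \<subseteq> ival b'" using mem_iff c_a by auto
    show "ival b' \<subseteq> \<tau> ` ival c"
    proof
      fix u assume u: "u \<in> ival b'"
      then have "u \<in> ival b" using ival_subset_ival[OF b'(3)] by auto
      then show "u \<in> \<tau> ` ival c" using mem_iff[OF rho_mem] u by (intro image_eqI[of _ _ "\<rho> u"]) auto
    qed
  qed
  finally have ran: "ran (tau h) = ival (a_idx \<alpha> \<beta> b)"
    unfolding b'(1)[symmetric] Moebius_image[OF assms b_pos] .
  have "0 < a_idx \<alpha> \<beta> b"
  proof -
    have "val (tau h) 0 \<in> ran (tau h)"
      unfolding h.ran_tau_image by (rule imageI[OF zero_mem_ival[OF c_a(2)]])
    then have "ereal 0 < a_idx \<alpha> \<beta> b" unfolding ran by (simp add: ival_def)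
    then show ?thesis by (simp add: zero_ereal_def)
  qed
  then have "tau_at h c = a_idx \<alpha> \<beta> b" by (rule h.tau_atI[OF ran])
  then have "A_path h c (a_idx \<alpha> \<beta> b)" by unfold_locales
  then show "A_path (Pi_op \<alpha> (- \<beta>) f) (b_idx \<alpha> \<beta> b a (Sigma_op f)) (a_idx \<alpha> \<beta> b)"
    by (simp add: h_def c_def)
  show "\<And>t. t \<in> dom (Pi_op \<alpha> (- \<beta>) f) \<Longrightarrow>
      val (tau (Pi_op \<alpha> (- \<beta>) f)) t = \<tau> t / (\<alpha> * (\<alpha> - \<beta> * \<tau> t))"
    using tau_h dom_h by (simp add: h_def)
qed

lemma Sigma_Sigma: "Sigma_op (Sigma_op f) = f"
proof -
  interpret S: A_path "Sigma_op f" b a by (rule A_path_Sigma)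
  show ?thesis
    by (rule pfun_eqI)
      (auto simp: S.dom_Sigma dom S.val_Sigma rho_Sigma tau_mem val_Sigma)
qed

text \<open>For \<open>g = Sigma_op f\<close> the function \<open>tau g\<close> is
  \<open>\<rho>\<close>. A point \<open>s\<close> of the domain of
  \<open>Pi_op \<alpha> (- \<beta>) g\<close> has the coordinate \<open>v = \<rho> s\<close> in the
  domain of \<open>f\<close> and \<open>t = v / (\<alpha> * (\<alpha> - \<beta> * v))\<close> in
  that of the result. Solving for \<open>v\<close> gives the argument of \<open>f\<close> in the
  formula, and \<open>tau\<close> of the result at \<open>t\<close> is
  \<open>s = \<tau> v\<close>.\<close>

lemma
  assumes "\<alpha> \<noteq> 0"
  shows A_path_S: "A_path (S_op \<alpha> \<beta> f) (a_idx \<alpha> \<beta> a) (b_idx \<alpha> \<beta> a b f)"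
    and S_formula: "\<And>t. t \<in> ival (a_idx \<alpha> \<beta> a) \<Longrightarrow>
      0 < 1 + \<alpha> * \<beta> * t \<and> \<alpha>\<^sup>2 * t / (1 + \<alpha> * \<beta> * t) \<in> ival a \<and>
      val (S_op \<alpha> \<beta> f) t = (1 + \<alpha> * \<beta> * t) / \<alpha> * val f (\<alpha>\<^sup>2 * t / (1 + \<alpha> * \<beta> * t)) \<and>
      val (tau (S_op \<alpha> \<beta> f)) t = \<tau> (\<alpha>\<^sup>2 * t / (1 + \<alpha> * \<beta> * t))"
proof -
  define g where "g = Sigma_op f"
  interpret g: A_path g b a unfolding g_def by (rule A_path_Sigma)
  define h where "h = Pi_op \<alpha> (- \<beta>) g"
  have Sg: "Sigma_op g = f" by (simp add: g_def Sigma_Sigma)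
  interpret h: A_path h "b_idx \<alpha> \<beta> a b f" "a_idx \<alpha> \<beta> a"
    using g.A_path_Pi(1)[OF assms, of \<beta>] by (simp add: h_def Sg)
  have S: "S_op \<alpha> \<beta> f = Sigma_op h" by (simp add: S_op_def h_def g_def)
  show "A_path (S_op \<alpha> \<beta> f) (a_idx \<alpha> \<beta> a) (b_idx \<alpha> \<beta> a b f)"
    unfolding S by (rule h.A_path_Sigma)
  fix t assume t: "t \<in> ival (a_idx \<alpha> \<beta> a)"
  define s where "s = h.\<rho> t"
  have s: "s \<in> dom h" using h.rho_mem[OF t] h.dom by (simp add: s_def)
  then have s': "s \<in> ival b" "g.\<tau> s \<in> sign_set \<alpha> \<beta> a"
    using g.Pi_dom[OF assms] by (auto simp: h_def)
  define v where "v = g.\<tau> s"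
  have v: "v \<in> ival a" "0 < \<alpha> * (\<alpha> - \<beta> * v)" using s' by (auto simp: sign_set_def v_def)
  have s_eq: "s = \<tau> v" using s' by (simp add: v_def g_def tau_Sigma)
  have t_eq: "t = v / (\<alpha> * (\<alpha> - \<beta> * v))"
    using g.A_path_Pi(2)[OF assms s[unfolded h_def]] h.tau_rho[OF t]
    by (simp add: h_def[symmetric] v_def s_def)
  have ne: "\<alpha> - \<beta> * v \<noteq> 0" using v by auto
  note M = Moebius_inverse[OF assms ne t_eq]
  have "val (S_op \<alpha> \<beta> f) t = 1 / (val g s * (\<alpha> - \<beta> * v))"
    unfolding S h.val_Sigma[OF t] s_def[symmetric]
    using g.val_Pi[OF s[unfolded h_def]] by (simp add: h_def[symmetric] v_def)
  also have "\<dots> = val f v / (\<alpha> - \<beta> * v)"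
    using s' v by (simp add: g_def val_Sigma s_eq tau_mem)
  also have "\<dots> = (1 + \<alpha> * \<beta> * t) / \<alpha> * val f v"
    using assms by (simp add: M(1))
  finally have val: "val (S_op \<alpha> \<beta> f) t = (1 + \<alpha> * \<beta> * t) / \<alpha> * val f v" .
  have "0 < \<alpha> / (\<alpha> - \<beta> * v)" using v by (simp add: zero_less_mult_iff zero_less_divide_iff)
  moreover have "val (tau (S_op \<alpha> \<beta> f)) t = \<tau> v"
    unfolding S h.tau_Sigma[OF t] s_def[symmetric] s_eq ..
  ultimately show "0 < 1 + \<alpha> * \<beta> * t \<and> \<alpha>\<^sup>2 * t / (1 + \<alpha> * \<beta> * t) \<in> ival a \<and>
      val (S_op \<alpha> \<beta> f) t = (1 + \<alpha> * \<beta> * t) / \<alpha> * val f (\<alpha>\<^sup>2 * t / (1 + \<alpha> * \<beta> * t)) \<and>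
      val (tau (S_op \<alpha> \<beta> f)) t = \<tau> (\<alpha>\<^sup>2 * t / (1 + \<alpha> * \<beta> * t))"
    unfolding M(2) using v(1) val by (simp only: M(1))
qed

end

text \<open>The definition hides linearity, as \<open>\<rho>\<close> depends on the map in a
  nonlinear way. In \<open>S_formula\<close> the argument of \<open>f\<close> is the same for all
  maps, and the new domain depends on \<open>f\<close> only through \<open>a\<close>.\<close>

lemma S_op_lincomb:
  assumes "\<alpha> \<noteq> 0" "f \<in> A_inf" "g \<in> A_inf" "dom f = dom g" "lincomb c f d g \<in> A_inf"
  shows "S_op \<alpha> \<beta> (lincomb c f d g) = lincomb c (S_op \<alpha> \<beta> f) d (S_op \<alpha> \<beta> g)"
proof -
  obtain a b where "A_path f a b" using assms A_inf_iff by auto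
  then interpret f: A_path f a b .
  obtain a' b' where g': "A_path g a' b'" using assms A_inf_iff by auto
  then have "path g a'" by (rule A_path.axioms)
  then have "a' = a" using f.dom f.a_pos assms(4) ival_inject[of a' a] by (simp add: path_def)
  then interpret g: A_path g a b' using g' by simp
  obtain a'' b'' where l': "A_path (lincomb c f d g) a'' b''" using assms A_inf_iff by auto
  then have "path (lincomb c f d g) a''" by (rule A_path.axioms)
  have dom_l: "dom (lincomb c f d g) = ival a" using f.dom assms by (auto simp: lincomb_def dom_def)
  with \<open>path (lincomb c f d g) a''\<close> have "a'' = a"
    using f.a_pos ival_inject[of a'' a] by (simp add: path_def)
  then interpret l: A_path "lincomb c f d g" a b'' using l' by simp
  have dom_S: "dom (S_op \<alpha> \<beta> f) = ival (a_idx \<alpha> \<beta> a)" "dom (S_op \<alpha> \<beta> g) = ival (a_idx \<alpha> \<beta> a)"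
    "dom (S_op \<alpha> \<beta> (lincomb c f d g)) = ival (a_idx \<alpha> \<beta> a)"
    using f.A_path_S[OF assms(1)] g.A_path_S[OF assms(1)] l.A_path_S[OF assms(1)]
    by (auto simp: A_path_def path_def)
  show ?thesis
  proof (rule pfun_eqI)
    show "dom (S_op \<alpha> \<beta> (lincomb c f d g)) = dom (lincomb c (S_op \<alpha> \<beta> f) d (S_op \<alpha> \<beta> g))"
      using dom_S by (auto simp: lincomb_def split: if_splits)
    fix t assume "t \<in> dom (S_op \<alpha> \<beta> (lincomb c f d g))"
    then have t: "t \<in> ival (a_idx \<alpha> \<beta> a)" by (simp add: dom_S)
    have "val (lincomb c f d g) v = c * val f v + d * val g v" if "v \<in> ival a" for v
      using that f.dom g.dom by (simp add: lincomb_def)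
    then show "val (S_op \<alpha> \<beta> (lincomb c f d g)) t = val (lincomb c (S_op \<alpha> \<beta> f) d (S_op \<alpha> \<beta> g)) t"
      using f.S_formula[OF assms(1) t] g.S_formula[OF assms(1) t] l.S_formula[OF assms(1) t] t
      by (simp add: lincomb_def dom_S algebra_simps)
  qed
qed

section \<open>Integrals against a locally finite measure\<close>

lemma continuous_on_Icc_bounded:
  fixes k :: "real \<Rightarrow> real"
  assumes "continuous_on {a..b} k"
  shows "\<exists>K. \<forall>u. u \<in> {a..b} \<longrightarrow> \<bar>k u\<bar> \<le> K"
  using compact_imp_bounded[OF compact_continuous_image[OF assms]] by (fastforce simp: bounded_iff)

text \<open>
  The function \<open>d\<close> may be discontinuous. The two sides still have the same derivative in the sense
  that their difference is \<open>o(y - x)\<close> at every point \<open>x\<close>, which suffices.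
\<close>

lemma inverse_of_integral:
  fixes f d :: "real \<Rightarrow> real"
  assumes cont: "continuous_on {0..T} f" and nz: "\<And>s. s \<in> {0..T} \<Longrightarrow> f s \<noteq> 0"
    and d: "d integrable_on {0..T}" "\<And>s. s \<in> {0..T} \<Longrightarrow> \<bar>d s\<bar> \<le> C"
    and dq: "(\<lambda>s. d s / (f s)\<^sup>2) integrable_on {0..T}"
    and f: "\<And>t. t \<in> {0..T} \<Longrightarrow> f t = x0 + integral {0..t} d"
    and t: "t \<in> {0..T}"
  shows "1 / f t = 1 / x0 - integral {0..t} (\<lambda>s. d s / (f s)\<^sup>2)"
proof -
  define q where "q s = 1 / f s" for s
  have q_cont: "continuous_on {0..T} q"
    unfolding q_def using nz by (intro continuous_intros cont) auto
  obtain Q where Q: "\<And>s. s \<in> {0..T} \<Longrightarrow> \<bar>q s\<bar> \<le> Q"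
    using continuous_on_Icc_bounded[OF q_cont] by blast
  \<comment> \<open>The claim is that \<open>W\<close> is constant. The density \<open>d\<close>
    enters its increments only as a bounded factor of \<open>(q r)^2 - q x * q y\<close>, which is
    small near \<open>x\<close> by continuity of \<open>q\<close>.\<close>
  define W where "W s = q s + integral {0..s} (\<lambda>s. d s * (q s)\<^sup>2)" for s
  have dq': "(\<lambda>s. d s * (q s)\<^sup>2) integrable_on {0..T}"
    using dq by (simp add: q_def power_divide)
  have incr: "W y - W x = integral {x..y} (\<lambda>r. d r * ((q r)\<^sup>2 - q x * q y))"
      "(\<lambda>r. d r * ((q r)\<^sup>2 - q x * q y)) integrable_on {x..y}"
    if xy: "0 \<le> x" "x \<le> y" "y \<le> T" for x y
  proof -
    have int: "g integrable_on {0..y}" "g integrable_on {x..y}" if "g integrable_on {0..T}" for g :: "real \<Rightarrow> real"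
      using that xy by (auto intro: integrable_subinterval_real)
    have comb: "integral {0..y} g - integral {0..x} g = integral {x..y} g" if "g integrable_on {0..T}" for g :: "real \<Rightarrow> real"
      using Henstock_Kurzweil_Integration.integral_combine[OF xy(1,2) int(1)[OF that]] by simp
    have "q y - q x = - (q x * q y) * (f y - f x)"
      using nz[of x] nz[of y] xy by (simp add: q_def divide_simps)
    also have "f y - f x = integral {x..y} d"
      using f[of x] f[of y] xy comb[OF d(1)] by simp
    finally have "W y - W x = integral {x..y} (\<lambda>r. d r * (q r)\<^sup>2) - q x * q y * integral {x..y} d"
      using comb[OF dq'] by (simp add: W_def)
    also have "\<dots> = integral {x..y} (\<lambda>r. d r * (q r)\<^sup>2 - q x * q y * d r)"
      using int(2)[OF dq'] int(2)[OF d(1)] by (subst Henstock_Kurzweil_Integration.integral_diff) (auto intro: integrable_on_mult_right)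
    finally show "W y - W x = integral {x..y} (\<lambda>r. d r * ((q r)\<^sup>2 - q x * q y))"
      by (simp add: algebra_simps)
    have "(\<lambda>r. d r * (q r)\<^sup>2 - q x * q y * d r) integrable_on {x..y}"
      using int(2)[OF dq'] int(2)[OF d(1)] by (intro Henstock_Kurzweil_Integration.integrable_diff integrable_on_mult_right)
    then show "(\<lambda>r. d r * ((q r)\<^sup>2 - q x * q y)) integrable_on {x..y}"
      by (simp add: algebra_simps)
  qed
  have "0 \<le> T" using t by simp
  have C0: "0 \<le> C" "0 \<le> Q" using order_trans[OF abs_ge_zero d(2)[OF t]] order_trans[OF abs_ge_zero Q[OF t]] by auto
  have "(W has_real_derivative 0) (at x within {0..T})" if x: "x \<in> {0..T}" for x
    unfolding has_field_derivative_iff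
  proof (rule tendstoI)
    fix e :: real assume "0 < e"
    \<comment> \<open>The kernel is at most \<open>3 * Q * \<eta>\<close> once all values of
      \<open>q\<close> are within \<eta> of \<open>q x\<close>; the summand 1 keeps the divisor
      positive.\<close>
    define \<eta> where "\<eta> = e / (2 * (3 * Q * C + 1))"
    have "0 < \<eta>" using \<open>0 < e\<close> C0 by (simp add: \<eta>_def add_nonneg_pos)
    have small: "C * (3 * Q * \<eta>) < e"
    proof -
      have "C * (3 * Q * \<eta>) = e * (3 * Q * C / (2 * (3 * Q * C + 1)))" by (simp add: \<eta>_def)
      also have "\<dots> < e * 1"
        using \<open>0 < e\<close> C0 by (intro mult_strict_left_mono) (auto simp: divide_simps add_nonneg_pos intro: add_nonneg_pos)
      finally show ?thesis by simp
    qed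
    obtain \<delta> where \<delta>: "0 < \<delta>" "\<And>r. r \<in> {0..T} \<Longrightarrow> \<bar>r - x\<bar> < \<delta> \<Longrightarrow> \<bar>q r - q x\<bar> < \<eta>"
      using q_cont x \<open>0 < \<eta>\<close> unfolding continuous_on_iff dist_real_def by blast
    have est: "\<bar>d r * ((q r)\<^sup>2 - q u * q v)\<bar> \<le> C * (3 * Q * \<eta>)"
      if r: "r \<in> {0..T}" "\<bar>r - x\<bar> < \<delta>" and y: "y \<in> {0..T}" "\<bar>y - x\<bar> < \<delta>"
        and uv: "q u * q v = q x * q y" for r y u v
    proof -
      have "(q r)\<^sup>2 - q u * q v = q r * (q r - q x) + q x * ((q r - q x) - (q y - q x))"
        unfolding uv by (simp add: algebra_simps power2_eq_square)
      also have "\<bar>\<dots>\<bar> \<le> \<bar>q r\<bar> * \<bar>q r - q x\<bar> + \<bar>q x\<bar> * (\<bar>q r - q x\<bar> + \<bar>q y - q x\<bar>)"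
        by (rule order_trans[OF abs_triangle_ineq], unfold abs_mult)
          (intro add_mono mult_left_mono abs_triangle_ineq4 order_refl abs_ge_zero)
      also have "\<dots> \<le> Q * \<eta> + Q * (\<eta> + \<eta>)"
        using Q[OF r(1)] Q[OF x] \<delta>(2)[OF r] \<delta>(2)[OF y] \<open>0 < \<eta>\<close> C0
        by (intro add_mono mult_mono) auto
      finally have "\<bar>(q r)\<^sup>2 - q u * q v\<bar> \<le> 3 * Q * \<eta>" by simp
      then show ?thesis unfolding abs_mult using d(2)[OF r(1)] C0 by (intro mult_mono) auto
    qed
    have bound: "\<bar>W v - W u\<bar> \<le> C * (3 * Q * \<eta>) * (v - u)"
      if "0 \<le> u" "u \<le> v" "v \<le> T" "u = x \<and> \<bar>v - x\<bar> < \<delta> \<or> v = x \<and> \<bar>u - x\<bar> < \<delta>" for u v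
    proof -
      have "norm (integral {u..v} (\<lambda>r. d r * ((q r)\<^sup>2 - q u * q v))) \<le> C * (3 * Q * \<eta>) * measure lborel (cbox u v)"
      proof (rule has_integral_bound)
        show "((\<lambda>r. d r * ((q r)\<^sup>2 - q u * q v)) has_integral
            integral {u..v} (\<lambda>r. d r * ((q r)\<^sup>2 - q u * q v))) (cbox u v)"
          using incr(2)[OF that(1-3)] by (simp add: integrable_integral)
        fix r assume "r \<in> cbox u v"
        then have r: "r \<in> {0..T}" "\<bar>r - x\<bar> < \<delta>" using that by auto
        show "norm (d r * ((q r)\<^sup>2 - q u * q v)) \<le> C * (3 * Q * \<eta>)"
          using that est[OF r, of v u v] est[OF r, of u u v] by (auto simp: mult.commute)
      qed (use C0 \<open>0 < \<eta>\<close> in auto)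
      then show ?thesis using incr(1)[OF that(1-3)] that by simp
    qed
    have "\<bar>(W y - W x) / (y - x)\<bar> < e" if y: "y \<in> {0..T}" "y \<noteq> x" "\<bar>y - x\<bar> < \<delta>" for y
    proof -
      have "\<bar>W y - W x\<bar> \<le> C * (3 * Q * \<eta>) * \<bar>y - x\<bar>"
        using bound[of x y] bound[of y x] x y by (cases "x < y") auto
      also have "\<dots> < e * \<bar>y - x\<bar>" using small y by (intro mult_strict_right_mono) auto
      finally show ?thesis using y by (simp add: abs_divide pos_divide_less_eq)
    qed
    then show "eventually (\<lambda>y. dist ((W y - W x) / (y - x)) 0 < e) (at x within {0..T})"
      unfolding eventually_at dist_real_def using \<delta>(1) by (intro exI[of _ \<delta>]) auto
  qed
  then obtain c where "\<And>s. s \<in> {0..T} \<Longrightarrow> W s = c"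
    using has_field_derivative_zero_constant[of "{0..T}" W] convex_real_interval by blast
  then have "W t = W 0" using t by auto
  moreover have "f 0 = x0" using f[of 0] t by simp
  ultimately show ?thesis by (simp add: W_def q_def power_divide)
qed

text \<open>The instance will be the image on the whole line of the measure on [0,\<infinity>), so
  that ordinary Borel sets and functions suffice.\<close>

locale loc_finite_measure =
  fixes M :: "real measure"
  assumes sets_M [measurable_cong, simp]: "sets M = sets borel"
    and finite_M: "emeasure M {..U} < \<infinity>"
begin

lemma space_M [simp]: "space M = UNIV"
  using sets_eq_imp_space_eq[OF sets_M] by simp

lemma finite_Ioc: "emeasure M {0<..U} < \<infinity>"
  by (rule le_less_trans[OF emeasure_mono finite_M[of U]]) auto

lemma sigma_finite: "sigma_finite_measure M"
proof
  show "\<exists>A. countable A \<and> A \<subseteq> sets M \<and> \<Union> A = space M \<and> (\<forall>a\<in>A. emeasure M a \<noteq> \<infinity>)"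
  proof (intro exI conjI)
    show "\<Union> (range (\<lambda>n::nat. {..real n})) = space M"
      using real_arch_simple by fastforce
    show "\<forall>a\<in>range (\<lambda>n::nat. {..real n}). emeasure M a \<noteq> \<infinity>"
      using finite_M by (auto simp: less_top)
  qed auto
qed

lemma set_integrable_M:
  fixes k :: "real \<Rightarrow> real"
  assumes "continuous_on {0..U} k"
  shows "set_integrable M {0<..U} k"
proof -
  obtain K where K: "\<And>u. u \<in> {0..U} \<Longrightarrow> \<bar>k u\<bar> \<le> K"
    using continuous_on_Icc_bounded[OF assms] by blast
  have "set_borel_measurable borel {0<..U} k"
    unfolding set_borel_measurable_def
    by (intro borel_measurable_continuous_on_indicator continuous_on_subset[OF assms]) auto
  then have [measurable]: "(\<lambda>u. indicator {0<..U} u *\<^sub>R k u) \<in> borel_measurable borel"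
    by (simp add: set_borel_measurable_def)
  show ?thesis unfolding set_integrable_def
  proof (rule integrableI_bounded_set[of "{0<..U}" _ _ K])
    show "(\<lambda>u. indicator {0<..U} u *\<^sub>R k u) \<in> borel_measurable M" by measurable
  qed (use K finite_Ioc in \<open>auto intro!: AE_I2\<close>)
qed

text \<open>Later \<open>r\<close> is \<open>\<rho>\<close>, which turns the inner region into
  \<open>{0<..\<tau> s}\<close>. Integrability holds because all factors are bounded on a rectangle
  of finite product measure.\<close>

lemma Fubini_triangle:
  fixes k r w :: "real \<Rightarrow> real"
  assumes k: "continuous_on {0..U} k" and r: "continuous_on {0..U} r"
    and w: "continuous_on {0..t} w"
  shows "set_integrable lborel {0..t} (\<lambda>s. w s * (LINT u:{u\<in>{0<..U}. r u \<le> s}|M. k u))"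
    and "(LBINT s:{0..t}. w s * (LINT u:{u\<in>{0<..U}. r u \<le> s}|M. k u)) =
      (LINT u:{0<..U}|M. k u * (LBINT s:{s\<in>{0..t}. r u \<le> s}. w s))"
proof -
  interpret sigma_finite_measure M by (rule sigma_finite)
  interpret P: pair_sigma_finite lborel M by unfold_locales
  obtain K where K: "\<And>u. u \<in> {0..U} \<Longrightarrow> \<bar>k u\<bar> \<le> K"
    using continuous_on_Icc_bounded[OF k] by blast
  obtain W where W: "\<And>s. s \<in> {0..t} \<Longrightarrow> \<bar>w s\<bar> \<le> W"
    using continuous_on_Icc_bounded[OF w] by blast
  \<comment> \<open>Continuity is known only on the intervals; cut off by indicators, the functions
    become Borel on the line. Where \<open>r'\<close> has the wrong value 0, \<open>k'\<close>
    vanishes.\<close>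
  define k' where "k' u = indicator {0<..U} u * k u" for u
  define r' where "r' u = indicator {0<..U} u * r u" for u
  define w' where "w' s = indicator {0..t} s * w s" for s
  have "set_borel_measurable borel {0<..U} k" "set_borel_measurable borel {0<..U} r"
    "set_borel_measurable borel {0..t} w"
    unfolding set_borel_measurable_def
    by (intro borel_measurable_continuous_on_indicator continuous_on_subset[OF k]
        continuous_on_subset[OF r] w; force)+
  then have [measurable]: "k' \<in> borel_measurable borel" "r' \<in> borel_measurable borel"
    "w' \<in> borel_measurable borel"
    by (simp_all add: set_borel_measurable_def k'_def[abs_def] r'_def[abs_def] w'_def[abs_def])
  define g where "g = (\<lambda>s u. w' s * k' u * indicator {0..} (s - r' u))"
  have [measurable]: "(\<lambda>(s, u). g s u) \<in> borel_measurable (lborel \<Otimes>\<^sub>M M)"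
    unfolding g_def by measurable
  have fin: "emeasure (lborel \<Otimes>\<^sub>M M) ({0..t} \<times> {0<..U}) < \<infinity>"
    using finite_Ioc[of U] emeasure_lborel_Icc_eq[of 0 t]
    by (subst emeasure_pair_measure_Times) (auto simp: ennreal_mult_less_top)
  have int: "integrable (lborel \<Otimes>\<^sub>M M) (\<lambda>(s, u). g s u)"
  proof (rule integrableI_bounded_set[of "{0..t} \<times> {0<..U}" _ _ "W * K"])
    show "AE x in lborel \<Otimes>\<^sub>M M. x \<in> {0..t} \<times> {0<..U} \<longrightarrow> norm (case x of (s, u) \<Rightarrow> g s u) \<le> W * K"
    proof (intro AE_I2 impI)
      fix x :: "real \<times> real" assume "x \<in> {0..t} \<times> {0<..U}"
      then show "norm (case x of (s, u) \<Rightarrow> g s u) \<le> W * K"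
        using mult_mono[OF W[of "fst x"] K[of "snd x"]] order_trans[OF abs_ge_zero W[of "fst x"]]
          order_trans[OF abs_ge_zero K[of "snd x"]]
        by (auto simp: g_def w'_def k'_def abs_mult indicator_def split: prod.splits)
    qed
    show "AE x in lborel \<Otimes>\<^sub>M M. x \<notin> {0..t} \<times> {0<..U} \<longrightarrow> (case x of (s, u) \<Rightarrow> g s u) = 0"
      by (auto intro!: AE_I2 simp: g_def w'_def k'_def indicator_def)
  qed (use fin in \<open>simp_all\<close>)
  have inner: "(\<integral>u. g s u \<partial>M) = w' s * (LINT u:{u\<in>{0<..U}. r u \<le> s}|M. k u)" for s
  proof -
    have "(\<integral>u. g s u \<partial>M) = (\<integral>u. w' s * (indicator {u\<in>{0<..U}. r u \<le> s} u * k u) \<partial>M)"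
      by (intro Bochner_Integration.integral_cong) (auto simp: g_def k'_def r'_def indicator_def)
    then show ?thesis by (simp add: set_lebesgue_integral_def)
  qed
  have inner': "(\<integral>s. g s u \<partial>lborel) = k' u * (LBINT s:{s\<in>{0..t}. r u \<le> s}. w s)" for u
  proof -
    have "(\<integral>s. g s u \<partial>lborel) = (\<integral>s. k' u * (indicator {s\<in>{0..t}. r u \<le> s} s * w s) \<partial>lborel)"
      by (intro Bochner_Integration.integral_cong) (auto simp: g_def k'_def r'_def w'_def indicator_def)
    then show ?thesis by (simp add: set_lebesgue_integral_def)
  qed
  have "integrable lborel (\<lambda>s. \<integral>u. g s u \<partial>M)"
    using P.integrable_fst'[OF int] by simp
  then show "set_integrable lborel {0..t} (\<lambda>s. w s * (LINT u:{u\<in>{0<..U}. r u \<le> s}|M. k u))"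
    unfolding inner by (simp add: set_integrable_def w'_def mult.assoc)
  have "(\<integral>u. (\<integral>s. g s u \<partial>lborel) \<partial>M) = (\<integral>s. (\<integral>u. g s u \<partial>M) \<partial>lborel)"
    by (rule P.Fubini_integral[OF int])
  then show "(LBINT s:{0..t}. w s * (LINT u:{u\<in>{0<..U}. r u \<le> s}|M. k u)) =
      (LINT u:{0<..U}|M. k u * (LBINT s:{s\<in>{0..t}. r u \<le> s}. w s))"
    unfolding inner inner' by (simp add: set_lebesgue_integral_def w'_def k'_def mult.assoc)
qed

text \<open>The indicators of \<open>{0<..x n}\<close> converge to that of \<open>{0<..u}\<close>
  except possibly at the point \<open>u\<close>, which is a null set unless it is an atom; for
  \<open>u = 0\<close> that point lies in none of the intervals.\<close>

lemma continuous_set_integral_Ioc: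
  fixes k :: "real \<Rightarrow> real"
  assumes k: "continuous_on (ival b) k" and u: "u \<in> ival b" and atom: "u = 0 \<or> emeasure M {u} = 0"
  shows "continuous (at u within ival b) (\<lambda>U. LINT s:{0<..U}|M. k s)"
  unfolding continuous_within_sequentially
proof (intro allI impI)
  fix x assume x: "(\<forall>n. x n \<in> ival b) \<and> x \<longlonglongrightarrow> u"
  obtain u' where u': "u < u'" "u' \<in> ival b" using u by (rule ival_obtain_gt)
  have k': "continuous_on {0..u'} k" by (rule continuous_on_subset[OF k ival_subset[OF u'(2)]])
  have ev: "eventually (\<lambda>n. x n < u') sequentially"
    using x u' order_tendstoD(2) by blast
  then obtain N where N: "\<And>n. n \<ge> N \<Longrightarrow> x n < u'" by (auto simp: eventually_sequentially)
  have int: "set_integrable M {0<..u'} k" by (rule set_integrable_M[OF k'])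
  have sub: "set_integrable M {0<..v} k" if "v \<le> u'" for v
    by (rule set_integrable_subset[OF int]) (use that in auto)
  \<comment> \<open>The shift by \<open>N\<close> keeps all intervals inside
    \<open>{0<..u'}\<close>, where \<open>k\<close> is integrable.\<close>
  have "(\<lambda>n. LINT s:{0<..x (n + N)}|M. k s) \<longlonglongrightarrow> (LINT s:{0<..u}|M. k s)"
    unfolding set_lebesgue_integral_def
  proof (rule integral_dominated_convergence[where w = "\<lambda>s. norm (indicator {0<..u'} s *\<^sub>R k s)"])
    show "integrable M (\<lambda>s. norm (indicator {0<..u'} s *\<^sub>R k s))"
      using int by (intro integrable_norm) (simp add: set_integrable_def)
    have "AE s in M. u = 0 \<or> s \<noteq> u"
      using atom by (auto intro!: AE_I[of _ _ "{u}"])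
    then show "AE s in M. (\<lambda>n. indicator {0<..x (n + N)} s *\<^sub>R k s) \<longlonglongrightarrow> indicator {0<..u} s *\<^sub>R k s"
    proof eventually_elim
      case (elim s)
      have xN: "(\<lambda>n. x (n + N)) \<longlonglongrightarrow> u" using x by (simp add: LIMSEQ_ignore_initial_segment)
      have "eventually (\<lambda>n. indicator {0<..x (n + N)} s *\<^sub>R k s = indicator {0<..u} s *\<^sub>R k s) sequentially"
      proof (cases "s < u")
        case True
        show ?thesis using order_tendstoD(1)[OF xN True]
          by eventually_elim (use True in \<open>auto simp: indicator_def\<close>)
      next
        case False
        show ?thesis
        proof (cases "s \<le> 0")
          case False
          then have "u < s" using \<open>\<not> s < u\<close> elim by auto
          show ?thesis using order_tendstoD(2)[OF xN \<open>u < s\<close>]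
            by eventually_elim (use \<open>u < s\<close> in \<open>auto simp: indicator_def\<close>)
        qed auto
      qed
      then show ?case by (rule tendsto_eventually)
    qed
    fix n show "AE s in M. norm (indicator {0<..x (n + N)} s *\<^sub>R k s) \<le> norm (indicator {0<..u'} s *\<^sub>R k s)"
      using N[of "n + N"] by (intro AE_I2) (auto simp: indicator_def)
    show "(\<lambda>s. indicator {0<..x (n + N)} s *\<^sub>R k s) \<in> borel_measurable M"
      using sub[of "x (n + N)"] N[of "n + N"] by (simp add: set_integrable_def)
  next
    show "(\<lambda>s. indicator {0<..u} s *\<^sub>R k s) \<in> borel_measurable M"
      using sub[of u] u' by (simp add: set_integrable_def)
  qed
  then show "((\<lambda>U. LINT s:{0<..U}|M. k s) \<circ> x) \<longlonglongrightarrow> (LINT s:{0<..u}|M. k s)"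
    using LIMSEQ_offset[of "\<lambda>n. LINT s:{0<..x n}|M. k s"] by (simp add: o_def)
qed

lemma set_integral_Ioc_mono:
  fixes k :: "real \<Rightarrow> real"
  assumes k: "continuous_on {0..V} k" "\<And>u. u \<in> {0..V} \<Longrightarrow> 0 \<le> k u" and "U \<le> V"
  shows "(LINT s:{0<..U}|M. k s) \<le> (LINT s:{0<..V}|M. k s)"
proof -
  have "set_integrable M {0<..V} k" by (rule set_integrable_M[OF k(1)])
  moreover have "set_integrable M {0<..U} k"
    by (rule set_integrable_subset[OF calculation]) (use \<open>U \<le> V\<close> in auto)
  ultimately show ?thesis
    unfolding set_lebesgue_integral_def set_integrable_def
    by (intro integral_mono) (use \<open>U \<le> V\<close> k(2) in \<open>auto simp: indicator_def\<close>)
qed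

end

section \<open>The integrated equation\<close>

text \<open>
  The equation \<open>f'' = - \<nu>\<close> with initial data \<open>x\<close> and \<open>p\<close>, integrated twice; here \<open>\<nu>\<close> is the image under
  \<open>rho (tau f)\<close> of the measure with density \<open>1 / f \<circ> rho (tau f)\<close> with respect to \<open>M\<close>.
\<close>

definition mild :: "real measure \<Rightarrow> pfun \<Rightarrow> real \<Rightarrow> real \<Rightarrow> bool" where
  "mild M f x p \<longleftrightarrow> (\<forall>t\<in>dom f. val f t = x + p * t -
     (LINT u:{0<..val (tau f) t}|M. (t - val (rho (tau f)) u) / val f (val (rho (tau f)) u)))"

locale pos_path = A_path f a b + loc_finite_measure M for f a b M +
  assumes pos: "t \<in> ival a \<Longrightarrow> 0 < val f t"
begin

abbreviation "\<phi> \<equiv> \<lambda>u. 1 / val f (\<rho> u)"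

text \<open>The mass that \<open>- f''\<close> gives to the interval from 0 to
  \<open>\<rho> U\<close>: a solution has slope \<open>p - D (\<tau> t)\<close> wherever this is
  continuous.\<close>

definition D :: "real \<Rightarrow> real" where "D U = (LINT u:{0<..U}|M. \<phi> u)"

lemma phi_cont: "continuous_on (ival b) \<phi>"
  using nonzero rho_mem by (auto intro!: continuous_intros f_rho_cont)

lemma phi_pos: "u \<in> ival b \<Longrightarrow> 0 < \<phi> u"
  using pos rho_mem by simp

lemma D_mono: "V \<in> ival b \<Longrightarrow> U \<le> V \<Longrightarrow> D U \<le> D V"
  unfolding D_def
  using phi_pos ival_le by (intro set_integral_Ioc_mono continuous_on_subset[OF phi_cont] ival_subset)
    (auto intro!: less_imp_le)

lemma D_nonneg: "V \<in> ival b \<Longrightarrow> 0 \<le> D V"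
  using D_mono[of V 0] ival_nonneg[of V b] by (simp add: D_def set_lebesgue_integral_def)

lemma D_tau_cont:
  assumes t: "t \<in> ival a" "t = 0 \<or> emeasure M {\<tau> t} = 0"
  shows "continuous (at t within ival a) (\<lambda>s. D (\<tau> s))"
proof -
  have "continuous (at t within ival a) \<tau>"
    using tau_cont t(1) by (simp add: continuous_on_eq_continuous_within)
  moreover have "\<tau> t = 0 \<or> emeasure M {\<tau> t} = 0" using t(2) by auto
  then have "continuous (at (\<tau> t) within \<tau> ` ival a) D"
    unfolding tau_image D_def by (rule continuous_set_integral_Ioc[OF phi_cont tau_mem[OF t(1)]])
  ultimately have "continuous (at t within ival a) (D \<circ> \<tau>)"
    by (rule continuous_within_compose)
  then show ?thesis by (simp add: o_def)
qed

text \<open>Because \<open>\<rho>\<close> increases, the sections of the region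
  \<open>\<rho> u \<le> s\<close> are the intervals \<open>{0<..\<tau> s}\<close> and
  \<open>{\<rho> u..t}\<close>.\<close>

lemma triangle:
  fixes k w :: "real \<Rightarrow> real"
  assumes t: "t \<in> ival a" and w: "continuous_on {0..t} w" and k: "continuous_on (ival b) k"
  shows "set_integrable lborel {0..t} (\<lambda>s. w s * (LINT u:{0<..\<tau> s}|M. k u))"
    and "(LBINT s:{0..t}. w s * (LINT u:{0<..\<tau> s}|M. k u)) =
      (LINT u:{0<..\<tau> t}|M. k u * integral {\<rho> u..t} w)"
proof -
  have k': "continuous_on {0..\<tau> t} k" "continuous_on {0..\<tau> t} \<rho>"
    using continuous_on_subset[OF _ ival_subset[OF tau_mem[OF t]]] k rho_cont by auto
  note F = Fubini_triangle[OF k' w]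
  have mem: "u \<in> ival b" if "u \<in> {0<..\<tau> t}" for u
    using that ival_subset[OF tau_mem[OF t]] by auto
  have 1: "{u \<in> {0<..\<tau> t}. \<rho> u \<le> s} = {0<..\<tau> s}" if "s \<in> {0..t}" for s
  proof -
    have s: "s \<in> ival a" using that ival_le[OF t] by auto
    then have "\<tau> s \<le> \<tau> t" using that t tau_le_iff by auto
    then show ?thesis using rho_le_iff[OF mem s] by auto
  qed
  have 2: "{s \<in> {0..t}. \<rho> u \<le> s} = {\<rho> u..t}" if "u \<in> {0<..\<tau> t}" for u
    using ival_nonneg[OF rho_mem[OF mem[OF that]]] by auto
  have eq: "indicator {0..t} s *\<^sub>R (w s * (LINT u:{u \<in> {0<..\<tau> t}. \<rho> u \<le> s}|M. k u)) =
      indicator {0..t} s *\<^sub>R (w s * (LINT u:{0<..\<tau> s}|M. k u))" for s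
    using 1[of s] by (cases "s \<in> {0..t}") simp_all
  show "set_integrable lborel {0..t} (\<lambda>s. w s * (LINT u:{0<..\<tau> s}|M. k u))"
    using F(1) unfolding set_integrable_def eq .
  have "(LBINT s:{0..t}. w s * (LINT u:{0<..\<tau> s}|M. k u)) =
      (LINT u:{0<..\<tau> t}|M. k u * (LBINT s:{s \<in> {0..t}. \<rho> u \<le> s}. w s))"
    using F(2) unfolding set_lebesgue_integral_def[of lborel "{0..t}"] eq .
  also have "\<dots> = (LINT u:{0<..\<tau> t}|M. k u * integral {\<rho> u..t} w)"
  proof (intro set_lebesgue_integral_cong allI impI)
    fix u assume u: "u \<in> {0<..\<tau> t}"
    have "(LBINT s:{\<rho> u..t}. w s) = integral {\<rho> u..t} w"
      using ival_nonneg[OF rho_mem[OF mem[OF u]]]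
      by (intro set_borel_integral_eq_integral borel_integrable_atLeastAtMost' continuous_on_subset[OF w]) auto
    then show "k u * (LBINT s:{s \<in> {0..t}. \<rho> u \<le> s}. w s) = k u * integral {\<rho> u..t} w"
      by (simp only: 2[OF u])
  qed simp
  finally show "(LBINT s:{0..t}. w s * (LINT u:{0<..\<tau> s}|M. k u)) =
      (LINT u:{0<..\<tau> t}|M. k u * integral {\<rho> u..t} w)" .
qed

lemma triangle_integral:
  fixes k w :: "real \<Rightarrow> real"
  assumes t: "t \<in> ival a" and w: "continuous_on {0..t} w" and k: "continuous_on (ival b) k"
  shows "(\<lambda>s. w s * (LINT u:{0<..\<tau> s}|M. k u)) integrable_on {0..t}"
    and "integral {0..t} (\<lambda>s. w s * (LINT u:{0<..\<tau> s}|M. k u)) =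
      (LINT u:{0<..\<tau> t}|M. k u * integral {\<rho> u..t} w)"
  using set_borel_integral_eq_integral[OF triangle(1)[OF assms]] triangle(2)[OF assms] by simp_all

lemma D_tau_integrable: "t \<in> ival a \<Longrightarrow> (\<lambda>s. D (\<tau> s)) integrable_on {0..t}"
  using triangle_integral(1)[OF _ _ phi_cont, of t "\<lambda>_. 1"] by (simp add: D_def)

lemma integral_D_tau:
  assumes t: "t \<in> ival a"
  shows "integral {0..t} (\<lambda>s. D (\<tau> s)) = (LINT u:{0<..\<tau> t}|M. (t - \<rho> u) / val f (\<rho> u))"
proof -
  have "integral {0..t} (\<lambda>s. D (\<tau> s)) = (LINT u:{0<..\<tau> t}|M. \<phi> u * integral {\<rho> u..t} (\<lambda>_. 1))"
    using triangle_integral(2)[OF t _ phi_cont, of "\<lambda>_. 1"] by (simp add: D_def)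
  also have "\<dots> = (LINT u:{0<..\<tau> t}|M. (t - \<rho> u) / val f (\<rho> u))"
  proof (intro set_lebesgue_integral_cong allI impI)
    fix u assume "u \<in> {0<..\<tau> t}"
    then have "\<rho> u \<le> t" using rho_le_iff[OF _ t] ival_le[OF tau_mem[OF t]] by auto
    then show "\<phi> u * integral {\<rho> u..t} (\<lambda>_. 1) = (t - \<rho> u) / val f (\<rho> u)" by simp
  qed simp
  finally show ?thesis .
qed

text \<open>The weight is the derivative of \<open>\<tau>\<close>, so its integral from
  \<open>\<rho> u\<close> to \<open>t\<close> is \<open>\<tau> t - u\<close>. The kernel no longer
  contains \<open>\<rho>\<close>, and this is the source of linearity.\<close>

lemma integral_D_tau_weighted:
  assumes t: "t \<in> ival a"
  shows "(\<lambda>s. D (\<tau> s) / (val f s)\<^sup>2) integrable_on {0..t}"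
    and "integral {0..t} (\<lambda>s. D (\<tau> s) / (val f s)\<^sup>2) = (LINT u:{0<..\<tau> t}|M. (\<tau> t - u) * \<phi> u)"
proof -
  have w: "continuous_on {0..t} (\<lambda>s. 1 / (val f s)\<^sup>2)"
    by (rule continuous_on_subset[OF cont_inv_sq ival_subset[OF t]])
  note T = triangle_integral[OF t w phi_cont, folded D_def]
  show "(\<lambda>s. D (\<tau> s) / (val f s)\<^sup>2) integrable_on {0..t}" using T(1) by simp
  have "integral {0..t} (\<lambda>s. D (\<tau> s) / (val f s)\<^sup>2) =
      (LINT u:{0<..\<tau> t}|M. \<phi> u * integral {\<rho> u..t} (\<lambda>s. 1 / (val f s)\<^sup>2))"
    using T(2) by simp
  also have "\<dots> = (LINT u:{0<..\<tau> t}|M. (\<tau> t - u) * \<phi> u)"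
  proof (intro set_lebesgue_integral_cong allI impI)
    fix u assume "u \<in> {0<..\<tau> t}"
    then have u: "u \<in> ival b" "\<rho> u \<le> t" using rho_le_iff[OF _ t] ival_le[OF tau_mem[OF t]] by auto
    have "integral {0..\<rho> u} (\<lambda>s. 1 / (val f s)\<^sup>2) + integral {\<rho> u..t} (\<lambda>s. 1 / (val f s)\<^sup>2) =
        integral {0..t} (\<lambda>s. 1 / (val f s)\<^sup>2)"
      using ival_nonneg[OF rho_mem[OF u(1)]] u(2) integrable_continuous_real[OF w]
      by (intro Henstock_Kurzweil_Integration.integral_combine)
    then have "integral {\<rho> u..t} (\<lambda>s. 1 / (val f s)\<^sup>2) = \<tau> t - u"
      using tau_val[OF t] tau_val[OF rho_mem[OF u(1)]] u(1) by simp
    then show "\<phi> u * integral {\<rho> u..t} (\<lambda>s. 1 / (val f s)\<^sup>2) = (\<tau> t - u) * \<phi> u" by simp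
  qed simp
  finally show "integral {0..t} (\<lambda>s. D (\<tau> s) / (val f s)\<^sup>2) = (LINT u:{0<..\<tau> t}|M. (\<tau> t - u) * \<phi> u)" .
qed

lemma mild_iff_integral:
  "mild M f x p \<longleftrightarrow> (\<forall>t\<in>ival a. val f t = x + integral {0..t} (\<lambda>s. p - D (\<tau> s)))"
proof -
  have "integral {0..t} (\<lambda>s. p - D (\<tau> s)) =
      p * t - (LINT u:{0<..\<tau> t}|M. (t - \<rho> u) / val f (\<rho> u))" if t: "t \<in> ival a" for t
    using D_tau_integrable[OF t] ival_nonneg[OF t]
    by (subst Henstock_Kurzweil_Integration.integral_diff) (auto simp: integral_D_tau[OF t])
  then show ?thesis unfolding mild_def dom by (intro ball_cong refl) (simp add: add_diff_eq)
qed

text \<open>In the variable \<open>u = tau f t\<close> the equation \<open>mild\<close> is linear.\<close>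

lemma mild_iff_linear:
  "mild M f x p \<longleftrightarrow> (\<forall>t\<in>ival a. 1 / val f t =
     1 / x - p * \<tau> t + (LINT u:{0<..\<tau> t}|M. (\<tau> t - u) * \<phi> u))"
proof -
  \<comment> \<open>\<open>inverse_of_integral\<close> asks for a bounded density; monotonicity of
    \<open>D\<close> supplies the bound.\<close>
  have bound: "\<exists>C. \<forall>s\<in>{0..t}. \<bar>p - D (\<tau> s)\<bar> \<le> C" if t: "t \<in> ival a" for t
  proof (intro exI ballI)
    fix s assume s: "s \<in> {0..t}"
    then have "s \<in> ival a" "\<tau> s \<le> \<tau> t" using ival_le[OF t] tau_le_iff[of s t] t by auto
    then have "0 \<le> D (\<tau> s)" "D (\<tau> s) \<le> D (\<tau> t)" using D_nonneg D_mono tau_mem t by auto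
    then show "\<bar>p - D (\<tau> s)\<bar> \<le> \<bar>p\<bar> + D (\<tau> t)" by linarith
  qed
  have int1: "(\<lambda>s. p - D (\<tau> s)) integrable_on {0..t}" if t: "t \<in> ival a" for t
    by (intro Henstock_Kurzweil_Integration.integrable_diff D_tau_integrable[OF t]) auto
  have int2: "(\<lambda>s. (p - D (\<tau> s)) / (val f s)\<^sup>2) integrable_on {0..t}"
    "integral {0..t} (\<lambda>s. (p - D (\<tau> s)) / (val f s)\<^sup>2) = p * \<tau> t - (LINT u:{0<..\<tau> t}|M. (\<tau> t - u) * \<phi> u)"
    if t: "t \<in> ival a" for t
  proof -
    have 1: "(\<lambda>s. p * (1 / (val f s)\<^sup>2)) integrable_on {0..t}"
      by (intro integrable_on_mult_right integrable_continuous_real continuous_on_subset[OF cont_inv_sq ival_subset[OF t]])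
    note 2 = integral_D_tau_weighted[OF t]
    show "(\<lambda>s. (p - D (\<tau> s)) / (val f s)\<^sup>2) integrable_on {0..t}"
      using Henstock_Kurzweil_Integration.integrable_diff[OF 1 2(1)] by (simp add: diff_divide_distrib)
    show "integral {0..t} (\<lambda>s. (p - D (\<tau> s)) / (val f s)\<^sup>2) = p * \<tau> t - (LINT u:{0<..\<tau> t}|M. (\<tau> t - u) * \<phi> u)"
    proof -
      have "integral {0..t} (\<lambda>s. p * (1 / (val f s)\<^sup>2)) = p * \<tau> t"
        unfolding tau_val[OF t] by (rule Henstock_Kurzweil_Integration.integral_mult_right)
      then show ?thesis
        using Henstock_Kurzweil_Integration.integral_diff[OF 1 2(1)] unfolding 2(2)
        by (simp add: diff_divide_distrib)
    qed
  qed
  show ?thesis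
  proof
    assume "mild M f x p"
    then have f: "val f t = x + integral {0..t} (\<lambda>s. p - D (\<tau> s))" if "t \<in> ival a" for t
      using that mild_iff_integral by blast
    show "\<forall>t\<in>ival a. 1 / val f t = 1 / x - p * \<tau> t + (LINT u:{0<..\<tau> t}|M. (\<tau> t - u) * \<phi> u)"
    proof
      fix t assume t: "t \<in> ival a"
      note sub = ival_le[OF t]
      obtain C where C: "\<forall>s\<in>{0..t}. \<bar>p - D (\<tau> s)\<bar> \<le> C" using bound[OF t] by blast
      have "1 / val f t = 1 / x - integral {0..t} (\<lambda>s. (p - D (\<tau> s)) / (val f s)\<^sup>2)"
        by (rule inverse_of_integral[OF continuous_on_subset[OF cont ival_subset[OF t]] _ int1[OF t] _ int2(1)[OF t], of C])
          (use C nonzero f sub ival_nonneg[OF t] in auto)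
      then show "1 / val f t = 1 / x - p * \<tau> t + (LINT u:{0<..\<tau> t}|M. (\<tau> t - u) * \<phi> u)"
        unfolding int2(2)[OF t] by simp
    qed
  next
    assume R: "\<forall>t\<in>ival a. 1 / val f t = 1 / x - p * \<tau> t + (LINT u:{0<..\<tau> t}|M. (\<tau> t - u) * \<phi> u)"
    show "mild M f x p" unfolding mild_iff_integral
    proof
      fix t assume t: "t \<in> ival a"
      note sub = ival_le[OF t]
      \<comment> \<open>The converse applies the same lemma to the reciprocal of \<open>f\<close>,
        with density \<open>e\<close>: here \<open>e s / (y s)^2\<close> is
        \<open>- (p - D (\<tau> s))\<close>, so that \<open>1 / y\<close> satisfies the wanted
        equation.\<close>
      define y where "y s = 1 / val f s" for s
      define e where "e s = - ((p - D (\<tau> s)) / (val f s)\<^sup>2)" for s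
      have y: "y s = 1 / x + integral {0..s} e" if "s \<in> {0..t}" for s
        using R int2(2)[of s] sub that by (auto simp: y_def e_def[abs_def])
      have ce: "continuous_on {0..t} y"
        unfolding y_def using nonzero sub by (intro continuous_intros continuous_on_subset[OF cont ival_subset[OF t]]) auto
      have ee: "e s / (y s)\<^sup>2 = - (p - D (\<tau> s))" if "s \<in> {0..t}" for s
        using nonzero[OF sub, of s] that by (simp add: e_def y_def power_divide)
      obtain C where C: "\<forall>s\<in>{0..t}. \<bar>p - D (\<tau> s)\<bar> \<le> C" using bound[OF t] by blast
      obtain K where K: "\<forall>s. s \<in> {0..t} \<longrightarrow> \<bar>1 / (val f s)\<^sup>2\<bar> \<le> K"
        using continuous_on_Icc_bounded[OF continuous_on_subset[OF cont_inv_sq ival_subset[OF t]]] by blast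
      have "1 / y t = 1 / (1 / x) - integral {0..t} (\<lambda>s. e s / (y s)\<^sup>2)"
      proof (rule inverse_of_integral[OF ce _ _ _ _ y, of "C * K"])
        show "y s \<noteq> 0" if "s \<in> {0..t}" for s using nonzero[OF sub, of s] that by (simp add: y_def)
        show "e integrable_on {0..t}"
          unfolding e_def using int2(1)[OF t] by (rule integrable_neg)
        show "\<bar>e s\<bar> \<le> C * K" if "s \<in> {0..t}" for s
        proof -
          have "\<bar>e s\<bar> = \<bar>p - D (\<tau> s)\<bar> * \<bar>1 / (val f s)\<^sup>2\<bar>" by (simp add: e_def abs_divide)
          also have "\<dots> \<le> C * K"
            using C K that order_trans[OF abs_ge_zero, of "p - D (\<tau> s)" C] by (intro mult_mono) auto
          finally show ?thesis .
        qed
        show "(\<lambda>s. e s / (y s)\<^sup>2) integrable_on {0..t}"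
          by (rule integrable_eq[OF integrable_neg[OF int1[OF t]]]) (simp add: ee)
        show "t \<in> {0..t}" using ival_nonneg[OF t] by simp
      qed
      also have "integral {0..t} (\<lambda>s. e s / (y s)\<^sup>2) = integral {0..t} (\<lambda>s. - (p - D (\<tau> s)))"
        by (rule Henstock_Kurzweil_Integration.integral_cong) (simp add: ee)
      also have "\<dots> = - integral {0..t} (\<lambda>s. p - D (\<tau> s))"
        by (rule Henstock_Kurzweil_Integration.integral_neg)
      finally show "val f t = x + integral {0..t} (\<lambda>s. p - D (\<tau> s))" by (simp add: y_def)
    qed
  qed
qed

lemma mild_at_0: "mild M f x p \<Longrightarrow> val f 0 = x"
  using zero_mem_ival[OF a_pos] by (auto simp: mild_iff_integral)

end

context pos_path
begin

text \<open>In the variable \<open>u\<close> the region of integration does not change, as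
  \<open>tau\<close> of the image at \<open>t\<close> is \<open>\<tau> (v t)\<close>. The kernel
  transforms by \<open>v t - v r = \<alpha>^2 * (t - r) / ((1 + \<alpha> * \<beta> * t) * (1 +
  \<alpha> * \<beta> * r))\<close>, whose two denominators cancel against the prefactors of the
  image at \<open>t\<close> and at \<open>r\<close>. The new initial data come from
  \<open>(1 + \<alpha> * \<beta> * t) / \<alpha> * v t = \<alpha> * t\<close>.\<close>

lemma
  assumes "0 < \<alpha>"
  shows pos_path_S: "pos_path (S_op \<alpha> \<beta> f) (a_idx \<alpha> \<beta> a) (b_idx \<alpha> \<beta> a b f) M"
    and mild_S: "mild M f x p \<Longrightarrow> mild M (S_op \<alpha> \<beta> f) (x / \<alpha>) (x * \<beta> + p * \<alpha>)"
proof -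
  have \<alpha>: "\<alpha> \<noteq> 0" using assms by simp
  define g where "g = S_op \<alpha> \<beta> f"
  define v where "v t = \<alpha>\<^sup>2 * t / (1 + \<alpha> * \<beta> * t)" for t
  interpret g: A_path g "a_idx \<alpha> \<beta> a" "b_idx \<alpha> \<beta> a b f"
    unfolding g_def by (rule A_path_S[OF \<alpha>])
  have S: "0 < 1 + \<alpha> * \<beta> * t" "v t \<in> ival a" "val g t = (1 + \<alpha> * \<beta> * t) / \<alpha> * val f (v t)"
    "g.\<tau> t = \<tau> (v t)" if "t \<in> ival (a_idx \<alpha> \<beta> a)" for t
    using S_formula[OF \<alpha> that] by (simp_all add: g_def v_def)
  show "pos_path (S_op \<alpha> \<beta> f) (a_idx \<alpha> \<beta> a) (b_idx \<alpha> \<beta> a b f) M"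
    unfolding g_def[symmetric] by unfold_locales (use assms pos S in auto)
  show "mild M (S_op \<alpha> \<beta> f) (x / \<alpha>) (x * \<beta> + p * \<alpha>)" if mild: "mild M f x p"
    unfolding g_def[symmetric] mild_def g.dom
  proof
    fix t assume t: "t \<in> ival (a_idx \<alpha> \<beta> a)"
    note St = S[OF t]
    have "val g t = (1 + \<alpha> * \<beta> * t) / \<alpha> * (x + p * v t) -
        (1 + \<alpha> * \<beta> * t) / \<alpha> * (LINT u:{0<..\<tau> (v t)}|M. (v t - \<rho> u) / val f (\<rho> u))"
      using mild St(2) by (simp add: St(3) mild_def dom right_diff_distrib)
    also have "(1 + \<alpha> * \<beta> * t) / \<alpha> * (x + p * v t) = x / \<alpha> + (x * \<beta> + p * \<alpha>) * t"
    proof -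
      have "(1 + \<alpha> * \<beta> * t) / \<alpha> * v t = \<alpha> * t"
        using assms St(1) by (simp add: v_def power2_eq_square)
      then have "(1 + \<alpha> * \<beta> * t) / \<alpha> * (x + p * v t) = (1 + \<alpha> * \<beta> * t) / \<alpha> * x + p * (\<alpha> * t)"
        by (simp only: distrib_left mult.left_commute[of _ p])
      then show ?thesis using assms by (simp add: field_simps)
    qed
    also have "(1 + \<alpha> * \<beta> * t) / \<alpha> * (LINT u:{0<..\<tau> (v t)}|M. (v t - \<rho> u) / val f (\<rho> u)) =
        (LINT u:{0<..\<tau> (v t)}|M. (1 + \<alpha> * \<beta> * t) / \<alpha> * ((v t - \<rho> u) / val f (\<rho> u)))"
      by (rule set_integral_mult_right[symmetric])
    also have "\<dots> = (LINT u:{0<..g.\<tau> t}|M. (t - g.\<rho> u) / val g (g.\<rho> u))"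
      unfolding St(4)
    proof (intro set_lebesgue_integral_cong allI impI)
      fix u assume "u \<in> {0<..\<tau> (v t)}"
      then have u: "u \<in> ival (b_idx \<alpha> \<beta> a b f)" using ival_le[OF g.tau_mem[OF t]] St(4) by auto
      define r where "r = g.\<rho> u"
      have r: "r \<in> ival (a_idx \<alpha> \<beta> a)" using g.rho_mem[OF u] by (simp add: r_def)
      note Sr = S[OF r]
      have "\<tau> (v r) = u" using Sr(4) u by (simp add: r_def)
      then have vr: "\<rho> u = v r" using Sr(2) rho_tau by auto
      have "v t - v r = \<alpha>\<^sup>2 * (t - r) / ((1 + \<alpha> * \<beta> * t) * (1 + \<alpha> * \<beta> * r))"
        using St(1) Sr(1) by (simp add: v_def divide_simps) (simp add: algebra_simps)
      then show "(1 + \<alpha> * \<beta> * t) / \<alpha> * ((v t - \<rho> u) / val f (\<rho> u)) = (t - g.\<rho> u) / val g (g.\<rho> u)"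
        using St(1) Sr(1) nonzero[OF Sr(2)] assms unfolding vr r_def[symmetric] Sr(3)
        by (simp add: divide_simps power2_eq_square mult_ac)
    qed simp
    finally show "val g t = x / \<alpha> + (x * \<beta> + p * \<alpha>) * t -
        (LINT u:{0<..g.\<tau> t}|M. (t - g.\<rho> u) / val g (g.\<rho> u))" .
  qed
qed

lemma phi_linear:
  assumes "mild M f x p" "u \<in> ival b"
  shows "\<phi> u = 1 / x - p * u + (LINT s:{0<..u}|M. (u - s) * \<phi> s)"
  using assms(1)[unfolded mild_iff_linear, rule_format, OF rho_mem[OF assms(2)]] assms(2) by simp

text \<open>Recovers \<open>\<rho>\<close>, and with it \<open>f\<close>, from \<open>\<phi>\<close>
  alone; thus uniqueness for the linear equation carries over to \<open>f\<close>.\<close>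

lemma rho_integral: "u \<in> ival b \<Longrightarrow> \<rho> u = integral {0..u} (\<lambda>s. 1 / (\<phi> s)\<^sup>2)"
proof -
  assume u: "u \<in> ival b"
  interpret S: A_path "Sigma_op f" b a by (rule A_path_Sigma)
  have "\<rho> u = integral {0..u} (\<lambda>s. 1 / (val (Sigma_op f) s)\<^sup>2)"
    using S.tau_val[OF u] tau_Sigma[OF u] by simp
  also have "\<dots> = integral {0..u} (\<lambda>s. 1 / (\<phi> s)\<^sup>2)"
    using ival_le[OF u] by (intro Henstock_Kurzweil_Integration.integral_cong) (auto simp: val_Sigma)
  finally show ?thesis .
qed

end

section \<open>Linear Volterra equations against a measure\<close>

lemma mult_exp_le:
  fixes x \<kappa> s :: real
  assumes "0 < \<kappa>" shows "(x - s) * exp (\<kappa> * s) \<le> exp (\<kappa> * x) / \<kappa>"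
proof -
  have "\<kappa> * (x - s) \<le> exp (\<kappa> * (x - s))" using exp_ge_add_one_self[of "\<kappa> * (x - s)"] by linarith
  then have "\<kappa> * (x - s) * exp (\<kappa> * s) \<le> exp (\<kappa> * (x - s)) * exp (\<kappa> * s)" by (rule mult_right_mono) simp
  then show ?thesis using assms by (simp add: field_simps exp_add[symmetric])
qed

context loc_finite_measure
begin

text \<open>The weight \<open>exp (- \<kappa> u)\<close> makes the integral operator a contraction for large \<open>\<kappa>\<close>.\<close>

lemma Volterra_unique:
  assumes cont: "continuous_on {0..U} \<delta>"
    and eq: "\<And>u. u \<in> {0..U} \<Longrightarrow> \<delta> u = (LINT s:{0<..u}|M. (u - s) * \<delta> s)"
    and u: "u \<in> {0..U}"
  shows "\<delta> u = 0"
proof -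
  define m where "m = measure M {0<..U}"
  \<comment> \<open>By \<open>mult_exp_le\<close> the weighted kernel is at most
    \<open>1 / \<kappa>\<close>, so the operator has norm at most \<open>m / \<kappa>\<close>; this
    choice makes it less than 1 and is positive also for \<open>m = 0\<close>.\<close>
  define \<kappa> where "\<kappa> = 2 * m + 1"
  have "0 \<le> m" by (simp add: m_def)
  then have \<kappa>: "0 < \<kappa>" "m / \<kappa> < 1" by (auto simp: \<kappa>_def divide_simps)
  have "continuous_on {0..U} (\<lambda>u. \<bar>\<delta> u\<bar> * exp (- \<kappa> * u))" by (intro continuous_intros cont)
  \<comment> \<open>At a maximum of the weighted function the estimate can be played against itself:
    it yields \<open>C \<le> C * (m / \<kappa>)\<close>.\<close>
  then obtain z where z: "z \<in> {0..U}" "\<And>u. u \<in> {0..U} \<Longrightarrow> \<bar>\<delta> u\<bar> * exp (- \<kappa> * u) \<le> \<bar>\<delta> z\<bar> * exp (- \<kappa> * z)"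
    using continuous_attains_sup[OF compact_Icc, of 0 U] u by blast
  define C where "C = \<bar>\<delta> z\<bar> * exp (- \<kappa> * z)"
  have bound: "\<bar>\<delta> s\<bar> \<le> C * exp (\<kappa> * s)" if "s \<in> {0..U}" for s
  proof -
    have "\<bar>\<delta> s\<bar> * exp (- \<kappa> * s) * exp (\<kappa> * s) \<le> C * exp (\<kappa> * s)"
      unfolding C_def by (rule mult_right_mono[OF z(2)[OF that]]) simp
    then show ?thesis by (simp add: mult.assoc exp_add[symmetric])
  qed
  have int: "set_integrable M {0<..z} (\<lambda>s. (z - s) * \<delta> s)"
    using z(1) by (intro set_integrable_M continuous_intros continuous_on_subset[OF cont]) auto
  have "\<bar>\<delta> z\<bar> \<le> (LINT s:{0<..z}|M. \<bar>(z - s) * \<delta> s\<bar>)"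
    using set_integral_norm_bound[OF int] eq[OF z(1)] by simp
  also have "\<dots> \<le> (LINT s:{0<..z}|M. C * exp (\<kappa> * z) / \<kappa>)"
  proof (rule set_integral_mono)
    show "set_integrable M {0<..z} (\<lambda>s. \<bar>(z - s) * \<delta> s\<bar>)"
      using set_integrable_abs[OF int] .
    show "set_integrable M {0<..z} (\<lambda>s. C * exp (\<kappa> * z) / \<kappa>)"
      by (intro set_integrable_M continuous_intros)
    fix s assume s: "s \<in> {0<..z}"
    have "\<bar>(z - s) * \<delta> s\<bar> \<le> (z - s) * (C * exp (\<kappa> * s))"
      unfolding abs_mult using bound[of s] s z by (intro mult_mono) auto
    also have "\<dots> = C * ((z - s) * exp (\<kappa> * s))" by simp
    also have "\<dots> \<le> C * (exp (\<kappa> * z) / \<kappa>)"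
      by (intro mult_left_mono mult_exp_le \<kappa>) (simp add: C_def)
    finally show "\<bar>(z - s) * \<delta> s\<bar> \<le> C * exp (\<kappa> * z) / \<kappa>" by simp
  qed
  also have "\<dots> = C * exp (\<kappa> * z) / \<kappa> * measure M {0<..z}"
    using finite_Ioc[of z] by (subst set_integral_const) (auto simp: less_top)
  also have "\<dots> \<le> C * exp (\<kappa> * z) / \<kappa> * m"
    unfolding m_def using finite_Ioc[of U] z(1) \<kappa>
    by (intro mult_left_mono measure_mono_fmeasurable) (auto simp: C_def fmeasurable_def)
  finally have "C * exp (\<kappa> * z) \<le> C * exp (\<kappa> * z) * (m / \<kappa>)"
    by (simp add: C_def mult.assoc exp_add[symmetric])
  moreover have "C * exp (\<kappa> * z) * (m / \<kappa>) < C * exp (\<kappa> * z) * 1" if "0 < C"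
    using that \<kappa> by (intro mult_strict_left_mono) auto
  ultimately have "C \<le> 0" by force
  then have "\<bar>\<delta> u\<bar> \<le> 0" using bound[OF u] mult_nonpos_nonneg[of C "exp (\<kappa> * u)"] by simp
  then show ?thesis by simp
qed

end

text \<open>The two linear equations live on different \<open>u\<close>-intervals. The map with the
  smaller \<open>tau\<close> at \<open>t\<close> is taken first, so that \<open>U = \<tau> t\<close>
  lies in both. Then both \<open>\<phi>\<close> agree on \<open>{0..U}\<close>, hence both
  \<open>\<rho>\<close> take \<open>U\<close> to \<open>t\<close>, and the values at
  \<open>t\<close> are the reciprocals of the common value at \<open>U\<close>.\<close>

lemma mild_unique:
  assumes f: "pos_path f a b M" "mild M f x p" and g: "pos_path g a' b' M" "mild M g x p"
    and t: "t \<in> ival a" "t \<in> ival a'"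
  shows "val f t = val g t"
proof -
  have main: "val f t = val g t"
    if f: "pos_path f a b M" "mild M f x p" and g: "pos_path g a' b' M" "mild M g x p"
    and t: "t \<in> ival a" "t \<in> ival a'" and le: "val (tau f) t \<le> val (tau g) t" for f a b g a' b'
  proof -
    interpret f: pos_path f a b M by (rule f(1))
    interpret g: pos_path g a' b' M by (rule g(1))
    define U where "U = f.\<tau> t"
    have Ub: "U \<in> ival b" "U \<in> ival b'" "0 \<le> U"
      using f.tau_mem[OF t(1)] ival_le[OF g.tau_mem[OF t(2)]] le f.tau_nonneg[OF t(1)] by (auto simp: U_def)
    have mem: "u \<in> ival b" "u \<in> ival b'" if "u \<in> {0..U}" for u
      using that ival_le[OF Ub(1)] ival_le[OF Ub(2)] by auto
    have cont: "continuous_on {0..U} f.\<phi>" "continuous_on {0..U} g.\<phi>"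
      by (rule continuous_on_subset[OF f.phi_cont ival_subset[OF Ub(1)]],
          rule continuous_on_subset[OF g.phi_cont ival_subset[OF Ub(2)]])
    have eq: "f.\<phi> u = g.\<phi> u" if u: "u \<in> {0..U}" for u
    proof -
      have "f.\<phi> u - g.\<phi> u = 0"
      proof (rule f.Volterra_unique[OF _ _ u])
        show "continuous_on {0..U} (\<lambda>u. f.\<phi> u - g.\<phi> u)" by (rule continuous_on_diff[OF cont])
        fix v assume v: "v \<in> {0..U}"
        have "continuous_on {0..v} (\<lambda>s. (v - s) * f.\<phi> s)" "continuous_on {0..v} (\<lambda>s. (v - s) * g.\<phi> s)"
          using v continuous_on_subset[OF cont(1), of "{0..v}"] continuous_on_subset[OF cont(2), of "{0..v}"]
          by (auto intro!: continuous_on_mult continuous_on_diff simp del: times_divide_eq_right)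
        then have "(LINT s:{0<..v}|M. (v - s) * f.\<phi> s - (v - s) * g.\<phi> s) =
            (LINT s:{0<..v}|M. (v - s) * f.\<phi> s) - (LINT s:{0<..v}|M. (v - s) * g.\<phi> s)"
          by (intro set_integral_diff f.set_integrable_M)
        then show "f.\<phi> v - g.\<phi> v = (LINT s:{0<..v}|M. (v - s) * (f.\<phi> s - g.\<phi> s))"
          unfolding f.phi_linear[OF f(2) mem(1)[OF v]] g.phi_linear[OF g(2) mem(2)[OF v]]
          by (simp add: right_diff_distrib)
      qed
      then show ?thesis by simp
    qed
    have "f.\<rho> U = g.\<rho> U"
      unfolding f.rho_integral[OF Ub(1)] g.rho_integral[OF Ub(2)]
      by (intro Henstock_Kurzweil_Integration.integral_cong) (metis eq)
    then have "f.\<rho> U = t" "g.\<rho> U = t" using t by (simp_all add: U_def)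
    then show "val f t = val g t" using eq[of U] Ub(3) by simp
  qed
  show ?thesis
    using main[OF f g t] main[OF g f t(2,1)] by (metis linear)
qed

lemma continuous_on_ivalI:
  fixes g :: "real \<Rightarrow> real"
  assumes "\<And>t. t \<in> ival a \<Longrightarrow> continuous_on {0..t} g"
  shows "continuous_on (ival a) g"
  unfolding continuous_on_eq_continuous_within
proof
  fix t assume t: "t \<in> ival a"
  obtain t' where t': "t < t'" "t' \<in> ival a" using t by (rule ival_obtain_gt)
  have "at t within {0..t'} = at t within ival a"
    using t t' ival_subset[OF t'(2)]
    by (intro at_within_nhd[of _ "{..<t'}"]) (auto dest: ival_nonneg)
  moreover have "continuous (at t within {0..t'}) g"
    using assms[OF t'(2)] t t' ival_nonneg[OF t] by (auto simp: continuous_on_eq_continuous_within)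
  ultimately show "continuous (at t within ival a) g" by simp
qed

context loc_finite_measure
begin

text \<open>Values in \<open>ennreal\<close>: the kernel is nonnegative, so the series and its
  exchange with the integral require no prior convergence, and finiteness is a separate
  estimate.\<close>

primrec Picard :: "nat \<Rightarrow> real \<Rightarrow> ennreal" where
  "Picard 0 u = 1"
| "Picard (Suc n) u = (\<integral>\<^sup>+ s. ennreal (u - s) * Picard n s * indicator {0<..u} s \<partial>M)"

text \<open>The set in \<open>indicator {0<..u} s\<close> depends on the parameter; as
  \<open>of_bool\<close> of a predicate in \<open>s\<close> and \<open>u\<close> the integrand is
  visibly jointly measurable.\<close>

lemma Picard_measurable [measurable]: "Picard n \<in> borel_measurable borel"
proof (induction n)
  case (Suc n)
  interpret sigma_finite_measure M by (rule sigma_finite)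
  note Suc[measurable]
  have "(\<lambda>u. \<integral>\<^sup>+ s. ennreal (u - s) * Picard n s * of_bool (0 < s \<and> s \<le> u) \<partial>M) \<in> borel_measurable borel"
    by measurable
  moreover have "Picard (Suc n) = (\<lambda>u. \<integral>\<^sup>+ s. ennreal (u - s) * Picard n s * of_bool (0 < s \<and> s \<le> u) \<partial>M)"
    by (auto intro!: nn_integral_cong simp: indicator_def)
  ultimately show ?case by simp
qed (simp add: fun_eq_iff)

text \<open>Each integration against the kernel costs a factor \<open>m / \<kappa>\<close>, where
  \<open>m\<close> is the mass of \<open>{0<..U}\<close>; \<kappa> is chosen to make it at most 1/2,
  so a geometric series dominates the iterates on \<open>[0,U]\<close>.\<close>

lemma Picard_bound:
  assumes u: "0 \<le> u" "u \<le> U"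
  defines "\<kappa> \<equiv> 2 * measure M {0<..U} + 1"
  shows "Picard n u \<le> ennreal (exp (\<kappa> * u) * (1 / 2) ^ n)"
  using u
proof (induction n arbitrary: u)
  case 0
  then show ?case by (simp add: \<kappa>_def)
next
  case (Suc n)
  define m where "m = measure M {0<..U}"
  have \<kappa>: "0 < \<kappa>" "m / \<kappa> \<le> 1 / 2" by (auto simp: \<kappa>_def m_def divide_simps add_nonneg_pos)
  have em: "emeasure M {0<..U} = ennreal m"
    unfolding m_def using finite_Ioc[of U] by (intro emeasure_eq_ennreal_measure) (auto simp: less_top)
  have "Picard (Suc n) u \<le> (\<integral>\<^sup>+ s. ennreal (exp (\<kappa> * u) / \<kappa> * (1 / 2) ^ n) * indicator {0<..U} s \<partial>M)"
    unfolding Picard.simps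
  proof (intro nn_integral_mono)
    fix s
    have "ennreal (u - s) * Picard n s \<le> ennreal (exp (\<kappa> * u) / \<kappa> * (1 / 2) ^ n)"
      if s: "0 < s" "s \<le> u"
    proof -
      have "ennreal (u - s) * Picard n s \<le> ennreal (u - s) * ennreal (exp (\<kappa> * s) * (1 / 2) ^ n)"
        using Suc.IH[of s] s Suc.prems by (intro mult_left_mono) auto
      also have "\<dots> = ennreal ((u - s) * exp (\<kappa> * s) * (1 / 2) ^ n)"
        using s by (subst ennreal_mult'[symmetric]) (auto simp: mult.assoc)
      also have "\<dots> \<le> ennreal (exp (\<kappa> * u) / \<kappa> * (1 / 2) ^ n)"
        by (intro ennreal_leI mult_right_mono mult_exp_le \<kappa>) simp
      finally show ?thesis .
    qed
    then show "ennreal (u - s) * Picard n s * indicator {0<..u} s \<le>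
        ennreal (exp (\<kappa> * u) / \<kappa> * (1 / 2) ^ n) * indicator {0<..U} s"
      using Suc.prems by (auto simp: indicator_def)
  qed
  also have "\<dots> = ennreal (exp (\<kappa> * u) / \<kappa> * (1 / 2) ^ n) * ennreal m"
    by (subst nn_integral_cmult_indicator) (auto simp: em)
  also have "\<dots> = ennreal (exp (\<kappa> * u) * (1 / 2) ^ n * (m / \<kappa>))"
    using \<kappa> by (subst ennreal_mult''[symmetric]) (auto simp: m_def)
  also have "\<dots> \<le> ennreal (exp (\<kappa> * u) * (1 / 2) ^ n * (1 / 2))"
    by (intro ennreal_leI mult_left_mono \<kappa>) simp
  finally show ?case by (simp add: mult_ac)
qed

text \<open>The solution is the sum of the iterates: the zeroth term gives
  \<open>1 \<le> \<phi> u\<close>, the geometric bound gives finiteness, and continuity comes as a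
  local Lipschitz estimate.\<close>

lemma Volterra_exists:
  "\<exists>\<phi>. continuous_on {0..} \<phi> \<and>
    (\<forall>u\<ge>0. 1 \<le> \<phi> u \<and> \<phi> u = 1 + (LINT s:{0<..u}|M. (u - s) * \<phi> s))"
proof -
  define \<Phi> where "\<Phi> u = (\<Sum>n. Picard n u)" for u
  have [measurable]: "\<Phi> \<in> borel_measurable borel" unfolding \<Phi>_def by measurable
  have bound: "\<exists>B. \<forall>u. 0 \<le> u \<and> u \<le> U \<longrightarrow> \<Phi> u \<le> ennreal B" for U
  proof -
    define \<kappa> where "\<kappa> = 2 * measure M {0<..U} + 1"
    have "\<Phi> u \<le> ennreal (exp (\<kappa> * U) * 2)" if u: "0 \<le> u" "u \<le> U" for u
    proof -
      have "Picard n u \<le> ennreal (exp (\<kappa> * U) * (1 / 2) ^ n)" for n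
      proof (rule order_trans[OF Picard_bound[OF u]])
        have "\<kappa> * u \<le> \<kappa> * U" using u by (intro mult_left_mono) (auto simp: \<kappa>_def)
        then show "ennreal (exp ((2 * measure M {0<..U} + 1) * u) * (1 / 2) ^ n) \<le> ennreal (exp (\<kappa> * U) * (1 / 2) ^ n)"
          unfolding \<kappa>_def[symmetric] by (intro ennreal_leI mult_right_mono) auto
      qed
      then have "\<Phi> u \<le> (\<Sum>n. ennreal (exp (\<kappa> * U) * (1 / 2) ^ n))"
        unfolding \<Phi>_def by (intro suminf_le) auto
      also have "\<dots> = ennreal (exp (\<kappa> * U) * 2)"
        using sums_mult[OF geometric_sums[of "1 / 2 :: real"], of "exp (\<kappa> * U)"]
        by (intro suminf_ennreal_eq) auto
      finally show ?thesis .
    qed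
    then show ?thesis by blast
  qed
  have eq: "\<Phi> u = 1 + (\<integral>\<^sup>+ s. ennreal (u - s) * \<Phi> s * indicator {0<..u} s \<partial>M)" for u
  proof -
    have "(\<lambda>n. Picard (Suc n) u) sums (\<Sum>n. Picard (Suc n) u)" by (intro summable_sums) auto
    from sums_Suc[OF this] have "\<Phi> u = (\<Sum>n. Picard (Suc n) u) + 1"
      unfolding \<Phi>_def by (auto dest: sums_unique)
    also have "(\<Sum>n. Picard (Suc n) u) = (\<integral>\<^sup>+ s. (\<Sum>n. ennreal (u - s) * Picard n s * indicator {0<..u} s) \<partial>M)"
      unfolding Picard.simps by (subst nn_integral_suminf) auto
    also have "\<dots> = (\<integral>\<^sup>+ s. ennreal (u - s) * \<Phi> s * indicator {0<..u} s \<partial>M)"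
      unfolding \<Phi>_def by (intro nn_integral_cong) (simp add: ennreal_suminf_cmult ennreal_suminf_multc)
    finally show ?thesis by (simp add: add.commute)
  qed
  define \<phi> where "\<phi> u = enn2real (\<Phi> u)" for u
  have [measurable]: "\<phi> \<in> borel_measurable borel" unfolding \<phi>_def by measurable
  have \<Phi>: "\<Phi> u = ennreal (\<phi> u)" if u: "0 \<le> u" for u
  proof -
    obtain B where "\<Phi> u \<le> ennreal B" using bound[of u] u by auto
    then have "\<Phi> u < top" by (rule le_less_trans) simp
    then show ?thesis by (simp add: \<phi>_def)
  qed
  have \<phi>0: "0 \<le> \<phi> u" for u by (simp add: \<phi>_def)
  have ge1: "1 \<le> \<phi> u" if "0 \<le> u" for u
  proof -
    have "1 \<le> \<Phi> u" by (subst eq) simp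
    then show ?thesis by (simp add: \<Phi>[OF that] ennreal_le_iff[OF \<phi>0] flip: ennreal_1)
  qed
  have int_eq: "\<phi> u = 1 + (LINT s:{0<..u}|M. (u - s) * \<phi> s)" if u: "0 \<le> u" for u
  proof -
    have "(\<integral>\<^sup>+ s. ennreal (indicator {0<..u} s *\<^sub>R ((u - s) * \<phi> s)) \<partial>M) =
        (\<integral>\<^sup>+ s. ennreal (u - s) * \<Phi> s * indicator {0<..u} s \<partial>M)"
      using \<Phi> \<phi>0 by (intro nn_integral_cong) (auto simp: indicator_def ennreal_mult)
    moreover have "1 + (\<integral>\<^sup>+ s. ennreal (u - s) * \<Phi> s * indicator {0<..u} s \<partial>M) = 1 + ennreal (\<phi> u - 1)"
      using eq[of u] ge1[OF u] by (simp add: \<Phi>[OF u] flip: ennreal_1 ennreal_plus)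
    ultimately have *: "(\<integral>\<^sup>+ s. ennreal (indicator {0<..u} s *\<^sub>R ((u - s) * \<phi> s)) \<partial>M) = ennreal (\<phi> u - 1)"
      by (simp only: ennreal_add_left_cancel) simp
    have "has_bochner_integral M (\<lambda>s. indicator {0<..u} s *\<^sub>R ((u - s) * \<phi> s)) (\<phi> u - 1)"
    proof (rule has_bochner_integral_nn_integral)
      show "AE s in M. 0 \<le> indicator {0<..u} s *\<^sub>R ((u - s) * \<phi> s)"
        using \<phi>0 by (intro AE_I2) (auto simp: indicator_def)
    qed (use * ge1[OF u] in auto)
    then show ?thesis by (simp add: set_lebesgue_integral_def has_bochner_integral_integral_eq)
  qed
  have cont: "continuous_on {0..U} \<phi>" for U
  proof -
    obtain B where B: "\<And>u. 0 \<le> u \<Longrightarrow> u \<le> U \<Longrightarrow> \<Phi> u \<le> ennreal B" using bound by blast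
    define J where "J = (\<integral>\<^sup>+ s. \<Phi> s * indicator {0<..U} s \<partial>M)"
    have "J \<le> (\<integral>\<^sup>+ s. ennreal B * indicator {0<..U} s \<partial>M)"
      unfolding J_def using B by (intro nn_integral_mono) (auto simp: indicator_def)
    also have "\<dots> = ennreal B * emeasure M {0<..U}" by (rule nn_integral_cmult_indicator) simp
    also have "\<dots> < top" using finite_Ioc[of U] by (simp add: ennreal_mult_less_top)
    finally obtain j where j: "J = ennreal j" "0 \<le> j" by (cases J) auto
    have incr: "\<bar>\<phi> v - \<phi> u\<bar> \<le> j * (v - u)" if uv: "0 \<le> u" "u \<le> v" "v \<le> U" for u v
    proof -
      have "(\<integral>\<^sup>+ s. ennreal (u - s) * \<Phi> s * indicator {0<..u} s \<partial>M) \<le>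
          (\<integral>\<^sup>+ s. ennreal (v - s) * \<Phi> s * indicator {0<..v} s \<partial>M)"
        using uv by (intro nn_integral_mono) (auto simp: indicator_def intro!: mult_right_mono ennreal_leI)
      then have "\<Phi> u \<le> \<Phi> v" by (subst (1 2) eq) (rule add_left_mono)
      then have "\<phi> u \<le> \<phi> v" using uv by (simp add: \<Phi> \<phi>0 ennreal_le_iff)
      have "(\<integral>\<^sup>+ s. ennreal (v - s) * \<Phi> s * indicator {0<..v} s \<partial>M) \<le>
        (\<integral>\<^sup>+ s. ennreal (u - s) * \<Phi> s * indicator {0<..u} s + ennreal (v - u) * (\<Phi> s * indicator {0<..U} s) \<partial>M)"
      proof (intro nn_integral_mono)
        fix s
        \<comment> \<open>Moving the parameter from \<open>u\<close> to \<open>v\<close> raises the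
          truncated kernel by at most \<open>v - u\<close>, so the integral \<open>j\<close> of
          \<Phi> over \<open>{0<..U}\<close> is a Lipschitz constant.\<close>
        have "ennreal (v - s) \<le> ennreal (u - s) + ennreal (v - u)" if "s \<le> u"
          using that uv by (subst ennreal_plus[symmetric]) auto
        then have "ennreal (v - s) * \<Phi> s \<le> ennreal (u - s) * \<Phi> s + ennreal (v - u) * \<Phi> s" if "s \<le> u"
          using mult_right_mono[of _ _ "\<Phi> s"] that by (simp flip: distrib_right)
        moreover have "ennreal (v - s) * \<Phi> s \<le> ennreal (v - u) * \<Phi> s" if "u < s"
          using that by (intro mult_right_mono ennreal_leI) auto
        ultimately show "ennreal (v - s) * \<Phi> s * indicator {0<..v} s \<le>
            ennreal (u - s) * \<Phi> s * indicator {0<..u} s + ennreal (v - u) * (\<Phi> s * indicator {0<..U} s)"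
          using uv by (auto simp: indicator_def)
      qed
      also have "\<dots> = (\<integral>\<^sup>+ s. ennreal (u - s) * \<Phi> s * indicator {0<..u} s \<partial>M) + ennreal (v - u) * J"
        unfolding J_def by (subst nn_integral_add) (auto simp: nn_integral_cmult)
      finally have "\<Phi> v \<le> \<Phi> u + ennreal (v - u) * J"
        by (subst (1 2) eq) (simp add: add.assoc add_left_mono)
      then have "ennreal (\<phi> v) \<le> ennreal (\<phi> u + (v - u) * j)"
        using uv j \<phi>0 by (simp add: \<Phi> ennreal_mult ennreal_plus)
      then have "\<phi> v \<le> \<phi> u + (v - u) * j"
        using uv j(2) \<phi>0 by (subst (asm) ennreal_le_iff) (auto intro!: add_nonneg_nonneg mult_nonneg_nonneg)
      with \<open>\<phi> u \<le> \<phi> v\<close> show ?thesis by (simp add: mult.commute)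
    qed
    have "j-lipschitz_on {0..U} \<phi>"
    proof (rule lipschitz_onI)
      fix x y assume "x \<in> {0..U}" "y \<in> {0..U}"
      then show "dist (\<phi> x) (\<phi> y) \<le> j * dist x y"
        using incr[of x y] incr[of y x] by (cases "x \<le> y") (auto simp: dist_real_def abs_minus_commute)
    qed (rule j)
    then show ?thesis by (rule lipschitz_on_continuous_on)
  qed
  show ?thesis
  proof (intro exI conjI allI impI)
    show "continuous_on {0..} \<phi>" using continuous_on_ivalI[of \<infinity> \<phi>] cont by simp
  qed (use int_eq ge1 in auto)
qed

text \<open>The data 1 and 0 turn \<open>mild_iff_linear\<close> into the equation just solved. The
  path \<open>g\<close> with values \<phi> lives on the half-line, so \<open>Sigma_op g\<close> has
  a \<open>tau\<close> with unbounded range.\<close>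

lemma mild_exists:
  obtains f L where "pos_path f L \<infinity> M" "mild M f 1 0"
proof -
  obtain \<phi> where \<phi>: "continuous_on {0..} \<phi>"
    "\<And>u. 0 \<le> u \<Longrightarrow> 1 \<le> \<phi> u \<and> \<phi> u = 1 + (LINT s:{0<..u}|M. (u - s) * \<phi> s)"
    using Volterra_exists by auto
  define g :: pfun where "g u = (if 0 \<le> u then Some (\<phi> u) else None)" for u
  have val_g: "val g u = \<phi> u" if "0 \<le> u" for u using that by (simp add: g_def)
  have "path g \<infinity>"
  proof
    show "dom g = ival \<infinity>" by (auto simp: g_def dom_def)
    show "continuous_on (ival \<infinity>) (val g)"
      using \<phi>(1) by (subst continuous_on_cong[OF refl val_g]) auto
    show "(\<forall>t\<in>ival \<infinity>. 0 < val g t) \<or> (\<forall>t\<in>ival \<infinity>. 0 < - val g t)"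
      using \<phi>(2) by (force simp: val_g)
  qed simp
  then interpret g: A_path g \<infinity> "tau_at g \<infinity>" by (simp add: A_path_def A_path_axioms_def)
  define f where "f = Sigma_op g"
  interpret f: A_path f "tau_at g \<infinity>" \<infinity> unfolding f_def by (rule g.A_path_Sigma)
  have val_f: "val f t = 1 / \<phi> (g.\<rho> t)" "f.\<tau> t = g.\<rho> t" "0 \<le> g.\<rho> t" if "t \<in> ival (tau_at g \<infinity>)" for t
    using g.val_Sigma[OF that] g.tau_Sigma[OF that] g.rho_mem[OF that] by (simp_all add: f_def val_g)
  have pp: "pos_path f (tau_at g \<infinity>) \<infinity> M"
  proof
    fix t assume t: "t \<in> ival (tau_at g \<infinity>)"
    then show "0 < val f t" using \<phi>(2)[of "g.\<rho> t"] val_f[OF t] by auto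
  qed
  interpret f: pos_path f "tau_at g \<infinity>" \<infinity> M by (rule pp)
  have phi: "f.\<phi> u = \<phi> u" if "0 \<le> u" for u
    using that g.rho_Sigma[of u] val_f[OF g.tau_mem, of u] by (simp add: f_def)
  have "mild M f 1 0" unfolding f.mild_iff_linear
  proof
    fix t assume t: "t \<in> ival (tau_at g \<infinity>)"
    note v = val_f[OF t]
    have "1 / val f t = 1 + (LINT s:{0<..f.\<tau> t}|M. (f.\<tau> t - s) * \<phi> s)"
      using \<phi>(2)[OF v(3)] by (simp add: v(1,2))
    also have "(LINT s:{0<..f.\<tau> t}|M. (f.\<tau> t - s) * \<phi> s) = (LINT s:{0<..f.\<tau> t}|M. (f.\<tau> t - s) * f.\<phi> s)"
      by (intro set_lebesgue_integral_cong allI impI) (simp_all only: phi greaterThanAtMost_iff less_imp_le, simp)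
    finally show "1 / val f t = 1 / 1 - 0 * f.\<tau> t + (LINT s:{0<..f.\<tau> t}|M. (f.\<tau> t - s) * f.\<phi> s)"
      by simp
  qed
  with pp show thesis by (rule that)
qed

end

section \<open>Test functions\<close>

definition smooth :: "(real \<Rightarrow> real) \<Rightarrow> bool" where
  "smooth f \<longleftrightarrow> (\<forall>n. (deriv ^^ n) f differentiable_on UNIV)"

text \<open>A class closed under differentiation takes the place of formulas for all higher
  derivatives.\<close>

lemma smooth_coinduct:
  assumes "f \<in> C" and C: "\<And>g. g \<in> C \<Longrightarrow> \<exists>g'\<in>C. \<forall>x. (g has_real_derivative g' x) (at x)"
  shows "smooth f"
proof -
  have "(deriv ^^ n) f \<in> C" for n
  proof (induction n)
    case (Suc n)
    then obtain g' where g': "g' \<in> C" "\<And>x. ((deriv ^^ n) f has_real_derivative g' x) (at x)"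
      using C by blast
    then have "deriv ((deriv ^^ n) f) = g'" by (intro ext DERIV_imp_deriv)
    then show ?case using g' by simp
  qed (use assms in simp)
  then show ?thesis
    unfolding smooth_def differentiable_on_def using C
    by (meson differentiableI differentiable_at_withinI field_differentiable_def real_differentiable_def)
qed

lemma smooth_deriv: "smooth f \<Longrightarrow> smooth (deriv f)"
  unfolding smooth_def by (auto simp: funpow_Suc_right simp del: funpow.simps dest: spec[of _ "Suc _"])

lemma smooth_DERIV: "smooth f \<Longrightarrow> (f has_real_derivative deriv f x) (at x)"
  unfolding smooth_def differentiable_on_def
  by (metis DERIV_deriv_iff_real_differentiable UNIV_I funpow_0)

lemma smooth_continuous: "smooth f \<Longrightarrow> continuous_on S f"
  by (meson DERIV_isCont continuous_at_imp_continuous_on smooth_DERIV)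

lemma smooth_antiderivative:
  assumes "\<And>x. (F has_real_derivative g x) (at x)" "smooth g"
  shows "smooth F"
proof (rule smooth_coinduct[of _ "insert F {f. smooth f}"])
  fix h assume "h \<in> insert F {f. smooth f}"
  then show "\<exists>g'\<in>insert F {f. smooth f}. \<forall>x. (h has_real_derivative g' x) (at x)"
    using assms smooth_deriv smooth_DERIV by blast
qed simp

lemma smooth_affine:
  assumes "smooth f" shows "smooth (\<lambda>x. f (c * x + d))"
proof (rule smooth_coinduct[of _ "{\<lambda>x. k * g (c * x + d) | k g. smooth g}"])
  show "(\<lambda>x. f (c * x + d)) \<in> {\<lambda>x. k * g (c * x + d) | k g. smooth g}"
    using assms by (auto intro!: exI[of _ 1])
  fix h assume "h \<in> {\<lambda>x. k * g (c * x + d) | k g. smooth g}"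
  then obtain k g where h: "h = (\<lambda>x. k * g (c * x + d))" "smooth g" by blast
  show "\<exists>g'\<in>{\<lambda>x. k * g (c * x + d) | k g. smooth g}. \<forall>x. (h has_real_derivative g' x) (at x)"
  proof (rule bexI[of _ "\<lambda>x. (k * c) * deriv g (c * x + d)"])
    have "((\<lambda>x. g (c * x + d)) has_real_derivative deriv g (c * x + d) * c) (at x)" for x
      by (rule DERIV_chain2[OF smooth_DERIV[OF h(2)]]) (auto intro!: derivative_eq_intros)
    from DERIV_cmult[OF this, of k] show "\<forall>x. (h has_real_derivative k * c * deriv g (c * x + d)) (at x)"
      by (simp add: h(1) mult_ac)
  qed (use smooth_deriv[OF h(2)] in blast)
qed

text \<open>Products alone are not closed under differentiation; by the Leibniz rule finite sums of
  products are, which fits \<open>smooth_coinduct\<close>.\<close>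

inductive_set product_sums :: "(real \<Rightarrow> real) set" where
  prod: "smooth f \<Longrightarrow> smooth g \<Longrightarrow> (\<lambda>x. f x * g x) \<in> product_sums"
| sum: "f \<in> product_sums \<Longrightarrow> g \<in> product_sums \<Longrightarrow> (\<lambda>x. f x + g x) \<in> product_sums"

lemma smooth_product_sums: "f \<in> product_sums \<Longrightarrow> smooth f"
proof (erule smooth_coinduct)
  fix h assume "h \<in> product_sums"
  then show "\<exists>g'\<in>product_sums. \<forall>x. (h has_real_derivative g' x) (at x)"
  proof induction
    case (prod f g)
    show ?case
    proof (rule bexI)
      show "\<forall>x. ((\<lambda>x. f x * g x) has_real_derivative deriv f x * g x + f x * deriv g x) (at x)"
        using DERIV_mult[OF smooth_DERIV[OF prod(1)] smooth_DERIV[OF prod(2)]] by (simp add: mult.commute add.commute)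
      show "(\<lambda>x. deriv f x * g x + f x * deriv g x) \<in> product_sums"
        by (intro product_sums.intros smooth_deriv prod)
    qed
  next
    case (sum f g)
    then obtain f' g' where "f' \<in> product_sums" "g' \<in> product_sums"
      "\<forall>x. (f has_real_derivative f' x) (at x)" "\<forall>x. (g has_real_derivative g' x) (at x)" by blast
    then show ?case by (intro bexI[of _ "\<lambda>x. f' x + g' x"]) (auto intro: DERIV_add product_sums.sum)
  qed
qed

lemma smooth_const: "smooth (\<lambda>_. c)"
  by (rule smooth_coinduct[of _ "range (\<lambda>c _. c)"]) (auto intro!: exI[of _ 0])

lemma smooth_mult: "smooth f \<Longrightarrow> smooth g \<Longrightarrow> smooth (\<lambda>x. f x * g x)"
  by (rule smooth_product_sums[OF product_sums.prod])

lemma smooth_add: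
  assumes "smooth f" "smooth g" shows "smooth (\<lambda>x. f x + g x)"
proof -
  have "(\<lambda>x. f x * 1 + g x * 1) \<in> product_sums"
    by (rule product_sums.sum; rule product_sums.prod) (rule assms smooth_const)+
  then show ?thesis using smooth_product_sums by simp
qed

section \<open>Flat functions, plateaus and ramps\<close>

lemma poly_exp_tendsto_0:
  fixes p :: "real poly"
  shows "((\<lambda>y. poly p y * exp (- y)) \<longlongrightarrow> 0) at_top"
proof -
  have "((\<lambda>y. \<Sum>i\<le>degree p. coeff p i * (y ^ i / exp y)) \<longlongrightarrow> (\<Sum>i\<le>degree p. coeff p i * 0)) at_top"
    by (intro tendsto_intros tendsto_power_div_exp_0)
  moreover have "(\<lambda>y. \<Sum>i\<le>degree p. coeff p i * (y ^ i / exp y)) = (\<lambda>y. poly p y * exp (- y))"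
    by (auto simp: poly_altdef sum_distrib_right exp_minus divide_inverse mult.assoc)
  ultimately show ?thesis by simp
qed

text \<open>A family closed under differentiation that contains \<open>exp (- (1 / x))\<close>. With
  \<open>y = 1 / x\<close>, the derivative of \<open>poly p y * exp (- y)\<close> in
  \<open>x\<close> is \<open>y^2 * (poly p y - poly (pderiv p) y) * exp (- y)\<close>, whence the
  factor \<open>[:0, 0, 1:]\<close> in \<open>DERIV_flat\<close>.\<close>

definition flat :: "real poly \<Rightarrow> real \<Rightarrow> real" where
  "flat p x = (if 0 < x then poly p (1 / x) * exp (- (1 / x)) else 0)"

lemma DERIV_flat: "(flat p has_real_derivative flat ([:0, 0, 1:] * (p - pderiv p)) x) (at x)"
proof (cases x "0 :: real" rule: linorder_cases)
  case less
  have "((\<lambda>_. 0) has_real_derivative 0) (at x)" by simp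
  then have "(flat p has_real_derivative 0) (at x)"
    by (rule has_field_derivative_transform_within_open[of _ _ _ "{..<0}"]) (use less in \<open>auto simp: flat_def\<close>)
  then show ?thesis using less by (simp add: flat_def)
next
  case greater
  have "((\<lambda>x. poly p (1 / x) * exp (- (1 / x))) has_real_derivative
      flat ([:0, 0, 1:] * (p - pderiv p)) x) (at x)"
    using greater by (auto intro!: derivative_eq_intros DERIV_chain2[OF poly_DERIV] simp: flat_def field_simps power2_eq_square)
  then show ?thesis
    by (rule has_field_derivative_transform_within_open[of _ _ _ "{0<..}"]) (use greater in \<open>auto simp: flat_def\<close>)
next
  case equal
  have "((\<lambda>y. (flat p y - flat p 0) / (y - 0)) \<longlongrightarrow> 0) (at 0)"
  proof (rule filterlim_split_at)
    show "((\<lambda>y. (flat p y - flat p 0) / (y - 0)) \<longlongrightarrow> 0) (at_left 0)"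
      by (rule tendsto_eventually) (auto simp: eventually_at_filter flat_def)
    \<comment> \<open>In the difference quotient at 0, division by \<open>y\<close> multiplies the
      polynomial in \<open>1 / y\<close> by its variable, hence \<open>pCons 0 p\<close>.\<close>
    have "((\<lambda>y. poly (pCons 0 p) (inverse y) * exp (- (inverse y))) \<longlongrightarrow> 0) (at_right 0)"
      by (rule filterlim_compose[OF poly_exp_tendsto_0 filterlim_inverse_at_top_right])
    moreover have "\<forall>\<^sub>F y in at_right 0. poly (pCons 0 p) (inverse y) * exp (- (inverse y)) =
        (flat p y - flat p 0) / (y - 0)"
      by (auto simp: eventually_at_filter flat_def field_simps)
    ultimately show "((\<lambda>y. (flat p y - flat p 0) / (y - 0)) \<longlongrightarrow> 0) (at_right 0)"
      by (rule Lim_transform_eventually)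
  qed
  then show ?thesis using equal by (simp add: has_field_derivative_iff flat_def)
qed

lemma smooth_flat: "smooth (flat p)"
  by (rule smooth_coinduct[of _ "range flat"]) (use DERIV_flat in auto)

abbreviation "step \<equiv> flat 1"

lemma step_props: "0 \<le> step x" "step x \<le> 1" "x \<le> 0 \<Longrightarrow> step x = 0" "0 < x \<Longrightarrow> 0 < step x"
  by (auto simp: flat_def)

lemma step_scaled_tendsto: "0 < x \<Longrightarrow> (\<lambda>n. step (real n * x)) \<longlonglongrightarrow> 1"
proof -
  assume x: "0 < x"
  have "(\<lambda>n. exp (- (inverse x * inverse (real n)))) \<longlonglongrightarrow> exp (- (inverse x * 0))"
    by (intro tendsto_intros lim_inverse_n)
  moreover have "\<forall>\<^sub>F n in sequentially. exp (- (inverse x * inverse (real n))) = step (real n * x)"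
    using eventually_gt_at_top[of 0] by eventually_elim (use x in \<open>auto simp: flat_def field_simps\<close>)
  ultimately show ?thesis by (auto intro: Lim_transform_eventually)
qed

text \<open>Smooth approximations of the indicator of the open interval that vanish outside it and
  stay in \<open>[0,1]\<close>, so that dominated convergence applies with the integrand itself as
  bound.\<close>

definition plateau :: "nat \<Rightarrow> real \<Rightarrow> real \<Rightarrow> real \<Rightarrow> real" where
  "plateau n c d t = step (real n * (t - c)) * step (real n * (d - t))"

lemma smooth_plateau: "smooth (plateau n c d)"
proof -
  have "smooth (\<lambda>t. step (real n * t + - real n * c) * step (- real n * t + real n * d))"
    by (intro smooth_mult smooth_affine smooth_flat)
  moreover have "plateau n c d = (\<lambda>t. step (real n * t + - real n * c) * step (- real n * t + real n * d))"
    by (auto simp: plateau_def algebra_simps)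
  ultimately show ?thesis by simp
qed

lemma plateau_props:
  "0 \<le> plateau n c d t" "plateau n c d t \<le> 1" "t \<notin> {c<..<d} \<Longrightarrow> plateau n c d t = 0"
proof -
  show "0 \<le> plateau n c d t" "plateau n c d t \<le> 1"
    unfolding plateau_def by (intro mult_nonneg_nonneg mult_le_one step_props)+
  assume "t \<notin> {c<..<d}"
  then have "real n * (t - c) \<le> 0 \<or> real n * (d - t) \<le> 0" by (auto simp: mult_le_0_iff)
  then show "plateau n c d t = 0" by (auto simp: plateau_def step_props)
qed

lemma plateau_tendsto: "(\<lambda>n. plateau n c d t) \<longlonglongrightarrow> indicator {c<..<d} t"
proof (cases "t \<in> {c<..<d}")
  case True
  then have "(\<lambda>n. plateau n c d t) \<longlonglongrightarrow> 1 * 1"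
    unfolding plateau_def by (intro tendsto_mult step_scaled_tendsto) auto
  then show ?thesis using True by simp
qed (simp add: plateau_props)

lemma test_funI:
  assumes "smooth \<psi>" "0 < c" "c \<le> d" "\<And>t. t \<notin> {c..d} \<Longrightarrow> \<psi> t = 0"
  shows "test_fun \<psi>"
  using assms unfolding test_fun_def smooth_def by blast

lemma test_fun_plateau: "0 < c \<Longrightarrow> c \<le> d \<Longrightarrow> test_fun (plateau n c d)"
  by (rule test_funI[OF smooth_plateau]) (auto intro: plateau_props(3))

lemma antiderivative_from_0:
  fixes g :: "real \<Rightarrow> real"
  assumes g: "continuous_on UNIV g" "\<And>x. x \<le> 0 \<Longrightarrow> g x = 0"
  obtains G where "\<And>x. (G has_real_derivative g x) (at x)" "\<And>x. x \<le> 0 \<Longrightarrow> G x = 0"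
proof
  \<comment> \<open>Starting at -1 makes 0 an interior point of the intervals on which the
    derivative is taken; the value of \<open>G\<close> is unaffected, as \<open>g\<close> vanishes
    on the added part.\<close>
  define G where "G x = integral {-1..x} g" for x
  show G0: "G x = 0" if "x \<le> 0" for x
  proof -
    have "G x = integral {-1..x} (\<lambda>_. 0)"
      unfolding G_def using g(2) that by (intro Henstock_Kurzweil_Integration.integral_cong) auto
    then show ?thesis by simp
  qed
  show "(G has_real_derivative g x) (at x)" for x
  proof (cases "x < 0")
    case True
    have "((\<lambda>_. 0) has_real_derivative 0) (at x)" by simp
    then have "(G has_real_derivative 0) (at x)"
      by (rule has_field_derivative_transform_within_open[of _ _ _ "{..<0}"]) (use True G0 in auto)
    then show ?thesis using True g(2) by simp
  next
    case False
    have "(G has_real_derivative g x) (at x within {-1..x + 1})"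
      unfolding G_def using False
      by (intro integral_has_real_derivative continuous_on_subset[OF g(1)]) auto
    moreover have "at x within {-1..x + 1} = at x"
      using False by (intro at_within_interior) auto
    ultimately show ?thesis by simp
  qed
qed

text \<open>\<open>A\<close> is 0 up to 0 and affine from 1 on, with a bump \<eta> as second
  derivative. The slope \<kappa> is the integral of the bump and is not normalized, since it divides
  out in the end.\<close>

lemma smooth_ramp:
  obtains A N \<eta> :: "real \<Rightarrow> real" and \<kappa> m where "smooth A"
    "\<And>x. (A has_real_derivative N x) (at x)" "\<And>x. (N has_real_derivative \<eta> x) (at x)"
    "\<And>x. 0 \<le> \<eta> x" "\<And>x. x \<notin> {0<..<1} \<Longrightarrow> \<eta> x = 0"
    "\<And>x. x \<le> 0 \<Longrightarrow> A x = 0" "\<And>x. x \<le> 0 \<Longrightarrow> N x = 0"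
    "\<And>x. 1 \<le> x \<Longrightarrow> A x = \<kappa> * x - m" "\<And>x. 1 \<le> x \<Longrightarrow> N x = \<kappa>" "0 < \<kappa>"
proof -
  define \<eta> where "\<eta> = plateau 1 0 1"
  have \<eta>: "smooth \<eta>" "\<And>x. 0 \<le> \<eta> x" "\<And>x. x \<notin> {0<..<1} \<Longrightarrow> \<eta> x = 0"
    unfolding \<eta>_def by (rule smooth_plateau plateau_props; assumption)+
  have \<eta>_pos: "0 < \<eta> x" if "0 < x" "x < 1" for x
    using that by (simp add: \<eta>_def plateau_def step_props)
  obtain N where N: "\<And>x. (N has_real_derivative \<eta> x) (at x)" "\<And>x. x \<le> 0 \<Longrightarrow> N x = 0"
    by (rule antiderivative_from_0[of \<eta>]) (use \<eta> smooth_continuous in auto)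
  have "smooth N" by (rule smooth_antiderivative[OF N(1) \<eta>(1)])
  obtain A where A: "\<And>x. (A has_real_derivative N x) (at x)" "\<And>x. x \<le> 0 \<Longrightarrow> A x = 0"
    by (rule antiderivative_from_0[of N]) (use N \<open>smooth N\<close> smooth_continuous in auto)
  have "smooth A" by (rule smooth_antiderivative[OF A(1) \<open>smooth N\<close>])
  have N1: "N x = N 1" if "1 \<le> x" for x
  proof (cases "x = 1")
    case False
    show ?thesis
      by (rule DERIV_isconst_end[where f = N])
        (use False that \<eta>(3) N(1) smooth_continuous[OF \<open>smooth N\<close>] in \<open>auto, metis not_less_iff_gr_or_eq\<close>)
  qed simp
  have "N 0 < N 1"
    by (rule DERIV_pos_imp_increasing_open[where f = N])
      (use N(1) \<eta>_pos smooth_continuous[OF \<open>smooth N\<close>] in auto)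
  then have "0 < N 1" using N(2)[of 0] by simp
  have A1: "A x = N 1 * x - (N 1 - A 1)" if "1 \<le> x" for x
  proof (cases "x = 1")
    case False
    have "A x - N 1 * x = A 1 - N 1 * 1"
    proof (rule DERIV_isconst_end[where f = "\<lambda>x. A x - N 1 * x"])
      show "continuous_on {1..x} (\<lambda>x. A x - N 1 * x)"
        by (intro continuous_intros smooth_continuous[OF \<open>smooth A\<close>])
      show "((\<lambda>x. A x - N 1 * x) has_real_derivative 0) (at y)" if "1 < y" "y < x" for y
        using DERIV_diff[OF A(1)[of y] DERIV_cmult_Id[of "N 1" y]] N1[of y] that by simp
    qed (use False that in simp)
    then show ?thesis by simp
  qed simp
  show thesis
    by (rule that[OF \<open>smooth A\<close> A(1) N(1) \<eta>(2,3) A(2) N(2) A1 N1 \<open>0 < N 1\<close>])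
qed

text \<open>For large \<open>n\<close> the kernel has mass \<kappa> and lives on the interval from
  \<open>w\<close> to \<open>w + 1 / n\<close>. Being one-sided it admits \<open>w = x\<close>,
  while \<open>w < z\<close> leaves room on the right.\<close>

lemma mollify_tendsto:
  fixes h N \<eta> :: "real \<Rightarrow> real"
  assumes h: "continuous_on {x..z} h" and w: "x \<le> w" "w < z"
    and N: "\<And>x. (N has_real_derivative \<eta> x) (at x)" "\<And>x. x \<le> 0 \<Longrightarrow> N x = 0" "\<And>x. 1 \<le> x \<Longrightarrow> N x = \<kappa>"
    and \<eta>: "continuous_on UNIV \<eta>" "\<And>x. 0 \<le> \<eta> x" "\<And>x. x \<notin> {0<..<1} \<Longrightarrow> \<eta> x = 0" and "0 < \<kappa>"
  shows "(\<lambda>n. integral {x..z} (\<lambda>t. h t * (real n * \<eta> (real n * (t - w))))) \<longlonglongrightarrow> \<kappa> * h w"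
proof (rule LIMSEQ_I)
  fix r :: real assume "0 < r"
  define e where "e = r / (2 * \<kappa>)"
  have "0 < e" using \<open>0 < r\<close> \<open>0 < \<kappa>\<close> by (simp add: e_def)
  obtain d where d: "0 < d" "\<And>t. t \<in> {x..z} \<Longrightarrow> \<bar>t - w\<bar> < d \<Longrightarrow> \<bar>h t - h w\<bar> < e"
    using h w \<open>0 < e\<close> unfolding continuous_on_iff dist_real_def by (metis atLeastAtMost_iff less_imp_le)
  obtain n0 :: nat where n0: "0 < n0" "1 / real n0 < min d (z - w)"
    using d(1) w(2) real_arch_inverse[of "min d (z - w)"] by (auto simp: inverse_eq_divide)
  show "\<exists>no. \<forall>n\<ge>no. norm (integral {x..z} (\<lambda>t. h t * (real n * \<eta> (real n * (t - w)))) - \<kappa> * h w) < r"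
  proof (intro exI allI impI)
    fix n assume "n0 \<le> n"
    then have n: "0 < n" "1 / real n < d" "1 / real n < z - w"
      using n0 by (auto intro: le_less_trans[OF divide_left_mono[of "real n0"]])
    define k where "k t = real n * \<eta> (real n * (t - w))" for t
    have k_cont: "continuous_on {x..z} k"
      unfolding k_def by (intro continuous_intros continuous_on_compose2[OF \<eta>(1)]) auto
    have "(k has_integral (N (real n * (z - w)) - N (real n * (x - w)))) {x..z}"
    proof (rule fundamental_theorem_of_calculus)
      fix t assume "t \<in> {x..z}"
      have "((\<lambda>t. N (real n * (t - w))) has_real_derivative \<eta> (real n * (t - w)) * real n) (at t)"
        by (rule DERIV_chain2[OF N(1)]) (auto intro!: derivative_eq_intros)
      then show "((\<lambda>t. N (real n * (t - w))) has_vector_derivative k t) (at t within {x..z})"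
        by (simp add: k_def mult.commute has_real_derivative_iff_has_vector_derivative has_vector_derivative_at_within)
    qed (use w in simp)
    moreover have "N (real n * (z - w)) = \<kappa>" using n by (intro N(3)) (simp add: field_simps)
    moreover have "N (real n * (x - w)) = 0" using w by (intro N(2)) (simp add: mult_nonneg_nonpos)
    ultimately have k_int: "(k has_integral \<kappa>) {x..z}" by simp
    have near: "\<bar>(h t - h w) * k t\<bar> \<le> e * k t" if t: "t \<in> {x..z}" for t
    proof (cases "real n * (t - w) \<in> {0<..<1}")
      case True
      then have "0 < t - w" "t - w < 1 / real n"
        using n(1) by (auto simp: zero_less_mult_iff field_simps)
      then have "\<bar>h t - h w\<bar> < e" using d(2)[OF t] n(2) by simp
      moreover have "0 \<le> k t" using \<eta>(2) by (simp add: k_def)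
      ultimately show ?thesis by (simp add: abs_mult mult_right_mono)
    qed (simp add: k_def \<eta>(3))
    have hk: "(\<lambda>t. h t * k t) integrable_on {x..z}" "(\<lambda>t. (h t - h w) * k t) integrable_on {x..z}"
      by (intro integrable_continuous_real continuous_intros h k_cont)+
    have "norm (integral {x..z} (\<lambda>t. (h t - h w) * k t)) \<le> integral {x..z} (\<lambda>t. e * k t)"
      using hk(2) near has_integral_mult_right[OF k_int, of e]
      by (intro integral_norm_bound_integral) (auto simp: has_integral_integrable)
    also have "\<dots> = e * \<kappa>" by (rule integral_unique[OF has_integral_mult_right[OF k_int]])
    finally have *: "\<bar>integral {x..z} (\<lambda>t. (h t - h w) * k t)\<bar> \<le> e * \<kappa>" by simp
    have "integral {x..z} (\<lambda>t. (h t - h w) * k t) = integral {x..z} (\<lambda>t. h t * k t - h w * k t)"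
      by (simp add: left_diff_distrib)
    also have "\<dots> = integral {x..z} (\<lambda>t. h t * k t) - h w * \<kappa>"
      using has_integral_diff[OF integrable_integral[OF hk(1)] has_integral_mult_right[OF k_int, of "h w"]]
      by (rule integral_unique)
    finally have "\<bar>integral {x..z} (\<lambda>t. h t * k t) - \<kappa> * h w\<bar> \<le> e * \<kappa>" using * by (simp add: mult.commute)
    also have "\<dots> < r" using \<open>0 < r\<close> \<open>0 < \<kappa>\<close> by (simp add: e_def)
    finally show "norm (integral {x..z} (\<lambda>t. h t * (real n * \<eta> (real n * (t - w)))) - \<kappa> * h w) < r"
      by (simp add: k_def)
  qed
qed

lemma set_integral_half_line:
  fixes g :: "real \<Rightarrow> real"
  assumes "continuous_on {c..d} g" "0 \<le> c" "\<And>t. 0 \<le> t \<Longrightarrow> t \<notin> {c..d} \<Longrightarrow> g t = 0"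
  shows "(LBINT t:{0..}. g t) = integral {c..d} g"
proof -
  have "(LBINT t:{0..}. g t) = (LBINT t:{c..d}. g t)"
    unfolding set_lebesgue_integral_def
    using assms(2,3) by (intro Bochner_Integration.integral_cong) (auto simp: indicator_def)
  also have "\<dots> = integral {c..d} g"
    by (intro set_borel_integral_eq_integral borel_integrable_atLeastAtMost' assms)
  finally show ?thesis .
qed

text \<open>
  A second difference of translates of a smooth ramp function has compact support, and its second
  derivative is a combination of three approximations of the identity.
\<close>

lemma weak_second_derivative_0:
  fixes h :: "real \<Rightarrow> real"
  assumes h: "continuous_on {0..} h"
    and weak: "\<And>\<psi>. test_fun \<psi> \<Longrightarrow> (LBINT t:{0..}. h t * (deriv ^^ 2) \<psi> t) = 0"
    and xyz: "0 < x" "x < y" "y < z"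
  shows "(z - x) * h y = (z - y) * h x + (y - x) * h z"
proof -
  obtain A N \<eta> :: "real \<Rightarrow> real" and \<kappa> m where A: "smooth A"
    "\<And>x. (A has_real_derivative N x) (at x)" "\<And>x. (N has_real_derivative \<eta> x) (at x)"
    "\<And>x. 0 \<le> \<eta> x" "\<And>x. x \<notin> {0<..<1} \<Longrightarrow> \<eta> x = 0"
    "\<And>x. x \<le> 0 \<Longrightarrow> A x = 0" "\<And>x. x \<le> 0 \<Longrightarrow> N x = 0"
    "\<And>x. 1 \<le> x \<Longrightarrow> A x = \<kappa> * x - m" "\<And>x. 1 \<le> x \<Longrightarrow> N x = \<kappa>" "0 < \<kappa>"
    by (rule smooth_ramp) blast
  have dA: "deriv A = N" "deriv N = \<eta>" using A(2,3) by (auto intro!: ext DERIV_imp_deriv)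
  have \<eta>_cont: "continuous_on UNIV \<eta>"
    using smooth_continuous[OF smooth_deriv[OF smooth_deriv[OF A(1)]]] by (simp add: dA)
  have h': "continuous_on {x..z + 1} h" by (rule continuous_on_subset[OF h]) (use xyz in auto)
  define I where "I n w = integral {x..z + 1} (\<lambda>t. h t * (real n * \<eta> (real n * (t - w))))" for n w
  have lim: "(\<lambda>n. I n w) \<longlonglongrightarrow> \<kappa> * h w" if "x \<le> w" "w \<le> z" for w
    unfolding I_def
    by (rule mollify_tendsto[OF h' that(1) _ A(3,7,9) \<eta>_cont A(4,5,10)]) (use that in auto)
  have "(z - y) * I n x + (y - x) * I n z - (z - x) * I n y = 0" if n: "0 < n" for n
  proof -
    \<comment> \<open>The coefficients \<open>z - y\<close>, \<open>y - x\<close> and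
      \<open>- (z - x)\<close> at \<open>x\<close>, \<open>z\<close> and \<open>y\<close> annihilate
      affine functions. As each scaled ramp is affine within distance 1 after its start,
      \<open>C A\<close> vanishes beyond \<open>z + 1\<close>.\<close>
    define C where "C F = (\<lambda>t. (z - y) * F (real n * (t - x)) + (y - x) * F (real n * (t - z)) -
      (z - x) * F (real n * (t - y)))" for F :: "real \<Rightarrow> real"
    have DC: "(C F has_real_derivative real n * C F' t) (at t)"
      if F: "\<And>x. (F has_real_derivative F' x) (at x)" for F F' t
    proof -
      have "((\<lambda>t. F (real n * (t - w))) has_real_derivative F' (real n * (t - w)) * real n) (at t)" for w
        by (rule DERIV_chain2[OF F]) (auto intro!: derivative_eq_intros)
      then show ?thesis unfolding C_def
        by (auto intro!: derivative_eq_intros simp: algebra_simps)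
    qed
    have "smooth (C A)"
    proof -
      have 1: "smooth (\<lambda>t. k * A (real n * (t - w)))" for k w
        using smooth_mult[OF smooth_const smooth_affine[OF A(1)], of k "real n" "- real n * w"]
        by (simp add: algebra_simps)
      show ?thesis
        using smooth_add[OF smooth_add[OF 1 1] 1, of "z - y" x "y - x" z "- (z - x)" y]
        by (simp only: C_def diff_conv_add_uminus mult_minus_left)
    qed
    moreover have "C A t = 0" if "t \<notin> {x..z + 1}" for t
    proof (cases "t < x")
      case True
      have neg: "real n * (t - w) \<le> 0" if "x \<le> w" for w using True that by (simp add: mult_nonneg_nonpos)
      have "A (real n * (t - x)) = 0" "A (real n * (t - y)) = 0" "A (real n * (t - z)) = 0"
        by (rule A(6)[OF neg]; use xyz in simp)+
      then show ?thesis by (simp add: C_def)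
    next
      case False
      have ge: "1 \<le> real n * (t - w)" if "w \<le> z" for w
        using mult_mono[of 1 "real n" 1 "t - w"] n False \<open>t \<notin> {x..z + 1}\<close> that by simp
      have lin: "A (real n * (t - w)) = \<kappa> * (real n * (t - w)) - m" if "w \<le> z" for w
        by (rule A(8)[OF ge[OF that]])
      have "C A t = (z - y) * (\<kappa> * (real n * (t - x)) - m) + (y - x) * (\<kappa> * (real n * (t - z)) - m) -
          (z - x) * (\<kappa> * (real n * (t - y)) - m)"
        unfolding C_def using xyz lin[of x] lin[of y] lin[of z] by simp
      then show ?thesis by (simp add: algebra_simps)
    qed
    ultimately have test: "test_fun (C A)" by (intro test_funI[OF _ xyz(1), of _ "z + 1"]) (use xyz in auto)
    have "deriv (C A) = (\<lambda>t. real n * C N t)" using DC[OF A(2)] by (auto intro!: ext DERIV_imp_deriv)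
    moreover have "deriv (\<lambda>t. real n * C N t) = (\<lambda>t. real n * (real n * C \<eta> t))"
      using DERIV_cmult[OF DC[OF A(3)]] by (auto intro!: ext DERIV_imp_deriv)
    ultimately have d2: "(deriv ^^ 2) (C A) = (\<lambda>t. real n * (real n * C \<eta> t))"
      by (simp add: numeral_2_eq_2)
    have \<eta>_n: "continuous_on S (\<lambda>t. \<eta> (real n * (t - w)))" for S w
      by (rule continuous_on_compose2[OF \<eta>_cont]) (auto intro!: continuous_intros)
    have zero: "C \<eta> t = 0" if "t \<notin> {x..z + 1}" for t
    proof -
      have "real n * (t - w) \<notin> {0<..<1}" if w: "x \<le> w" "w \<le> z" for w
      proof (cases "t < x")
        case True
        then have "real n * (t - w) \<le> 0" using w by (simp add: mult_nonneg_nonpos)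
        then show ?thesis by simp
      next
        case False
        then have "1 \<le> real n * (t - w)"
          using mult_mono[of 1 "real n" 1 "t - w"] n \<open>t \<notin> {x..z + 1}\<close> w by simp
        then show ?thesis by simp
      qed
      then show ?thesis using A(5) xyz by (simp add: C_def)
    qed
    have "(LBINT t:{0..}. h t * (real n * (real n * C \<eta> t))) =
        integral {x..z + 1} (\<lambda>t. h t * (real n * (real n * C \<eta> t)))"
      unfolding C_def using zero xyz
      by (intro set_integral_half_line continuous_intros h' \<eta>_n) (auto simp: C_def)
    then have zero_int: "integral {x..z + 1} (\<lambda>t. h t * (real n * (real n * C \<eta> t))) = 0"
      using weak[OF test] unfolding d2 by simp
    have expand: "h t * (real n * (real n * C \<eta> t)) = real n * ((z - y) * (h t * (real n * \<eta> (real n * (t - x)))) +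
      (y - x) * (h t * (real n * \<eta> (real n * (t - z)))) - (z - x) * (h t * (real n * \<eta> (real n * (t - y)))))" for t
      by (simp add: C_def algebra_simps)
    have int: "(\<lambda>t. h t * (real n * \<eta> (real n * (t - w)))) integrable_on {x..z + 1}" for w
      by (intro integrable_continuous_real continuous_intros h' \<eta>_n)
    have hi: "((\<lambda>t. real n * ((z - y) * (h t * (real n * \<eta> (real n * (t - x)))) +
      (y - x) * (h t * (real n * \<eta> (real n * (t - z)))) - (z - x) * (h t * (real n * \<eta> (real n * (t - y)))))) has_integral
      real n * ((z - y) * I n x + (y - x) * I n z - (z - x) * I n y)) {x..z + 1}"
      unfolding I_def by (intro has_integral_mult_right has_integral_add has_integral_diff integrable_integral int)
    have "real n * ((z - y) * I n x + (y - x) * I n z - (z - x) * I n y) = 0"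
      using integral_unique[OF hi] zero_int unfolding expand by (rule trans[OF sym])
    then show ?thesis using n by simp
  qed
  then have "\<forall>\<^sub>F n in sequentially. (z - y) * I n x + (y - x) * I n z - (z - x) * I n y = 0"
    using eventually_gt_at_top[of 0] by (rule eventually_mono[rotated]) simp
  then have "(\<lambda>n. (z - y) * I n x + (y - x) * I n z - (z - x) * I n y) \<longlonglongrightarrow> 0"
    by (rule tendsto_eventually)
  moreover have "(\<lambda>n. (z - y) * I n x + (y - x) * I n z - (z - x) * I n y) \<longlonglongrightarrow>
      (z - y) * (\<kappa> * h x) + (y - x) * (\<kappa> * h z) - (z - x) * (\<kappa> * h y)"
    by (intro tendsto_intros lim) (use xyz in auto)
  ultimately have "(z - y) * (\<kappa> * h x) + (y - x) * (\<kappa> * h z) - (z - x) * (\<kappa> * h y) = 0"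
    using LIMSEQ_unique by blast
  then have "\<kappa> * ((z - y) * h x + (y - x) * h z - (z - x) * h y) = 0" by (simp add: algebra_simps)
  then show ?thesis using A(10) by simp
qed

text \<open>Test functions are supported away from 0, so the three-point relation is known for
  \<open>x > 0\<close> only; continuity extends it to \<open>x = 0\<close>. Comparison with the
  point 1 then gives the slope.\<close>

lemma weak_second_derivative_0_affine:
  fixes h :: "real \<Rightarrow> real"
  assumes h: "continuous_on {0..} h"
    and weak: "\<And>\<psi>. test_fun \<psi> \<Longrightarrow> (LBINT t:{0..}. h t * (deriv ^^ 2) \<psi> t) = 0"
  shows "\<exists>p. \<forall>t\<ge>0. h t = h 0 + p * t"
proof -
  have eq: "z * h y = (z - y) * h 0 + y * h z" if yz: "0 < y" "y < z" for y z
  proof -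
    define H where "H x = (z - x) * h y - ((z - y) * h x + (y - x) * h z)" for x
    have "continuous (at 0 within {0..}) h" using h by (simp add: continuous_on_eq_continuous_within)
    then have "(H \<longlongrightarrow> H 0) (at 0 within {0..})"
      unfolding H_def continuous_within by (intro tendsto_intros)
    then have "(H \<longlongrightarrow> H 0) (at_right 0)" by (rule tendsto_within_subset) auto
    moreover have "\<forall>\<^sub>F x in at_right 0. H x = 0"
      using eventually_at_right_less[of 0] eventually_at_right_real[OF yz(1)]
      by eventually_elim (use weak_second_derivative_0[OF h weak] yz in \<open>simp add: H_def\<close>)
    then have "(H \<longlongrightarrow> 0) (at_right 0)" by (rule tendsto_eventually)
    ultimately have "H 0 = 0" by (metis tendsto_unique trivial_limit_at_right_real)
    then show ?thesis by (simp add: H_def)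
  qed
  show ?thesis
  proof (intro exI allI impI)
    fix t :: real assume "0 \<le> t"
    then consider "t = 0" | "0 < t" "t < 1" | "t = 1" | "1 < t" by linarith
    then show "h t = h 0 + (h 1 - h 0) * t"
    proof cases
      case 2
      then show ?thesis using eq[of t 1] by (simp add: algebra_simps)
    next
      case 4
      then show ?thesis using eq[of 1 t] by (simp add: algebra_simps)
    qed auto
  qed
qed

section \<open>The weak equation\<close>

context pos_path
begin

text \<open>The second antiderivative of \<open>- f''\<close>: a map is a mild solution exactly if
  adding \<open>J\<close> makes it affine.\<close>

definition J :: "real \<Rightarrow> real" where "J t = integral {0..t} (\<lambda>s. D (\<tau> s))"

lemma J_0 [simp]: "J 0 = 0"
  by (simp add: J_def)

lemma J_cont: "continuous_on (ival a) J"
  unfolding J_def by (intro continuous_on_ivalI indefinite_integral_continuous_1 D_tau_integrable)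

text \<open>Separates \<open>t\<close> from \<open>u\<close> in the kernel
  \<open>t - \<rho> u\<close>, so that pairing \<open>J\<close> with a function of \<open>t\<close>
  reduces to two applications of \<open>triangle_integral\<close>.\<close>

lemma J_eq:
  assumes t: "t \<in> ival a"
  shows "J t = t * D (\<tau> t) - (LINT u:{0<..\<tau> t}|M. \<rho> u * \<phi> u)"
proof -
  have c: "continuous_on {0..\<tau> t} \<rho>" "continuous_on {0..\<tau> t} \<phi>"
    using continuous_on_subset[OF _ ival_subset[OF tau_mem[OF t]]] phi_cont rho_cont by auto
  have "J t = (LINT u:{0<..\<tau> t}|M. t * \<phi> u - \<rho> u * \<phi> u)"
    unfolding J_def integral_D_tau[OF t] by (simp add: diff_divide_distrib)
  also have "\<dots> = (LINT u:{0<..\<tau> t}|M. t * \<phi> u) - (LINT u:{0<..\<tau> t}|M. \<rho> u * \<phi> u)"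
    by (intro set_integral_diff set_integrable_M continuous_on_mult continuous_on_const c)
  finally show ?thesis unfolding D_def set_integral_mult_right .
qed

lemma mild_iff_J: "mild M f x p \<longleftrightarrow> (\<forall>t\<in>ival a. val f t = x + p * t - J t)"
  unfolding mild_def dom J_def by (auto simp: integral_D_tau)

end

lemma deriv_zero_outside:
  fixes \<psi> :: "real \<Rightarrow> real"
  assumes "\<And>t. t \<notin> {c..d} \<Longrightarrow> \<psi> t = 0" "t \<notin> {c..d}"
  shows "deriv \<psi> t = 0"
proof -
  have "((\<lambda>_. 0) has_real_derivative 0) (at t)" by simp
  then have "(\<psi> has_real_derivative 0) (at t)"
    by (rule has_field_derivative_transform_within_open[of _ _ _ "- {c..d}"]) (use assms in auto)
  then show ?thesis by (rule DERIV_imp_deriv)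
qed

locale test_function =
  fixes \<psi> :: "real \<Rightarrow> real" and c d :: real
  assumes smooth: "smooth \<psi>" and c_pos: "0 < c" and c_le_d: "c \<le> d"
    and outside: "t \<notin> {c..d} \<Longrightarrow> \<psi> t = 0"
begin

lemma deriv_outside: "t \<notin> {c..d} \<Longrightarrow> deriv \<psi> t = 0"
  by (rule deriv_zero_outside[OF outside])

lemma deriv2_outside: "t \<notin> {c..d} \<Longrightarrow> deriv (deriv \<psi>) t = 0"
  by (rule deriv_zero_outside[OF deriv_outside])

lemma D1: "(\<psi> has_real_derivative deriv \<psi> t) (at t)"
  by (rule smooth_DERIV[OF smooth])

lemma D2: "(deriv \<psi> has_real_derivative deriv (deriv \<psi>) t) (at t)"
  by (rule smooth_DERIV[OF smooth_deriv[OF smooth]])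

lemma cont:
  "continuous_on S \<psi>" "continuous_on S (deriv \<psi>)" "continuous_on S (deriv (deriv \<psi>))"
  by (intro smooth_continuous smooth smooth_deriv)+

text \<open>Integration by parts with \<open>T\<close> beyond the support. Together the two formulas
  say that the integral of \<open>(t - r) * deriv (deriv \<psi>) t\<close> from \<open>r\<close> to
  \<open>T\<close> is \<open>\<psi> r\<close>.\<close>

lemma integral_deriv2:
  assumes "r \<le> T" "d < T"
  shows "integral {r..T} (deriv (deriv \<psi>)) = - deriv \<psi> r"
    and "integral {r..T} (\<lambda>t. t * deriv (deriv \<psi>) t) = \<psi> r - r * deriv \<psi> r"
proof -
  have T: "deriv \<psi> T = 0" "\<psi> T = 0" using assms by (auto intro: outside deriv_outside)
  have "(deriv (deriv \<psi>) has_integral (deriv \<psi> T - deriv \<psi> r)) {r..T}"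
    by (rule fundamental_theorem_of_calculus[OF assms(1)])
      (metis D2 has_real_derivative_iff_has_vector_derivative has_vector_derivative_at_within)
  then show "integral {r..T} (deriv (deriv \<psi>)) = - deriv \<psi> r" using T by (simp add: integral_unique)
  have "((\<lambda>t. t * deriv (deriv \<psi>) t) has_integral ((T * deriv \<psi> T - \<psi> T) - (r * deriv \<psi> r - \<psi> r))) {r..T}"
  proof (rule fundamental_theorem_of_calculus[OF assms(1)])
    fix t
    have "((\<lambda>t. t * deriv \<psi> t - \<psi> t) has_real_derivative t * deriv (deriv \<psi>) t) (at t)"
      by (auto intro!: derivative_eq_intros D1 D2)
    then show "((\<lambda>t. t * deriv \<psi> t - \<psi> t) has_vector_derivative t * deriv (deriv \<psi>) t) (at t within {r..T})"
      by (simp add: has_real_derivative_iff_has_vector_derivative has_vector_derivative_at_within)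
  qed
  then show "integral {r..T} (\<lambda>t. t * deriv (deriv \<psi>) t) = \<psi> r - r * deriv \<psi> r"
    using T by (simp add: integral_unique)
qed

lemma half_line_deriv2:
  assumes "continuous_on {0..} g" "d < T"
  shows "(LBINT t:{0..}. g t * (deriv ^^ 2) \<psi> t) = integral {0..T} (\<lambda>t. g t * deriv (deriv \<psi>) t)"
    and "(\<lambda>t. g t * deriv (deriv \<psi>) t) integrable_on {0..T}"
proof -
  have "continuous_on {0..T} g" by (rule continuous_on_subset[OF assms(1)]) auto
  then have c: "continuous_on {0..T} (\<lambda>t. g t * deriv (deriv \<psi>) t)"
    by (intro continuous_on_mult cont)
  then show "(\<lambda>t. g t * deriv (deriv \<psi>) t) integrable_on {0..T}" by (rule integrable_continuous_real)
  have "(LBINT t:{0..}. g t * deriv (deriv \<psi>) t) = integral {0..T} (\<lambda>t. g t * deriv (deriv \<psi>) t)"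
    by (rule set_integral_half_line[OF c]) (use deriv2_outside assms(2) in auto)
  then show "(LBINT t:{0..}. g t * (deriv ^^ 2) \<psi> t) = integral {0..T} (\<lambda>t. g t * deriv (deriv \<psi>) t)"
    by (simp add: numeral_2_eq_2)
qed

end

lemma test_fun_iff: "test_fun \<psi> \<longleftrightarrow> (\<exists>c d. test_function \<psi> c d)"
  unfolding test_fun_def test_function_def smooth_def by auto

locale half_line_path = pos_path f \<infinity> b M for f b M
begin

text \<open>After the exchange of integrals, the inner one is that of
  \<open>(t - \<rho> u) * deriv (deriv \<psi>) t\<close> from \<open>\<rho> u\<close> to
  \<open>T\<close>, which is \<open>\<psi> (\<rho> u)\<close>.\<close>

lemma weak_J:
  assumes "test_function \<psi> c d" "d < T"
  shows "(LBINT t:{0..}. J t * (deriv ^^ 2) \<psi> t) = (LINT u:{0<..\<tau> T}|M. \<psi> (\<rho> u) * \<phi> u)"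
proof -
  interpret test_function \<psi> c d by (rule assms)
  have T: "T \<in> ival \<infinity>" using assms(2) c_pos c_le_d by simp
  define p where "p = deriv (deriv \<psi>)"
  have p: "continuous_on {0..T} p" "continuous_on {0..T} (\<lambda>t. t * p t)"
    unfolding p_def by (intro continuous_intros cont)+
  have \<rho>\<phi>: "continuous_on (ival b) (\<lambda>u. \<rho> u * \<phi> u)" by (intro continuous_on_mult rho_cont phi_cont)
  note T1 = triangle_integral[OF T p(2) phi_cont, folded D_def]
  note T2 = triangle_integral[OF T p(1) \<rho>\<phi>]
  have c: "continuous_on {0..\<tau> T} \<rho>" "continuous_on {0..\<tau> T} \<phi>"
    using continuous_on_subset[OF _ ival_subset[OF tau_mem[OF T]]] phi_cont rho_cont by blast+
  have "(LBINT t:{0..}. J t * (deriv ^^ 2) \<psi> t) = integral {0..T} (\<lambda>t. J t * p t)"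
    using half_line_deriv2(1)[OF _ assms(2), of J] J_cont by (simp add: p_def)
  also have "\<dots> = integral {0..T} (\<lambda>t. t * p t * D (\<tau> t) - p t * (LINT u:{0<..\<tau> t}|M. \<rho> u * \<phi> u))"
    by (intro Henstock_Kurzweil_Integration.integral_cong) (simp add: J_eq left_diff_distrib)
  also have "\<dots> = (LINT u:{0<..\<tau> T}|M. \<phi> u * integral {\<rho> u..T} (\<lambda>t. t * p t)) -
      (LINT u:{0<..\<tau> T}|M. \<rho> u * \<phi> u * integral {\<rho> u..T} p)"
    using Henstock_Kurzweil_Integration.integral_diff[OF T1(1) T2(1)] unfolding T1(2) T2(2) .
  also have "(LINT u:{0<..\<tau> T}|M. \<phi> u * integral {\<rho> u..T} (\<lambda>t. t * p t)) =
      (LINT u:{0<..\<tau> T}|M. \<phi> u * (\<psi> (\<rho> u) - \<rho> u * deriv \<psi> (\<rho> u)))"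
  proof (intro set_lebesgue_integral_cong allI impI)
    fix u assume "u \<in> {0<..\<tau> T}"
    then have "\<rho> u \<le> T" using rho_le_iff[OF _ T] ival_le[OF tau_mem[OF T]] by auto
    then show "\<phi> u * integral {\<rho> u..T} (\<lambda>t. t * p t) = \<phi> u * (\<psi> (\<rho> u) - \<rho> u * deriv \<psi> (\<rho> u))"
      unfolding p_def by (subst integral_deriv2(2)) (use assms in auto)
  qed simp
  also have "(LINT u:{0<..\<tau> T}|M. \<rho> u * \<phi> u * integral {\<rho> u..T} p) =
      (LINT u:{0<..\<tau> T}|M. \<rho> u * \<phi> u * - deriv \<psi> (\<rho> u))"
  proof (intro set_lebesgue_integral_cong allI impI)
    fix u assume "u \<in> {0<..\<tau> T}"
    then have "\<rho> u \<le> T" using rho_le_iff[OF _ T] ival_le[OF tau_mem[OF T]] by auto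
    then show "\<rho> u * \<phi> u * integral {\<rho> u..T} p = \<rho> u * \<phi> u * - deriv \<psi> (\<rho> u)"
      unfolding p_def by (subst integral_deriv2(1)) (use assms in auto)
  qed simp
  also have "(LINT u:{0<..\<tau> T}|M. \<phi> u * (\<psi> (\<rho> u) - \<rho> u * deriv \<psi> (\<rho> u))) -
      (LINT u:{0<..\<tau> T}|M. \<rho> u * \<phi> u * - deriv \<psi> (\<rho> u)) =
      (LINT u:{0<..\<tau> T}|M. \<phi> u * (\<psi> (\<rho> u) - \<rho> u * deriv \<psi> (\<rho> u)) - \<rho> u * \<phi> u * - deriv \<psi> (\<rho> u))"
    by (intro set_integral_diff(2)[symmetric] set_integrable_M continuous_on_mult continuous_on_diff
        continuous_on_minus c continuous_on_compose2[OF cont(1) c(1)] continuous_on_compose2[OF cont(2) c(1)]) auto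
  also have "\<dots> = (LINT u:{0<..\<tau> T}|M. \<psi> (\<rho> u) * \<phi> u)"
    by (intro set_lebesgue_integral_cong) (auto simp: algebra_simps)
  finally show ?thesis .
qed

lemma weak_mild:
  assumes "mild M f x p" "test_function \<psi> c d" "d < T"
  shows "(LBINT t:{0..}. val f t * (deriv ^^ 2) \<psi> t) = - (LINT u:{0<..\<tau> T}|M. \<psi> (\<rho> u) * \<phi> u)"
proof -
  have f_cont: "continuous_on {0..} (val f)" using cont by simp
  interpret test_function \<psi> c d by (rule assms)
  have T: "0 \<le> T" using assms(3) c_pos c_le_d by simp
  have J: "continuous_on {0..} J" using J_cont by simp
  define r where "r = deriv (deriv \<psi>)"
  have f: "val f t = x + p * t - J t" if "0 \<le> t" for t using assms(1) that by (simp add: mild_iff_J)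
  have "(LBINT t:{0..}. val f t * (deriv ^^ 2) \<psi> t) = integral {0..T} (\<lambda>t. val f t * r t)"
    using half_line_deriv2(1)[OF f_cont assms(3)] by (simp add: r_def)
  also have "\<dots> = integral {0..T} (\<lambda>t. (x * r t + p * (t * r t)) - J t * r t)"
    by (intro Henstock_Kurzweil_Integration.integral_cong) (simp add: f algebra_simps)
  also have "((\<lambda>t. (x * r t + p * (t * r t)) - J t * r t) has_integral
      (x * - deriv \<psi> 0 + p * (\<psi> 0 - 0 * deriv \<psi> 0)) - (LBINT t:{0..}. J t * (deriv ^^ 2) \<psi> t)) {0..T}"
  proof (intro has_integral_diff has_integral_add has_integral_mult_right)
    show "(r has_integral - deriv \<psi> 0) {0..T}" "((\<lambda>t. t * r t) has_integral \<psi> 0 - 0 * deriv \<psi> 0) {0..T}"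
      unfolding r_def integral_deriv2[OF T assms(3), symmetric]
      by (intro integrable_integral integrable_continuous_real continuous_intros cont)+
    show "((\<lambda>t. J t * r t) has_integral (LBINT t:{0..}. J t * (deriv ^^ 2) \<psi> t)) {0..T}"
      using half_line_deriv2[OF J assms(3)] by (simp add: r_def has_integral_integral)
  qed
  then have "integral {0..T} (\<lambda>t. (x * r t + p * (t * r t)) - J t * r t) = - (LBINT t:{0..}. J t * (deriv ^^ 2) \<psi> t)"
    using outside[of 0] deriv_outside[of 0] c_pos by (simp add: integral_unique)
  also have "\<dots> = - (LINT u:{0<..\<tau> T}|M. \<psi> (\<rho> u) * \<phi> u)"
    by (simp only: weak_J[OF assms(2,3)])
  finally show ?thesis .
qed

text \<open>\<open>J\<close> pairs to the same right-hand side with the opposite sign, so the weak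
  second derivative of \<open>f + J\<close> vanishes; the slope of this affine function is
  \<open>p\<close>.\<close>

lemma mild_of_weak:
  assumes "\<And>\<psi> c d. test_function \<psi> c d \<Longrightarrow>
    (LBINT t:{0..}. val f t * (deriv ^^ 2) \<psi> t) = - (LINT u:{0<..\<tau> (d + 1)}|M. \<psi> (\<rho> u) * \<phi> u)"
  obtains p where "mild M f (val f 0) p"
proof -
  define h where "h t = val f t + J t" for t
  have c: "continuous_on {0..} (val f)" "continuous_on {0..} J" using cont J_cont by simp_all
  have "continuous_on {0..} h" unfolding h_def by (intro continuous_on_add c)
  moreover have "(LBINT t:{0..}. h t * (deriv ^^ 2) \<psi> t) = 0" if "test_fun \<psi>" for \<psi>
  proof -
    obtain c' d where "test_function \<psi> c' d" using \<open>test_fun \<psi>\<close> test_fun_iff by blast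
    then interpret t: test_function \<psi> c' d .
    have d: "d < d + 1" by simp
    note H = t.half_line_deriv2[OF c(1) d] t.half_line_deriv2[OF c(2) d]
    have "(LBINT t:{0..}. h t * (deriv ^^ 2) \<psi> t) = integral {0..d + 1} (\<lambda>t. h t * deriv (deriv \<psi>) t)"
      by (rule t.half_line_deriv2(1)) (use \<open>continuous_on {0..} h\<close> in auto)
    also have "\<dots> = integral {0..d + 1} (\<lambda>t. val f t * deriv (deriv \<psi>) t + J t * deriv (deriv \<psi>) t)"
      by (simp add: h_def distrib_right)
    also have "\<dots> = (LBINT t:{0..}. val f t * (deriv ^^ 2) \<psi> t) + (LBINT t:{0..}. J t * (deriv ^^ 2) \<psi> t)"
      unfolding H(1,3) by (rule Henstock_Kurzweil_Integration.integral_add[OF H(2,4)])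
    also have "\<dots> = 0"
      unfolding assms[OF \<open>test_function \<psi> c' d\<close>] weak_J[OF \<open>test_function \<psi> c' d\<close> d] by simp
    finally show ?thesis .
  qed
  ultimately obtain p where p: "\<And>t. 0 \<le> t \<Longrightarrow> h t = h 0 + p * t"
    using weak_second_derivative_0_affine by blast
  have "mild M f (val f 0) p"
    unfolding mild_iff_J
  proof
    fix t assume "t \<in> ival \<infinity>"
    then show "val f t = val f 0 + p * t - J t" using p[of t] by (simp add: h_def)
  qed
  then show thesis by (rule that)
qed

end

lemma plateau_integral_tendsto:
  fixes k s :: "'a \<Rightarrow> real"
  assumes k: "integrable N k" and [measurable]: "s \<in> borel_measurable N"
  shows "(\<lambda>n. LINT u|N. plateau n c d (s u) * k u) \<longlonglongrightarrow> (LINT u|N. indicator {c<..<d} (s u) * k u)"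
proof (rule integral_dominated_convergence[where w = "\<lambda>u. norm (k u)"])
  have [measurable]: "plateau n c d \<in> borel_measurable borel" for n
    by (intro borel_measurable_continuous_onI smooth_continuous smooth_plateau)
  have [measurable]: "k \<in> borel_measurable N" using k by simp
  show "(\<lambda>u. indicator {c<..<d} (s u) * k u) \<in> borel_measurable N"
    "\<And>n. (\<lambda>u. plateau n c d (s u) * k u) \<in> borel_measurable N" by measurable
  show "integrable N (\<lambda>u. norm (k u))" using k by (rule integrable_norm)
  show "AE u in N. (\<lambda>n. plateau n c d (s u) * k u) \<longlonglongrightarrow> indicator {c<..<d} (s u) * k u"
    by (intro AE_I2 tendsto_mult plateau_tendsto tendsto_const)
  show "AE u in N. norm (plateau n c d (s u) * k u) \<le> norm (k u)" for n
    using plateau_props(1,2)[of n c d] by (intro AE_I2) (simp add: abs_mult mult_left_le_one_le)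
qed

section \<open>The differential equation and its twice integrated form\<close>

locale ode_path = half_line_path f b "distr \<mu> borel (\<lambda>x. x)" for f b \<mu> +
  assumes radon: "radon_on {0..} \<mu>"
begin

abbreviation "M \<equiv> distr \<mu> borel (\<lambda>x. x)"

lemma sets_mu: "sets \<mu> = sets (restrict_space borel {0..})"
  using radon by (simp add: radon_on_def)

lemma space_mu: "space \<mu> = {0..}"
  using sets_eq_imp_space_eq[OF sets_mu] by (simp add: space_restrict_space)

lemma id_measurable [measurable]: "(\<lambda>x. x) \<in> measurable \<mu> borel"
  by (subst measurable_cong_sets[OF sets_mu refl]) (auto intro: measurable_restrict_space1)

lemma f_cont: "continuous_on {0..} (val f)"
  using cont by simp

lemma tau_range: "0 \<le> T \<Longrightarrow> {0..\<tau> T} \<subseteq> ival b"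
  using ival_subset[OF tau_mem, of T] by simp

lemma rho_beyond: "u \<in> ival b \<Longrightarrow> 0 \<le> T \<Longrightarrow> T < \<rho> u \<longleftrightarrow> \<tau> T < u"
  using rho_le_iff[of u T] by (simp add: linorder_not_le[symmetric])

text \<open>The Jacobian \<open>deriv \<rho> u\<close> is the square of
  \<open>val f (\<rho> u)\<close> for \<open>u > 0\<close>. The point \<open>u = 0\<close>, where
  \<open>deriv\<close> is taken at the edge of the domain, contributes nothing because
  \<open>\<psi> 0 = 0\<close>.\<close>

lemma comp_pairing_eq:
  assumes \<psi>: "continuous_on UNIV \<psi>" "\<psi> 0 = 0" "\<And>t. T < t \<Longrightarrow> \<psi> t = 0" and T: "0 \<le> T"
  shows "comp_pairing \<mu> (tau f) \<psi> = (LINT u:{0<..\<tau> T}|M. \<psi> (\<rho> u) * (val f (\<rho> u))\<^sup>2)"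
proof -
  have "continuous_on {0<..\<tau> T} (\<lambda>u. \<psi> (\<rho> u) * (val f (\<rho> u))\<^sup>2)"
    by (rule continuous_on_subset[OF _ order_trans[OF _ tau_range[OF T]]])
      (auto intro!: continuous_intros f_rho_cont continuous_on_compose2[OF \<psi>(1) rho_cont])
  then have meas: "(\<lambda>u. indicator {0<..\<tau> T} u *\<^sub>R (\<psi> (\<rho> u) * (val f (\<rho> u))\<^sup>2)) \<in> borel_measurable borel"
    by (intro borel_measurable_continuous_on_indicator) auto
  have "indicator (ival b) u *\<^sub>R (\<psi> (\<rho> u) * \<bar>deriv \<rho> u\<bar>) =
      indicator {0<..\<tau> T} u *\<^sub>R (\<psi> (\<rho> u) * (val f (\<rho> u))\<^sup>2)" if "u \<in> space \<mu>" for u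
  proof (cases "u \<in> ival b \<and> u \<noteq> 0")
    case True
    then have "0 < u" using that by (simp add: space_mu)
    then have "deriv \<rho> u = (val f (\<rho> u))\<^sup>2" using rho_DERIV True by (intro DERIV_imp_deriv) auto
    then show ?thesis
      using True \<open>0 < u\<close> \<psi>(3) rho_beyond[OF _ T, of u] by (auto simp: indicator_def)
  next
    case False
    moreover have "u \<notin> {0<..\<tau> T}" using False subsetD[OF tau_range[OF T], of u] by auto
    ultimately show ?thesis using \<psi>(2) by (auto simp: indicator_def)
  qed
  then have "comp_pairing \<mu> (tau f) \<psi> = (\<integral>u. indicator {0<..\<tau> T} u *\<^sub>R (\<psi> (\<rho> u) * (val f (\<rho> u))\<^sup>2) \<partial>\<mu>)"
    unfolding comp_pairing_def ran_tau_eq set_lebesgue_integral_def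
    by (intro Bochner_Integration.integral_cong refl)
  also have "\<dots> = (LINT u:{0<..\<tau> T}|M. \<psi> (\<rho> u) * (val f (\<rho> u))\<^sup>2)"
    unfolding set_lebesgue_integral_def by (rule integral_distr[symmetric, OF id_measurable meas])
  finally show ?thesis .
qed

definition V :: "real set" where "V = {u. 0 < u \<and> u \<in> ival b}"

lemma V_borel [measurable]: "V \<in> sets borel"
proof -
  have "V = {u. 0 < u \<and> ereal u < b}" by (auto simp: V_def ival_def)
  then show ?thesis by simp
qed

lemma V_sub: "V \<subseteq> ival b"
  by (auto simp: V_def)

definition weight :: "real \<Rightarrow> real" where "weight u = indicator V u * \<phi> u"

text \<open>The value 1 outside \<open>V\<close> is a placeholder that keeps the map in
  (0,\<infinity>), the space of \<open>nu\<close>; \<open>weight\<close> vanishes there.\<close>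

definition \<rho>' :: "real \<Rightarrow> real" where "\<rho>' u = (if u \<in> V then \<rho> u else 1)"

lemma weight_measurable [measurable]: "weight \<in> borel_measurable borel"
  using borel_measurable_continuous_on_indicator[OF V_borel continuous_on_subset[OF phi_cont V_sub]]
  by (simp add: weight_def[abs_def])

lemma weight_nonneg: "0 \<le> weight u"
  using phi_pos[of u] by (auto simp: weight_def V_def indicator_def)

lemma rho'_measurable [measurable]: "\<rho>' \<in> measurable borel (restrict_space borel {0<..})"
proof -
  have [measurable]: "(\<lambda>u. indicator V u * \<rho> u) \<in> borel_measurable borel"
    using borel_measurable_continuous_on_indicator[OF V_borel continuous_on_subset[OF rho_cont V_sub]] by simp
  have "(\<lambda>u. indicator V u * \<rho> u + indicator (- V) u) \<in> borel_measurable borel" by measurable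
  moreover have "(\<lambda>u. indicator V u * \<rho> u + indicator (- V) u) = \<rho>'"
    by (auto simp: \<rho>'_def)
  moreover have "0 < \<rho>' u" for u
    using rho_beyond[of u 0] by (auto simp: \<rho>'_def V_def)
  ultimately show ?thesis by (intro measurable_restrict_space2) auto
qed

text \<open>The measure \<open>- f''\<close> of a mild solution.\<close>

definition nu :: "real measure" where
  "nu = distr (density M (\<lambda>u. ennreal (weight u))) (restrict_space borel {0<..}) \<rho>'"

lemma integral_nu:
  assumes g: "continuous_on {0<..} g" "\<And>t. T < t \<Longrightarrow> g t = 0" and T: "0 \<le> T"
  shows "(LINT t|nu. g t) = (LINT u:{0<..\<tau> T}|M. g (\<rho> u) * \<phi> u)"
proof -
  have [measurable]: "g \<in> borel_measurable (restrict_space borel {0<..})"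
    by (rule borel_measurable_continuous_on_restrict[OF g(1)])
  have "(LINT t|nu. g t) = (LINT u|density M (\<lambda>u. ennreal (weight u)). g (\<rho>' u))"
    unfolding nu_def by (rule integral_distr) simp_all
  also have "\<dots> = (LINT u|M. weight u *\<^sub>R g (\<rho>' u))"
    using weight_nonneg by (intro integral_density) auto
  also have "\<dots> = (LINT u:{0<..\<tau> T}|M. g (\<rho> u) * \<phi> u)"
    unfolding set_lebesgue_integral_def
  proof (intro Bochner_Integration.integral_cong refl)
    fix u
    have "u \<in> V" if "u \<in> {0<..\<tau> T}" using that tau_range[OF T] by (auto simp: V_def)
    moreover have "g (\<rho> u) = 0" if "u \<in> V" "u \<notin> {0<..\<tau> T}"
      using that rho_beyond[OF _ T, of u] by (intro g(2)) (auto simp: V_def)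
    ultimately show "weight u *\<^sub>R g (\<rho>' u) = indicator {0<..\<tau> T} u *\<^sub>R (g (\<rho> u) * \<phi> u)"
      by (auto simp: indicator_def weight_def \<rho>'_def)
  qed
  finally show ?thesis .
qed

lemma radon_nu: "radon_on {0<..} nu"
  unfolding radon_on_def
proof (intro conjI allI impI)
  show "sets nu = sets (restrict_space borel {0<..})" by (simp add: nu_def)
  fix K :: "real set" assume K: "compact K \<and> K \<subseteq> {0<..}"
  obtain T where T: "0 \<le> T" "K \<subseteq> {..T}"
  proof -
    obtain T where "\<forall>x\<in>K. norm x \<le> T" using compact_imp_bounded[of K] K by (auto simp: bounded_iff)
    then show thesis by (intro that[of "\<bar>T\<bar>"]) force+
  qed
  have KM: "K \<in> sets (restrict_space borel {0<..})"
    using K by (auto simp: sets_restrict_space_iff borel_compact)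
  obtain C where C: "\<And>u. u \<in> {0..\<tau> T} \<Longrightarrow> \<bar>\<phi> u\<bar> \<le> C"
    using continuous_on_Icc_bounded[OF continuous_on_subset[OF phi_cont tau_range[OF T(1)]]] by blast
  have "emeasure nu K = emeasure (density M (\<lambda>u. ennreal (weight u))) (\<rho>' -` K)"
    unfolding nu_def by (subst emeasure_distr) (use KM in simp_all)
  also have "\<dots> = (\<integral>\<^sup>+u. ennreal (weight u) * indicator (\<rho>' -` K) u \<partial>M)"
    using measurable_sets[OF rho'_measurable KM] by (subst emeasure_density) auto
  also have "\<dots> \<le> (\<integral>\<^sup>+u. ennreal C * indicator {0<..\<tau> T} u \<partial>M)"
  proof (intro nn_integral_mono)
    fix u
    have "u \<in> {0<..\<tau> T}" if "u \<in> V" "\<rho>' u \<in> K"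
      using that T rho_beyond[OF _ T(1), of u] by (auto simp: \<rho>'_def V_def)
    then show "ennreal (weight u) * indicator (\<rho>' -` K) u \<le> ennreal C * indicator {0<..\<tau> T} u"
      using abs_le_D1[OF C[of u]] by (auto simp: weight_def indicator_def intro!: ennreal_leI)
  qed
  also have "\<dots> = ennreal C * emeasure M {0<..\<tau> T}" by (rule nn_integral_cmult_indicator) simp
  also have "\<dots> < \<infinity>" using finite_Ioc[of "\<tau> T"] by (simp add: ennreal_mult_less_top)
  finally show "emeasure nu K < \<infinity>" .
qed

lemma A_inf: "f \<in> A_inf"
  using A_path_axioms A_inf_iff by blast

text \<open>At \<open>\<rho> u\<close> the density \<open>\<phi>\<close> times the cube of
  \<open>f\<close> is the square of \<open>f\<close>, which is the derivative of
  \<open>\<rho>\<close>; this cancellation is what the cube in the equation achieves.\<close>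

lemma solves_ode_of_mild:
  assumes "mild M f x p"
  shows "solves_ode \<mu> f"
  unfolding solves_ode_def
proof (intro conjI exI[of _ nu] allI impI)
  show "f \<in> A_inf" by (rule A_inf)
  show "dom f = {0..}" using dom by simp
  show "radon_on {0<..} nu" by (rule radon_nu)
  fix \<psi> assume "test_fun \<psi>"
  then obtain c d where \<psi>: "test_function \<psi> c d" using test_fun_iff by blast
  then interpret t: test_function \<psi> c d .
  have T: "0 \<le> d + 1" "d < d + 1" using t.c_pos t.c_le_d by auto
  have "(LINT t|nu. \<psi> t) = (LINT u:{0<..\<tau> (d + 1)}|M. \<psi> (\<rho> u) * \<phi> u)"
    by (rule integral_nu[OF t.cont(1) _ T(1)]) (auto intro: t.outside)
  then show "(LBINT t:{0..}. val f t * (deriv ^^ 2) \<psi> t) = - (LINT t|nu. \<psi> t)"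
    using weak_mild[OF assms \<psi> T(2)] by simp
  have "(LINT t|nu. \<psi> t * val f t ^ 3) = (LINT u:{0<..\<tau> (d + 1)}|M. \<psi> (\<rho> u) * val f (\<rho> u) ^ 3 * \<phi> u)"
    by (rule integral_nu[OF _ _ T(1)])
      (auto intro!: continuous_intros t.cont continuous_on_subset[OF f_cont] t.outside)
  also have "\<dots> = (LINT u:{0<..\<tau> (d + 1)}|M. \<psi> (\<rho> u) * (val f (\<rho> u))\<^sup>2)"
  proof (intro set_lebesgue_integral_cong allI impI)
    fix u assume "u \<in> {0<..\<tau> (d + 1)}"
    then have "u \<in> ival b" using tau_range[OF T(1)] by auto
    then have "val f (\<rho> u) \<noteq> 0" by (rule nonzero[OF rho_mem])
    then show "\<psi> (\<rho> u) * val f (\<rho> u) ^ 3 * \<phi> u = \<psi> (\<rho> u) * (val f (\<rho> u))\<^sup>2"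
      by (simp add: power3_eq_cube power2_eq_square)
  qed simp
  also have "\<dots> = comp_pairing \<mu> (tau f) \<psi>"
    by (rule comp_pairing_eq[symmetric]) (use T t.cont t.outside t.c_pos in auto)
  finally show "- (LINT t|nu. \<psi> t * val f t ^ 3) = - comp_pairing \<mu> (tau f) \<psi>" by simp
qed

text \<open>
  The second equation determines \<open>f\<^sup>3 \<nu>\<close> on open intervals, because the indicator functions of these
  are limits of test functions. Dividing by \<open>f\<^sup>3\<close> gives \<open>\<nu>\<close>.
\<close>

lemma mild_of_solves_ode:
  assumes "solves_ode \<mu> f"
  obtains p where "mild M f (val f 0) p"
proof (rule mild_of_weak)
  fix \<psi> c d assume \<psi>: "test_function \<psi> c d"
  interpret t: test_function \<psi> c d by (rule \<psi>)
  obtain \<nu> where \<nu>: "radon_on {0<..} \<nu>"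
    "\<And>\<psi>. test_fun \<psi> \<Longrightarrow> (LBINT t:{0..}. val f t * (deriv ^^ 2) \<psi> t) = - (LINT t|\<nu>. \<psi> t)"
    "\<And>\<psi>. test_fun \<psi> \<Longrightarrow> (LINT t|\<nu>. \<psi> t * val f t ^ 3) = comp_pairing \<mu> (tau f) \<psi>"
    using assms unfolding solves_ode_def by auto
  have sets_\<nu>: "sets \<nu> = sets (restrict_space borel {0<..})" using \<nu>(1) by (simp add: radon_on_def)
  have space_\<nu>: "space \<nu> = {0<..}"
    using sets_eq_imp_space_eq[OF sets_\<nu>] by (simp add: space_restrict_space)
  \<comment> \<open>The support of \<psi> has to lie inside the open interval from \<open>c'\<close>
    to \<open>T\<close>, on which the plateaus converge to 1.\<close>
  define c' where "c' = c / 2"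
  define T where "T = d + 1"
  have cT: "0 < c'" "c' < c" "d < T" "c' < T" "0 \<le> T" using t.c_pos t.c_le_d by (auto simp: c'_def T_def)
  \<comment> \<open>\<open>F\<close> is the density that the second equation puts on \<nu>, and
    \<open>G\<close> undoes it: on the one side the product with \<open>G\<close> is \<psi>, on the
    other, after composition with \<open>r\<close>, it is
    \<open>\<psi> (\<rho> u) * \<phi> u\<close>.\<close>
  define F where "F t = indicator {c'..T} t * val f t ^ 3" for t
  define G where "G t = indicator {c'..T} t * (\<psi> t / val f t ^ 3)" for t
  define r where "r u = indicator {0<..\<tau> T} u * \<rho> u" for u
  define q where "q u = indicator {0<..\<tau> T} u * (val f (\<rho> u))\<^sup>2" for u
  have sub: "{c'..T} \<subseteq> {0..}" using cT by auto
  have range: "{0<..\<tau> T} \<subseteq> ival b" using tau_range[OF cT(5)] by auto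
  have fpos: "0 < val f t" if "0 \<le> t" for t using pos[of t] that by simp
  have [measurable]: "F \<in> borel_measurable borel" "G \<in> borel_measurable borel"
  proof -
    have "continuous_on {c'..T} (\<lambda>t. val f t ^ 3)" "continuous_on {c'..T} (\<lambda>t. \<psi> t / val f t ^ 3)"
    proof -
      show 1: "continuous_on {c'..T} (\<lambda>t. val f t ^ 3)"
        by (rule continuous_on_power[OF continuous_on_subset[OF f_cont sub]])
      show "continuous_on {c'..T} (\<lambda>t. \<psi> t / val f t ^ 3)"
        using fpos cT(1) by (intro continuous_on_divide t.cont 1) (auto simp: less_imp_neq[symmetric])
    qed
    then show "F \<in> borel_measurable borel" "G \<in> borel_measurable borel"
      using borel_measurable_continuous_on_indicator[of "{c'..T}" "\<lambda>t. val f t ^ 3"]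
        borel_measurable_continuous_on_indicator[of "{c'..T}" "\<lambda>t. \<psi> t / val f t ^ 3"]
      by (simp_all add: F_def[abs_def] G_def[abs_def])
  qed
  have [measurable]: "r \<in> borel_measurable borel" "q \<in> borel_measurable borel"
  proof -
    have "continuous_on {0<..\<tau> T} \<rho>" "continuous_on {0<..\<tau> T} (\<lambda>u. (val f (\<rho> u))\<^sup>2)"
      by (rule continuous_on_subset[OF rho_cont range],
          rule continuous_on_power[OF continuous_on_subset[OF f_rho_cont range]])
    then show "r \<in> borel_measurable borel" "q \<in> borel_measurable borel"
      using borel_measurable_continuous_on_indicator[of "{0<..\<tau> T}" \<rho>]
        borel_measurable_continuous_on_indicator[of "{0<..\<tau> T}" "\<lambda>u. (val f (\<rho> u))\<^sup>2"]
      by (simp_all add: r_def[abs_def] q_def[abs_def])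
  qed
  have id_\<nu>: "(\<lambda>t. t) \<in> measurable \<nu> borel"
    by (subst measurable_cong_sets[OF sets_\<nu> refl]) (auto intro: measurable_restrict_space1)
  have meas_\<nu>: "k \<in> borel_measurable \<nu>" if "k \<in> borel_measurable borel" for k :: "real \<Rightarrow> real"
    by (rule measurable_compose[OF id_\<nu> that])
  have [measurable]: "F \<in> borel_measurable \<nu>" "G \<in> borel_measurable \<nu>"
    by (rule meas_\<nu>; measurable)+
  have F0: "0 \<le> F t" for t using less_imp_le[OF fpos[of t]] cT by (auto simp: F_def indicator_def)
  have q0: "0 \<le> q u" for u by (simp add: q_def)
  have int_F: "integrable \<nu> F"
  proof -
    obtain K where K: "\<And>t. t \<in> {c'..T} \<Longrightarrow> \<bar>val f t ^ 3\<bar> \<le> K"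
      using continuous_on_Icc_bounded[OF continuous_on_power[OF continuous_on_subset[OF f_cont sub]]] by blast
    show ?thesis
    proof (rule integrableI_bounded_set[of "{c'..T}" _ _ K])
      show "{c'..T} \<in> sets \<nu>" unfolding sets_\<nu> using cT by (auto simp: sets_restrict_space_iff)
      show "emeasure \<nu> {c'..T} < \<infinity>"
      proof -
        have "compact {c'..T} \<and> {c'..T} \<subseteq> {0<..}" using cT by auto
        then show ?thesis using \<nu>(1) unfolding radon_on_def by blast
      qed
      show "AE x in \<nu>. x \<in> {c'..T} \<longrightarrow> norm (F x) \<le> K" using K by (intro AE_I2) (auto simp: F_def)
      show "AE x in \<nu>. x \<notin> {c'..T} \<longrightarrow> F x = 0" by (intro AE_I2) (auto simp: F_def)
    qed simp
  qed
  have int_q: "integrable M q"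
    using set_integrable_M[of "\<tau> T" "\<lambda>u. (val f (\<rho> u))\<^sup>2"]
      continuous_on_power[OF continuous_on_subset[OF f_rho_cont tau_range[OF cT(5)]]]
    by (simp add: set_integrable_def q_def[abs_def])
  \<comment> \<open>The right end stays fixed: every ray \<open>{x<..}\<close> meets the interval
    from \<open>c'\<close> to \<open>T\<close> in such a set, and finite agreement on rays suffices
    for \<open>N1 = N2\<close>.\<close>
  have interval: "(LINT t|\<nu>. indicator {e<..<T} t * F t) = (LINT u|M. indicator {e<..<T} (r u) * q u)"
    if e: "c' \<le> e" for e
  proof (cases "e < T")
    case True
    have test: "test_fun (plateau n e T)" for n
      by (rule test_fun_plateau) (use e cT True in auto)
    have eq: "(LINT t|\<nu>. plateau n e T t * F t) = (LINT u|M. plateau n e T (r u) * q u)" for n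
    proof -
      have "(LINT t|\<nu>. plateau n e T t * F t) = (LINT t|\<nu>. plateau n e T t * val f t ^ 3)"
      proof (intro Bochner_Integration.integral_cong refl)
        fix t show "plateau n e T t * F t = plateau n e T t * val f t ^ 3"
          using e plateau_props(3)[of t e T n] by (cases "t \<in> {e<..<T}") (auto simp: F_def)
      qed
      also have "\<dots> = comp_pairing \<mu> (tau f) (plateau n e T)" by (rule \<nu>(3)[OF test])
      also have "\<dots> = (LINT u:{0<..\<tau> T}|M. plateau n e T (\<rho> u) * (val f (\<rho> u))\<^sup>2)"
        by (rule comp_pairing_eq)
          (use e cT in \<open>auto intro!: smooth_continuous smooth_plateau plateau_props(3)\<close>)
      also have "\<dots> = (LINT u|M. plateau n e T (r u) * q u)"
        unfolding set_lebesgue_integral_def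
        by (intro Bochner_Integration.integral_cong refl) (auto simp: r_def q_def indicator_def)
      finally show ?thesis .
    qed
    have "(\<lambda>n. LINT t|\<nu>. plateau n e T t * F t) \<longlonglongrightarrow> (LINT t|\<nu>. indicator {e<..<T} t * F t)"
      by (intro plateau_integral_tendsto int_F id_\<nu>)
    moreover have "(\<lambda>n. LINT u|M. plateau n e T (r u) * q u) \<longlonglongrightarrow> (LINT u|M. indicator {e<..<T} (r u) * q u)"
      by (intro plateau_integral_tendsto int_q) simp
    ultimately show ?thesis unfolding eq by (rule LIMSEQ_unique)
  qed simp
  define w1 where "w1 t = indicator {c'<..<T} t * F t" for t
  define w2 where "w2 u = indicator {c'<..<T} (r u) * q u" for u
  have [measurable]: "w1 \<in> borel_measurable borel" "w2 \<in> borel_measurable borel"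
    unfolding w1_def[abs_def] w2_def[abs_def] by measurable
  have w1_\<nu>: "w1 \<in> borel_measurable \<nu>" by (rule meas_\<nu>) measurable
  note w1_\<nu>[measurable]
  have w0: "0 \<le> w1 t" "0 \<le> w2 u" for t u by (simp_all add: w1_def w2_def F0 q0)
  have int_ind: "integrable \<nu> (\<lambda>t. indicator {e<..<T} t * F t)"
    "integrable M (\<lambda>u. indicator {e<..<T} (r u) * q u)" for e
  proof -
    show "integrable \<nu> (\<lambda>t. indicator {e<..<T} t * F t)"
    proof (rule Bochner_Integration.integrable_bound[OF int_F])
      show "(\<lambda>t. indicator {e<..<T} t * F t) \<in> borel_measurable \<nu>" by (rule meas_\<nu>) measurable
      show "AE t in \<nu>. norm (indicator {e<..<T} t * F t) \<le> norm (F t)"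
        by (intro AE_I2) (simp add: indicator_def)
    qed
    show "integrable M (\<lambda>u. indicator {e<..<T} (r u) * q u)"
    proof (rule Bochner_Integration.integrable_bound[OF int_q])
      show "AE u in M. norm (indicator {e<..<T} (r u) * q u) \<le> norm (q u)"
        by (intro AE_I2) (simp add: indicator_def)
    qed simp
  qed
  define N1 where "N1 = distr (density \<nu> (\<lambda>t. ennreal (w1 t))) borel (\<lambda>t. t)"
  define N2 where "N2 = distr (density M (\<lambda>u. ennreal (w2 u))) borel r"
  have id_dens: "(\<lambda>t. t) \<in> measurable (density \<nu> (\<lambda>t. ennreal (w1 t))) borel"
    using id_\<nu> by simp
  have N1: "emeasure N1 {x<..} = ennreal (LINT t|\<nu>. indicator {max x c'<..<T} t * F t)" for x
  proof -
    have "emeasure N1 {x<..} = emeasure (density \<nu> (\<lambda>t. ennreal (w1 t))) ({x<..} \<inter> {0<..})"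
      unfolding N1_def by (subst emeasure_distr[OF id_dens]) (simp_all only: space_\<nu> space_density vimage_ident greaterThan_borel)
    also have "\<dots> = (\<integral>\<^sup>+t. ennreal (w1 t) * indicator ({x<..} \<inter> {0<..}) t \<partial>\<nu>)"
    proof (rule emeasure_density)
      show "(\<lambda>t. ennreal (w1 t)) \<in> borel_measurable \<nu>"
        by (rule measurable_compose[OF w1_\<nu> measurable_ennreal])
      show "{x<..} \<inter> {0<..} \<in> sets \<nu>" unfolding sets_\<nu> by (simp add: sets_restrict_space_iff)
    qed
    also have "\<dots> = (\<integral>\<^sup>+t. ennreal (indicator {max x c'<..<T} t * F t) \<partial>\<nu>)"
      by (intro nn_integral_cong) (auto simp: w1_def indicator_def space_\<nu>)
    also have "\<dots> = ennreal (LINT t|\<nu>. indicator {max x c'<..<T} t * F t)"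
      using int_ind(1) F0 by (intro nn_integral_eq_integral) auto
    finally show ?thesis .
  qed
  have N2: "emeasure N2 {x<..} = ennreal (LINT u|M. indicator {max x c'<..<T} (r u) * q u)" for x
  proof -
    have "emeasure N2 {x<..} = emeasure (density M (\<lambda>u. ennreal (w2 u))) (r -` {x<..})"
      unfolding N2_def by (subst emeasure_distr) auto
    also have "\<dots> = (\<integral>\<^sup>+u. ennreal (w2 u) * indicator (r -` {x<..}) u \<partial>M)"
      using measurable_sets[OF \<open>r \<in> borel_measurable borel\<close>, of "{x<..}"]
      by (subst emeasure_density) auto
    also have "\<dots> = (\<integral>\<^sup>+u. ennreal (indicator {max x c'<..<T} (r u) * q u) \<partial>M)"
      by (intro nn_integral_cong) (auto simp: w2_def indicator_def)
    also have "\<dots> = ennreal (LINT u|M. indicator {max x c'<..<T} (r u) * q u)"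
      using int_ind(2) q0 by (intro nn_integral_eq_integral) auto
    finally show ?thesis .
  qed
  have "N1 = N2"
    by (rule measure_eqI_lessThan) (use N1 N2 interval in \<open>auto simp: N1_def N2_def\<close>)
  have "(LINT t|\<nu>. \<psi> t) = (LINT t|\<nu>. w1 t *\<^sub>R G t)"
  proof (intro Bochner_Integration.integral_cong refl)
    fix t assume "t \<in> space \<nu>"
    then have "0 < val f t" using fpos by (simp add: space_\<nu>)
    then show "\<psi> t = w1 t *\<^sub>R G t"
      using t.outside[of t] cT by (auto simp: w1_def F_def G_def indicator_def)
  qed
  also have "\<dots> = (LINT t|density \<nu> (\<lambda>t. ennreal (w1 t)). G t)"
    using w0 by (intro integral_density[symmetric]) auto
  also have "\<dots> = (LINT t|N1. G t)"
    unfolding N1_def by (rule integral_distr[symmetric, OF id_dens]) simp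
  also have "\<dots> = (LINT u|density M (\<lambda>u. ennreal (w2 u)). G (r u))"
    unfolding \<open>N1 = N2\<close> N2_def by (rule integral_distr) simp_all
  also have "\<dots> = (LINT u|M. w2 u *\<^sub>R G (r u))"
    using w0 by (intro integral_density) auto
  also have "\<dots> = (LINT u:{0<..\<tau> T}|M. \<psi> (\<rho> u) * \<phi> u)"
    unfolding set_lebesgue_integral_def
  proof (intro Bochner_Integration.integral_cong refl)
    fix u show "w2 u *\<^sub>R G (r u) = indicator {0<..\<tau> T} u *\<^sub>R (\<psi> (\<rho> u) * \<phi> u)"
    proof (cases "u \<in> {0<..\<tau> T}")
      case True
      then have "0 < val f (\<rho> u)" using pos[OF rho_mem] range by auto
      then show ?thesis
        using True t.outside[of "\<rho> u"] cT
        by (cases "\<rho> u \<in> {c..d}")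
          (auto simp: w2_def q_def r_def G_def power2_eq_square power3_eq_cube)
    qed (simp add: w2_def q_def)
  qed
  finally show "(LBINT t:{0..}. val f t * (deriv ^^ 2) \<psi> t) = - (LINT u:{0<..\<tau> (d + 1)}|M. \<psi> (\<rho> u) * \<phi> u)"
    using \<nu>(2)[of \<psi>] \<psi> test_fun_iff by (auto simp: T_def)
qed

end

section \<open>Solutions\<close>

context pos_path
begin

text \<open>\<open>D\<close> is monotone along \<open>\<tau>\<close>, so its values at the two ends
  bound its mean. These are the support inequalities of a convex function, available also where
  \<open>J\<close> is not differentiable.\<close>

lemma J_diff_bounds:
  assumes t: "t \<in> ival a" and s: "0 \<le> s" "s \<le> t"
  shows "(t - s) * D (\<tau> s) \<le> J t - J s" "J t - J s \<le> (t - s) * D (\<tau> t)"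
proof -
  have int: "(\<lambda>r. D (\<tau> r)) integrable_on {0..t}" "(\<lambda>r. D (\<tau> r)) integrable_on {s..t}"
    using D_tau_integrable[OF t] s by (auto intro: integrable_subinterval_real)
  have J: "J t - J s = integral {s..t} (\<lambda>r. D (\<tau> r))"
    using Henstock_Kurzweil_Integration.integral_combine[OF s int(1)] by (simp add: J_def)
  have mono: "D (\<tau> x) \<le> D (\<tau> y)" if "0 \<le> x" "x \<le> y" "y \<le> t" for x y
    using that ival_le[OF t, of x] ival_le[OF t, of y] tau_le_iff[of x y] D_mono[OF tau_mem] by auto
  have "integral {s..t} (\<lambda>_. D (\<tau> s)) \<le> integral {s..t} (\<lambda>r. D (\<tau> r))"
    using s mono by (intro integral_le int) auto
  then show "(t - s) * D (\<tau> s) \<le> J t - J s" using s by (simp add: J)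
  have "integral {s..t} (\<lambda>r. D (\<tau> r)) \<le> integral {s..t} (\<lambda>_. D (\<tau> t))"
    using s mono by (intro integral_le int) auto
  then show "J t - J s \<le> (t - s) * D (\<tau> t)" using s by (simp add: J)
qed

end

context half_line_path
begin

lemma mild_val: "mild M f x p \<Longrightarrow> 0 \<le> t \<Longrightarrow> val f t = x + p * t - J t"
  by (simp add: mild_iff_J)

text \<open>At the intermediate point \<open>z\<close>, the number \<open>D (\<tau> z)\<close>
  bounds the slope of \<open>J\<close> from above on the left and from below on the right.\<close>

lemma mild_concave:
  assumes "mild M f x p"
  shows "concave_on {0..} (val f)"
  unfolding concave_on_def
proof (rule convex_on_linorderI)
  fix r x' y :: real assume r: "0 < r" "r < 1" and xy: "x' \<in> {0..}" "y \<in> {0..}" "x' < y"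
  define z where "z = (1 - r) *\<^sub>R x' + r *\<^sub>R y"
  have z: "z - x' = r * (y - x')" "y - z = (1 - r) * (y - x')" by (simp_all add: z_def algebra_simps)
  have zx: "x' \<le> z" "z \<le> y"
  proof -
    have "0 \<le> z - x'" "0 \<le> y - z" unfolding z using r xy by simp_all
    then show "x' \<le> z" "z \<le> y" by simp_all
  qed
  have 1: "J z - J x' \<le> (z - x') * D (\<tau> z)" "(y - z) * D (\<tau> z) \<le> J y - J z"
    using J_diff_bounds(2)[of z x'] J_diff_bounds(1)[of y z] zx xy by auto
  have "(1 - r) * (J z - J x') \<le> (1 - r) * ((z - x') * D (\<tau> z))"
    using 1(1) r by (intro mult_left_mono) auto
  also have "\<dots> = r * ((y - z) * D (\<tau> z))" unfolding z by simp
  also have "\<dots> \<le> r * (J y - J z)" using 1(2) r by (intro mult_left_mono) auto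
  finally have "J z \<le> (1 - r) * J x' + r * J y" by (simp add: algebra_simps)
  moreover have "x + p * z = (1 - r) * (x + p * x') + r * (x + p * y)" by (simp add: z_def algebra_simps)
  ultimately show "- val f ((1 - r) *\<^sub>R x' + r *\<^sub>R y) \<le> (1 - r) * - val f x' + r * - val f y"
    unfolding z_def[symmetric] using xy zx by (simp add: mild_val[OF assms] algebra_simps)
qed (simp add: convex_real_interval)

text \<open>A positive concave function on a half-line cannot have negative slope anywhere: it would
  lie below a line that reaches 0.\<close>

lemma mild_mono:
  assumes "mild M f x p"
  shows "mono_on {0..} (val f)"
proof (rule mono_onI)
  have slope: "D (\<tau> s) \<le> p" if s: "0 \<le> s" for s
  proof (rule ccontr)
    assume "\<not> D (\<tau> s) \<le> p"
    then have neg: "0 < D (\<tau> s) - p" by simp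
    \<comment> \<open>The zero of the line through the point over \<open>s\<close> with slope
      \<open>p - D (\<tau> s)\<close>.\<close>
    define t where "t = s + val f s / (D (\<tau> s) - p)"
    have fs: "0 < val f s" using pos[of s] s by simp
    then have t: "s \<le> t" using neg by (simp add: t_def)
    have "(t - s) * D (\<tau> s) \<le> J t - J s" using J_diff_bounds(1)[of t s] s t by simp
    then have "val f t \<le> val f s - (t - s) * (D (\<tau> s) - p)"
      using s t by (simp add: mild_val[OF assms] algebra_simps)
    also have "\<dots> = 0" using neg by (simp add: t_def)
    finally show False using pos[of t] s t by simp
  qed
  fix s t :: real assume st: "s \<in> {0..}" "t \<in> {0..}" "s \<le> t"
  have "J t - J s \<le> (t - s) * D (\<tau> t)" using J_diff_bounds(2)[of t s] st by simp
  also have "\<dots> \<le> (t - s) * p" using slope[of t] st by (intro mult_left_mono) auto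
  finally show "val f s \<le> val f t" using st by (simp add: mild_val[OF assms] algebra_simps)
qed

text \<open>Without an atom at \<open>\<tau> t\<close> the slope \<open>p - D (\<tau> s)\<close> is
  continuous at \<open>s = t\<close>, and the fundamental theorem of calculus needs continuity of
  the integrand at that one point.\<close>

lemma mild_differentiable:
  assumes "mild M f x p" "0 \<le> t" "t = 0 \<or> emeasure M {\<tau> t} = 0"
  shows "val f differentiable (at t within {0..})"
proof -
  have "continuous (at t within {0..}) (\<lambda>s. D (\<tau> s))"
    using D_tau_cont[of t] assms(2,3) by simp
  then have c: "continuous (at t within {0..t + 1} - {}) (\<lambda>s. D (\<tau> s))"
    by (rule continuous_within_subset) auto
  have "((\<lambda>u. integral {0..u} (\<lambda>s. D (\<tau> s))) has_vector_derivative D (\<tau> t)) (at t within {0..t + 1} - {})"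
    by (rule integral_has_vector_derivative_continuous_at[OF _ _ _ c])
      (use assms(2) D_tau_integrable[of "t + 1"] in auto)
  moreover have "at t within {0..t + 1} = at t within {0..}"
    using assms(2) by (intro at_within_nhd[of _ "{..<t + 1}"]) auto
  ultimately have "(J has_real_derivative D (\<tau> t)) (at t within {0..})"
    by (simp add: J_def[abs_def] has_real_derivative_iff_has_vector_derivative)
  then have "((\<lambda>t. x + p * t - J t) has_real_derivative p - D (\<tau> t)) (at t within {0..})"
    by (auto intro!: derivative_eq_intros)
  then have "(val f has_real_derivative p - D (\<tau> t)) (at t within {0..})"
    by (rule has_field_derivative_transform_within[where d = 1]) (use assms in \<open>auto simp: mild_val\<close>)
  then show ?thesis
    unfolding has_field_derivative_def by (rule differentiableI)
qed

end

abbreviation on_line :: "real measure \<Rightarrow> real measure" where "on_line \<mu> \<equiv> distr \<mu> borel (\<lambda>x. x)"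

lemma radon_loc_finite:
  assumes "radon_on {0..} \<mu>"
  shows "loc_finite_measure (on_line \<mu>)"
    and "0 \<le> v \<Longrightarrow> emeasure (on_line \<mu>) {v} = emeasure \<mu> {v}"
proof -
  have sets_\<mu>: "sets \<mu> = sets (restrict_space borel {0..})" using assms by (simp add: radon_on_def)
  have space_\<mu>: "space \<mu> = {0..}"
    using sets_eq_imp_space_eq[OF sets_\<mu>] by (simp add: space_restrict_space)
  have id: "(\<lambda>x. x) \<in> measurable \<mu> borel"
    by (subst measurable_cong_sets[OF sets_\<mu> refl]) (auto intro: measurable_restrict_space1)
  have em: "emeasure (on_line \<mu>) A = emeasure \<mu> (A \<inter> {0..})" if "A \<in> sets borel" for A
    using emeasure_distr[OF id that] by (simp only: vimage_ident space_\<mu>)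
  show "loc_finite_measure (on_line \<mu>)"
  proof
    fix U :: real
    have "compact {0..U} \<and> {0..U} \<subseteq> {0..}" by auto
    then have "emeasure \<mu> {0..U} < \<infinity>" using assms unfolding radon_on_def by blast
    moreover have "{..U} \<inter> {0..} = {0..U}" by auto
    ultimately show "emeasure (on_line \<mu>) {..U} < \<infinity>" by (simp only: em atMost_borel)
  qed simp
  have "{v} \<inter> {0..} = {v}" if "0 \<le> v" using that by auto
  then show "emeasure (on_line \<mu>) {v} = emeasure \<mu> {v}" if "0 \<le> v"
    using that em[of "{v}"] by simp
qed

lemma pos_solution_iff:
  assumes "radon_on {0..} \<mu>"
  shows "pos_solution \<mu> g \<longleftrightarrow> (\<exists>b x p. pos_path g \<infinity> b (on_line \<mu>) \<and>
    mild (on_line \<mu>) g x p)"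
proof
  assume L: "pos_solution \<mu> g"
  then obtain a b where ab: "A_path g a b" by (auto simp: pos_solution_def solves_ode_def A_inf_iff)
  have "dom g = {0..}" using L by (simp add: pos_solution_def solves_ode_def)
  moreover have "dom g = ival a" "0 < a" using A_path.axioms(1)[OF ab] by (simp_all add: path_def)
  ultimately have "a = \<infinity>" using ival_inject[of a \<infinity>] by simp
  then interpret A_path g \<infinity> b using ab by simp
  interpret loc_finite_measure "on_line \<mu>" by (rule radon_loc_finite[OF assms])
  have "pos_path g \<infinity> b (on_line \<mu>)"
    by unfold_locales (use L in \<open>auto simp: pos_solution_def\<close>)
  then interpret pos_path g \<infinity> b "on_line \<mu>" .
  interpret ode_path g b \<mu> by unfold_locales (rule assms)
  obtain p where "mild (on_line \<mu>) g (val g 0) p"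
    by (rule mild_of_solves_ode) (use L in \<open>auto simp: pos_solution_def\<close>)
  then show "\<exists>b x p. pos_path g \<infinity> b (on_line \<mu>) \<and> mild (on_line \<mu>) g x p"
    using \<open>pos_path g \<infinity> b (on_line \<mu>)\<close> by blast
next
  assume "\<exists>b x p. pos_path g \<infinity> b (on_line \<mu>) \<and> mild (on_line \<mu>) g x p"
  then obtain b x p where *: "pos_path g \<infinity> b (on_line \<mu>)" "mild (on_line \<mu>) g x p"
    by blast
  interpret pos_path g \<infinity> b "on_line \<mu>" by (rule *)
  interpret ode_path g b \<mu> by unfold_locales (rule assms)
  show "pos_solution \<mu> g"
    unfolding pos_solution_def using solves_ode_of_mild[OF *(2)] pos by simp
qed

lemma S_op_id:
  assumes "A_path f \<infinity> b"
  shows "S_op 1 0 f = f"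
proof -
  interpret A_path f \<infinity> b by (rule assms)
  have a: "a_idx 1 0 \<infinity> = \<infinity>" by (simp add: a_idx_def)
  interpret S: A_path "S_op 1 0 f" \<infinity> "b_idx 1 0 \<infinity> b f"
    using A_path_S[of 1 0] by (simp add: a)
  show ?thesis
    by (rule pfun_eqI) (use S.dom dom S_formula[of 1 _ 0] in \<open>auto simp: a\<close>)
qed

lemma a_idx_PInf: "0 < \<alpha> \<Longrightarrow> 0 \<le> \<beta> \<Longrightarrow> a_idx \<alpha> \<beta> \<infinity> = \<infinity>"
  by (auto simp: a_idx_def)

text \<open>Initial data determine a solution, and \<open>S_op\<close> reaches all data with
  positive value at 0. What remains is to exclude \<beta> < 0, since the image then lives on a
  bounded interval only.\<close>

lemma classification:
  assumes f: "pos_path f \<infinity> \<infinity> M" "mild M f 1 p" and g: "pos_path g \<infinity> B M" "mild M g y q"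
  shows "0 < y \<and> (\<exists>\<beta>\<ge>0. g = S_op (1 / y) \<beta> f)"
proof -
  interpret f: pos_path f \<infinity> \<infinity> M by (rule f)
  interpret g: pos_path g \<infinity> B M by (rule g)
  have y: "0 < y" using g.mild_at_0[OF g(2)] g.pos[of 0] by simp
  \<comment> \<open>By \<open>mild_S\<close> the data 1 and \<open>p\<close> become
    \<open>1 / \<alpha>\<close> and \<open>\<beta> + p * \<alpha>\<close>; these are equated with
    \<open>y\<close> and \<open>q\<close>.\<close>
  define \<alpha> where "\<alpha> = 1 / y"
  define \<beta> where "\<beta> = q - p * \<alpha>"
  have \<alpha>: "0 < \<alpha>" using y by (simp add: \<alpha>_def)
  define h where "h = S_op \<alpha> \<beta> f"
  have hp: "pos_path h (a_idx \<alpha> \<beta> \<infinity>) (b_idx \<alpha> \<beta> \<infinity> \<infinity> f) M"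
    unfolding h_def by (rule f.pos_path_S[OF \<alpha>])
  have hm: "mild M h y q"
    using f.mild_S[OF \<alpha> f(2), of \<beta>] by (simp add: h_def \<alpha>_def \<beta>_def)
  have eq: "val h t = val g t" if "t \<in> ival (a_idx \<alpha> \<beta> \<infinity>)" for t
    by (rule mild_unique[OF hp hm g that]) (use ival_nonneg[OF that] in simp)
  have "0 \<le> \<beta>"
  proof (rule ccontr)
    assume "\<not> 0 \<le> \<beta>"
    then have \<beta>: "\<beta> < 0" by simp
    \<comment> \<open>The length of the domain of \<open>h\<close>. There \<open>tau h\<close> takes
      every nonnegative value, among them \<open>g.\<tau> s + 1\<close>; but \<open>h\<close> agrees
      with \<open>g\<close> on this domain, and \<open>g.\<tau>\<close> stays below its value at
      \<open>s\<close>.\<close>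
    define s where "s = - 1 / (\<alpha> * \<beta>)"
    have "ereal \<alpha> * (ereal \<alpha> - ereal \<beta> * \<infinity>) > 0" using \<alpha> \<beta> by simp
    then have idx: "a_idx \<alpha> \<beta> \<infinity> = ereal s" "b_idx \<alpha> \<beta> \<infinity> \<infinity> f = \<infinity>"
      using \<beta> by (simp_all add: a_idx_def b_idx_def s_def)
    interpret h: pos_path h "ereal s" \<infinity> M using hp by (simp only: idx)
    have s: "0 < s" using h.a_pos by simp
    define u where "u = g.\<tau> s + 1"
    have u: "u \<in> ival \<infinity>" using g.tau_nonneg[of s] s by (simp add: u_def)
    define t where "t = h.\<rho> u"
    have t: "t \<in> ival (ereal s)" using h.rho_mem[OF u] by (simp add: t_def)
    have t': "0 \<le> t" "t < s" using t by (auto simp: ival_def)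
    have "u = h.\<tau> t" using h.tau_rho[OF u] by (simp add: t_def)
    also have "\<dots> = integral {0..t} (\<lambda>r. 1 / (val h r)\<^sup>2)" by (rule h.tau_val[OF t])
    also have "\<dots> = integral {0..t} (\<lambda>r. 1 / (val g r)\<^sup>2)"
      using eq ival_le[OF t] by (intro Henstock_Kurzweil_Integration.integral_cong) (auto simp: idx)
    also have "\<dots> = g.\<tau> t" using g.tau_val[of t] t' by simp
    also have "\<dots> \<le> g.\<tau> s" using g.tau_le_iff[of t s] t' by simp
    finally show False by (simp add: u_def)
  qed
  then have a: "a_idx \<alpha> \<beta> \<infinity> = \<infinity>" by (rule a_idx_PInf[OF \<alpha>])
  interpret h: pos_path h \<infinity> "b_idx \<alpha> \<beta> \<infinity> \<infinity> f" M using hp by (simp only: a)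
  have "g = h"
    by (rule pfun_eqI) (use eq g.dom h.dom in \<open>auto simp: a\<close>)
  then show ?thesis using y \<open>0 \<le> \<beta>\<close> by (auto simp: h_def \<alpha>_def)
qed

lemma pos_solution_S:
  assumes \<mu>: "radon_on {0..} \<mu>" and f: "pos_path f \<infinity> b (on_line \<mu>)"
    "mild (on_line \<mu>) f x p" and "0 < \<alpha>" "0 \<le> \<beta>"
  shows "pos_solution \<mu> (S_op \<alpha> \<beta> f)"
  using pos_path.pos_path_S[OF f(1) \<open>0 < \<alpha>\<close>, of \<beta>] pos_path.mild_S[OF f(1) \<open>0 < \<alpha>\<close> f(2), of \<beta>]
  unfolding pos_solution_iff[OF \<mu>] a_idx_PInf[OF assms(4,5)] by blast

lemma distinguished_solutionD:
  assumes \<mu>: "radon_on {0..} \<mu>" and "distinguished_solution \<mu> f"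
  obtains p where "pos_path f \<infinity> \<infinity> (on_line \<mu>)" "mild (on_line \<mu>) f 1 p"
proof -
  obtain b x p where *: "pos_path f \<infinity> b (on_line \<mu>)" "mild (on_line \<mu>) f x p"
    using assms(2) by (auto simp: distinguished_solution_def pos_solution_iff[OF \<mu>])
  interpret pos_path f \<infinity> b "on_line \<mu>" by (rule *)
  have "tau_at f \<infinity> = \<infinity>" using assms(2) by (simp add: distinguished_solution_def A_space_def)
  then have "b = \<infinity>" using tau_at_eq by simp
  moreover have "x = 1" using mild_at_0[OF *(2)] assms(2) by (simp add: distinguished_solution_def)
  ultimately show thesis using * by (intro that) auto
qed

lemma distinguished_solution_exists:
  assumes \<mu>: "radon_on {0..} \<mu>"
  shows "\<exists>f. distinguished_solution \<mu> f"
proof -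
  interpret loc_finite_measure "on_line \<mu>" by (rule radon_loc_finite[OF \<mu>])
  obtain f1 L where f1: "pos_path f1 L \<infinity> (on_line \<mu>)" "mild (on_line \<mu>) f1 1 0"
    by (rule mild_exists)
  interpret f1: pos_path f1 L \<infinity> "on_line \<mu>" by (rule f1)
  \<comment> \<open>For finite \<open>L\<close> the critical value:
    \<open>1 - \<beta> * L = 0\<close> puts both indices into their second case, so the domain
    becomes infinite while the limit of \<open>tau\<close> is \<open>tau_at f1 L\<close>, which is
    infinite.\<close>
  define \<beta> where "\<beta> = (if L = \<infinity> then 0 else 1 / real_of_ereal L)"
  have idx: "a_idx 1 \<beta> L = \<infinity>" "b_idx 1 \<beta> L \<infinity> f1 = \<infinity>"
  proof -
    have "a_idx 1 \<beta> L = \<infinity> \<and> b_idx 1 \<beta> L \<infinity> f1 = \<infinity>"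
    proof (cases L)
      case (real r)
      have "0 < r" using f1.a_pos real by simp
      then show ?thesis using real f1.tau_at_eq by (simp add: \<beta>_def a_idx_def b_idx_def flip: one_ereal_def)
    next
      case PInf
      then show ?thesis by (simp add: \<beta>_def a_idx_def b_idx_def)
    qed (use f1.a_pos in simp)
    then show "a_idx 1 \<beta> L = \<infinity>" "b_idx 1 \<beta> L \<infinity> f1 = \<infinity>" by auto
  qed
  define f where "f = S_op 1 \<beta> f1"
  have pp: "pos_path f \<infinity> \<infinity> (on_line \<mu>)"
    using f1.pos_path_S[of 1 \<beta>] by (simp add: f_def idx)
  have mild: "mild (on_line \<mu>) f 1 \<beta>"
    using f1.mild_S[of 1 1 0 \<beta>] f1(2) by (simp add: f_def)
  interpret f: pos_path f \<infinity> \<infinity> "on_line \<mu>" by (rule pp)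
  interpret f: half_line_path f \<infinity> "on_line \<mu>" by unfold_locales
  have "distinguished_solution \<mu> f"
    unfolding distinguished_solution_def
  proof (intro conjI allI impI)
    show "pos_solution \<mu> f" unfolding pos_solution_iff[OF \<mu>] using pp mild by blast
    show "f \<in> A_space \<infinity> \<infinity>" using f.A_path_axioms by (simp add: A_space_iff)
    show "val f 0 = 1" by (rule f.mild_at_0[OF mild])
    show "mono_on {0..} (val f)" by (rule f.mild_mono[OF mild])
    show "concave_on {0..} (val f)" by (rule f.mild_concave[OF mild])
    fix t :: real assume t: "0 \<le> t" "t = 0 \<or> emeasure \<mu> {val (tau f) t} = 0"
    show "val f differentiable (at t within {0..})"
      by (rule f.mild_differentiable[OF mild t(1)])
        (use t radon_loc_finite(2)[OF \<mu>, of "val (tau f) t"] f.tau_nonneg[of t] in auto)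
  qed
  then show ?thesis by blast
qed

text \<open>Equal values at 0 leave \<open>g = S_op 1 \<beta> f\<close> with \<beta> \<ge> 0. For
  \<beta> > 0 the limit of \<open>tau g\<close> would be the finite number
  \<open>f.\<tau> (1 / \<beta>)\<close>, against the normalization.\<close>

lemma distinguished_solution_unique:
  assumes \<mu>: "radon_on {0..} \<mu>" and f: "distinguished_solution \<mu> f" and g: "distinguished_solution \<mu> g"
  shows "g = f"
proof -
  obtain p where f': "pos_path f \<infinity> \<infinity> (on_line \<mu>)" "mild (on_line \<mu>) f 1 p"
    using distinguished_solutionD[OF \<mu> f] .
  obtain q where g': "pos_path g \<infinity> \<infinity> (on_line \<mu>)" "mild (on_line \<mu>) g 1 q"
    using distinguished_solutionD[OF \<mu> g] .
  obtain \<beta> where \<beta>: "0 \<le> \<beta>" "g = S_op 1 \<beta> f" using classification[OF f' g'] by auto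
  interpret f: pos_path f \<infinity> \<infinity> "on_line \<mu>" by (rule f')
  interpret g: pos_path g \<infinity> \<infinity> "on_line \<mu>" by (rule g')
  have "\<beta> = 0"
  proof (rule ccontr)
    assume "\<beta> \<noteq> 0"
    then have pos: "0 < \<beta>" using \<beta>(1) by simp
    have "A_path g \<infinity> (b_idx 1 \<beta> \<infinity> \<infinity> f)"
      using f.A_path_S[of 1 \<beta>] by (simp add: \<beta>(2) a_idx_PInf \<beta>(1))
    then have "b_idx 1 \<beta> \<infinity> \<infinity> f = \<infinity>"
      using g.tau_at_eq by (simp add: A_path_def A_path_axioms_def)
    moreover have "b_idx 1 \<beta> \<infinity> \<infinity> f = tau_at f (ereal (1 / \<beta>))" using pos by (simp add: b_idx_def)
    moreover have "tau_at f (ereal (1 / \<beta>)) = ereal (f.\<tau> (1 / \<beta>))"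
      using pos f.dom by (simp add: tau_at_def)
    ultimately show False by simp
  qed
  then show ?thesis using \<beta>(2) S_op_id[OF f.A_path_axioms] by simp
qed

theorem theorem1p1:
  shows "(\<forall>\<alpha> \<beta> :: real. \<alpha> \<noteq> 0 \<longrightarrow>
            (\<forall>f\<in>A_inf. S_op \<alpha> \<beta> f \<in> A_inf) \<and>
            (\<forall>f\<in>A_inf. \<forall>g\<in>A_inf. \<forall>c d. dom f = dom g \<and> lincomb c f d g \<in> A_inf \<longrightarrow>
               S_op \<alpha> \<beta> (lincomb c f d g) = lincomb c (S_op \<alpha> \<beta> f) d (S_op \<alpha> \<beta> g)) \<and>
            (\<forall>f\<in>A_inf. \<forall>t\<in>dom (S_op \<alpha> \<beta> f).
               1 + \<alpha> * \<beta> * t \<noteq> 0 \<and> \<alpha>\<^sup>2 * t / (1 + \<alpha> * \<beta> * t) \<in> dom f \<and>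
               val (S_op \<alpha> \<beta> f) t =
                 (1 + \<alpha> * \<beta> * t) / \<alpha> * val f (\<alpha>\<^sup>2 * t / (1 + \<alpha> * \<beta> * t))) \<and>
            (\<forall>a b f. 0 < a \<and> 0 < b \<and> f \<in> A_space a b \<longrightarrow>
               S_op \<alpha> \<beta> f \<in> A_space (a_idx \<alpha> \<beta> a) (b_idx \<alpha> \<beta> a b f)))
       \<and>
         (\<forall>\<mu> :: real measure. radon_on {0..} \<mu> \<and> emeasure \<mu> {0..} \<noteq> 0 \<longrightarrow>
            (\<exists>!f. distinguished_solution \<mu> f) \<and>
            (\<forall>f. distinguished_solution \<mu> f \<longrightarrow>
               {S_op \<alpha> \<beta> f | \<alpha> \<beta>. \<alpha> > 0 \<and> \<beta> \<ge> 0} = {g. pos_solution \<mu> g}))"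
proof (intro conjI allI impI)
  fix \<alpha> \<beta> :: real assume \<alpha>: "\<alpha> \<noteq> 0"
  show "\<forall>f\<in>A_inf. S_op \<alpha> \<beta> f \<in> A_inf"
  proof
    fix f assume "f \<in> A_inf"
    then obtain a b where "A_path f a b" by (auto simp: A_inf_iff)
    then show "S_op \<alpha> \<beta> f \<in> A_inf" using A_path.A_path_S[OF _ \<alpha>] A_inf_iff by blast
  qed
  show "\<forall>f\<in>A_inf. \<forall>g\<in>A_inf. \<forall>c d. dom f = dom g \<and> lincomb c f d g \<in> A_inf \<longrightarrow>
      S_op \<alpha> \<beta> (lincomb c f d g) = lincomb c (S_op \<alpha> \<beta> f) d (S_op \<alpha> \<beta> g)"
    using S_op_lincomb[OF \<alpha>] by blast
  show "\<forall>f\<in>A_inf. \<forall>t\<in>dom (S_op \<alpha> \<beta> f).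
      1 + \<alpha> * \<beta> * t \<noteq> 0 \<and> \<alpha>\<^sup>2 * t / (1 + \<alpha> * \<beta> * t) \<in> dom f \<and>
      val (S_op \<alpha> \<beta> f) t = (1 + \<alpha> * \<beta> * t) / \<alpha> * val f (\<alpha>\<^sup>2 * t / (1 + \<alpha> * \<beta> * t))"
  proof (intro ballI)
    fix f t assume f: "f \<in> A_inf" and t: "t \<in> dom (S_op \<alpha> \<beta> f)"
    obtain a b where ab: "A_path f a b" using f A_inf_iff by blast
    interpret A_path f a b by (rule ab)
    have "t \<in> ival (a_idx \<alpha> \<beta> a)"
      using t A_path.axioms(1)[OF A_path_S[OF \<alpha>, of \<beta>]] by (simp add: path_def)
    note S = S_formula[OF \<alpha> this]
    show "1 + \<alpha> * \<beta> * t \<noteq> 0 \<and> \<alpha>\<^sup>2 * t / (1 + \<alpha> * \<beta> * t) \<in> dom f \<and>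
      val (S_op \<alpha> \<beta> f) t = (1 + \<alpha> * \<beta> * t) / \<alpha> * val f (\<alpha>\<^sup>2 * t / (1 + \<alpha> * \<beta> * t))"
      unfolding dom using S by (intro conjI) (simp_all only:, linarith)
  qed
  fix a b :: ereal and f assume ab: "0 < a \<and> 0 < b \<and> f \<in> A_space a b"
  interpret A_path f a b using ab A_space_iff by blast
  show "S_op \<alpha> \<beta> f \<in> A_space (a_idx \<alpha> \<beta> a) (b_idx \<alpha> \<beta> a b f)"
    using A_path_S[OF \<alpha>, of \<beta>] A_space_iff path.a_pos[OF A_path.axioms(1)[OF A_path_S[OF \<alpha>, of \<beta>]]] by blast
next
  fix \<mu> :: "real measure" assume "radon_on {0..} \<mu> \<and> emeasure \<mu> {0..} \<noteq> 0"
  then have \<mu>: "radon_on {0..} \<mu>" by simp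
  show "\<exists>!f. distinguished_solution \<mu> f"
    using distinguished_solution_exists[OF \<mu>] distinguished_solution_unique[OF \<mu>] by blast
  fix f assume "distinguished_solution \<mu> f"
  then obtain p where f: "pos_path f \<infinity> \<infinity> (on_line \<mu>)" "mild (on_line \<mu>) f 1 p"
    using distinguished_solutionD[OF \<mu>] by blast
  show "{S_op \<alpha> \<beta> f | \<alpha> \<beta>. \<alpha> > 0 \<and> \<beta> \<ge> 0} = {g. pos_solution \<mu> g}"
  proof
    show "{S_op \<alpha> \<beta> f | \<alpha> \<beta>. \<alpha> > 0 \<and> \<beta> \<ge> 0} \<subseteq> {g. pos_solution \<mu> g}"
      using pos_solution_S[OF \<mu> f] by blast
    show "{g. pos_solution \<mu> g} \<subseteq> {S_op \<alpha> \<beta> f | \<alpha> \<beta>. \<alpha> > 0 \<and> \<beta> \<ge> 0}"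
    proof
      fix g assume "g \<in> {g. pos_solution \<mu> g}"
      then obtain B y q where "pos_path g \<infinity> B (on_line \<mu>)" "mild (on_line \<mu>) g y q"
        using pos_solution_iff[OF \<mu>] by blast
      then obtain \<beta> where "0 < y" "0 \<le> \<beta>" "g = S_op (1 / y) \<beta> f" using classification[OF f] by blast
      then show "g \<in> {S_op \<alpha> \<beta> f | \<alpha> \<beta>. \<alpha> > 0 \<and> \<beta> \<ge> 0}"
        by (intro CollectI exI[of _ "1 / y"] exI[of _ \<beta>]) simp
    qed
  qed
qed

end
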